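(* Let $X=(X_t,\ t\ge0)$ be a homogeneous Lévy process with a.s. right-continuous trajectories, $X_0=0$ and generating triplet $(a,\gamma,\nu)$, and let $K(u)=\nu((-\infty,-u]\cup[u,\infty))$, $u>0$. Assume either $a>0$, in which case put $\alpha:=2$; or else $a=0$ and there exist $0<\alpha\le2$ and $c>0$ such that $K(u)\sim c\,u^{-\alpha}$ as $u\downarrow0$. Let $X^{(1)},X^{(2)}$ be independent copies of $X$, and let $Z_\alpha$ be a random variable with characteristic function $\mathrm{E}e^{i\theta Z_\alpha}=e^{-|\theta|^\alpha}$ and independent copies $Z_\alpha^{(1)},Z_\alpha^{(2)},Z_\alpha^{(3)}$. Then: 1. $t^{-1/\alpha}(X^{(1)}_t-X^{(2)}_t)\to\tilde c\,Z_\alpha$ in distribution as $t\to0$, for some constant $\tilde c>0$ (depending on the generating triplet of $X$); 2. with $\tilde\Lambda(\alpha):=\mathrm{E}\,\psi(Z_\alpha^{(1)},Z_\alpha^{(2)})$, one has $\mathrm{E}\tilde R^{2,n}\to\tilde\Lambda(\alpha)$ and $\tilde R^{2,n}\to\tilde\Lambda(\alpha)$ a.s. as $n\to\infty$ ($n$ even); 3. with $\tilde\sigma^2(\alpha):=2\,\mathrm{var}\big(\psi(Z_\alpha^{(1)},Z_\alpha^{(2)})\big)+4\,\mathrm{cov}\big(\psi(Z_\alpha^{(1)},Z_\alpha^{(2)}),\psi(Z_\alpha^{(2)},Z_\alpha^{(3)})\big)$, $$\sqrt n\,(\tilde R^{2,n}-\mathrm{E}\tilde R^{2,n})\longrightarrow\mathcal{N}(0,\tilde\sigma^2(\alpha))\quad\text{in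 distribution as } n\to\infty\ (n\text{ even}).$$
   Context: The generating triplet $(a,\gamma,\nu)$ ($a\ge0$, $\gamma\in\mathbb{R}$, $\nu$ a measure on $\mathbb{R}$ with no mass at $0$ and $\int\min(u^2,1)\nu(du)<\infty$) is defined by $\mathrm{E}e^{i\theta X_t}=\exp\{t(i\gamma\theta-\frac12a^2\theta^2+\int_{\mathbb{R}}(e^{iu\theta}-1-iu\theta\mathbf{1}(|u|\le1))\nu(du))\}$. $\psi(x,y)=\frac{|x+y|}{|x|+|y|}$ with $\frac00:=1$. For even $n\ge4$, $$\tilde R^{2,n}=\frac{1}{n/2-1}\sum_{k=0}^{(n-4)/2}\psi\big(\Delta^{2,n}_{2k}X,\Delta^{2,n}_{2k+2}X\big),\qquad \Delta^{2,n}_jX=X_{(j+2)/n}-2X_{(j+1)/n}+X_{j/n}.$$ *)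

theory Defs
  imports "HOL-Probability.Probability" "HOL-Library.Landau_Symbols"
begin

section \<open>Levy processes\<close>

text \<open>
  Processes are indexed by all reals, but only times \<open>t \<ge> 0\<close> are ever constrained or used.
\<close>

locale levy_process = prob_space M for M :: "'a measure" +
  fixes X :: "real \<Rightarrow> 'a \<Rightarrow> real"
  assumes random_variable_at: "t \<ge> 0 \<Longrightarrow> random_variable borel (X t)"
    and starts_at_zero: "AE \<omega> in M. X 0 \<omega> = 0"
    and indep_increments:
      "\<And>t n. 0 \<le> t 0 \<Longrightarrow> mono t \<Longrightarrow>
         indep_vars (\<lambda>_. borel) (\<lambda>i \<omega>. X (t (Suc i)) \<omega> - X (t i) \<omega>) {..<(n::nat)}"
    and stationary_increments:
      "s \<ge> 0 \<Longrightarrow> h \<ge> 0 \<Longrightarrow>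
         distr M borel (\<lambda>\<omega>. X (s + h) \<omega> - X s \<omega>) = distr M borel (X h)"
    and stochastically_continuous:
      "s \<ge> 0 \<Longrightarrow> \<epsilon> > 0 \<Longrightarrow>
         ((\<lambda>t. prob {\<omega> \<in> space M. \<epsilon> < \<bar>X t \<omega> - X s \<omega>\<bar>}) \<longlongrightarrow> 0) (at s within {0..})"

definition as_right_continuous :: "'a measure \<Rightarrow> (real \<Rightarrow> 'a \<Rightarrow> real) \<Rightarrow> bool" where
  "as_right_continuous M X \<longleftrightarrow>
     (AE \<omega> in M. \<forall>t\<ge>0. continuous (at_right t) (\<lambda>s. X s \<omega>))"

definition generating_triplet ::
  "'a measure \<Rightarrow> (real \<Rightarrow> 'a \<Rightarrow> real) \<Rightarrow> real \<Rightarrow> real \<Rightarrow> real measure \<Rightarrow> bool" where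
  "generating_triplet M X a \<gamma> \<nu> \<longleftrightarrow>
     a \<ge> 0 \<and> sets \<nu> = sets borel \<and> emeasure \<nu> {0} = 0 \<and>
     (\<integral>\<^sup>+ u. ennreal (min (u\<^sup>2) 1) \<partial>\<nu>) < \<infinity> \<and>
     (\<forall>t\<ge>0. \<forall>\<theta>. char (distr M borel (X t)) \<theta> =
        exp (complex_of_real t *
          (\<i> * complex_of_real (\<gamma> * \<theta>) - complex_of_real (a\<^sup>2 * \<theta>\<^sup>2 / 2) +
           (CLINT u|\<nu>. iexp (u * \<theta>) - 1
              - \<i> * complex_of_real (u * \<theta> * (if \<bar>u\<bar> \<le> 1 then 1 else 0))))))"

text \<open>For a Levy measure \<open>\<nu>\<close> and \<open>u > 0\<close> the set below has finite mass,
  so the real-valued \<^const>\<open>measure\<close> does not collapse an infinite value to \<open>0\<close>.\<close>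

definition levy_tail :: "real measure \<Rightarrow> real \<Rightarrow> real" where
  "levy_tail \<nu> u = measure \<nu> ({..-u} \<union> {u..})"

text \<open>Paths as elements of the product space over the time axis \<open>[0,\<infinity>)\<close>; the law of a process
  (equivalently, the family of its finite-dimensional distributions) is the law of its path.\<close>

abbreviation path_space :: "(real \<Rightarrow> real) measure" where
  "path_space \<equiv> PiM {0..} (\<lambda>_. borel)"

definition path_of :: "(real \<Rightarrow> 'a \<Rightarrow> real) \<Rightarrow> 'a \<Rightarrow> real \<Rightarrow> real" where
  "path_of X \<omega> = restrict (\<lambda>t. X t \<omega>) {0..}"

text \<open>Measurability of \<open>path_of X1\<close> and \<open>path_of X2\<close> is part of the independence condition.\<close>

definition indep_process_copies ::
  "'b measure \<Rightarrow> (real \<Rightarrow> 'b \<Rightarrow> real) \<Rightarrow> (real \<Rightarrow> 'b \<Rightarrow> real) \<Rightarrow>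
   'a measure \<Rightarrow> (real \<Rightarrow> 'a \<Rightarrow> real) \<Rightarrow> bool" where
  "indep_process_copies N X1 X2 M X \<longleftrightarrow>
     prob_space N \<and>
     prob_space.indep_var N path_space (path_of X1) path_space (path_of X2) \<and>
     distr N path_space (path_of X1) = distr M path_space (path_of X) \<and>
     distr N path_space (path_of X2) = distr M path_space (path_of X)"

section \<open>The increment ratio statistic\<close>

definition \<psi> :: "real \<Rightarrow> real \<Rightarrow> real" where
  "\<psi> x y = (if x = 0 \<and> y = 0 then 1 else \<bar>x + y\<bar> / (\<bar>x\<bar> + \<bar>y\<bar>))"

definition second_diff :: "(real \<Rightarrow> 'a \<Rightarrow> real) \<Rightarrow> nat \<Rightarrow> nat \<Rightarrow> 'a \<Rightarrow> real" where
  "second_diff X n j \<omega> =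
     X (real (j + 2) / real n) \<omega> - 2 * X (real (j + 1) / real n) \<omega> + X (real j / real n) \<omega>"

text \<open>Intended for even \<open>n \<ge> 4\<close> only.\<close>

definition R2 :: "(real \<Rightarrow> 'a \<Rightarrow> real) \<Rightarrow> nat \<Rightarrow> 'a \<Rightarrow> real" where
  "R2 X n \<omega> = 1 / (real n / 2 - 1) *
     (\<Sum>k = 0..(n - 4) div 2. \<psi> (second_diff X n (2 * k) \<omega>) (second_diff X n (2 * k + 2) \<omega>))"

section \<open>Covariance and convergence in distribution\<close>

definition covariance :: "'a measure \<Rightarrow> ('a \<Rightarrow> real) \<Rightarrow> ('a \<Rightarrow> real) \<Rightarrow> real" where
  "covariance M U V =
     (LINT \<omega>|M. (U \<omega> - (LINT \<omega>'|M. U \<omega>')) * (V \<omega> - (LINT \<omega>'|M. V \<omega>')))"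

text \<open>The library's \<^const>\<open>weak_conv_m\<close> covers sequences only; this is the same notion along an
  arbitrary filter, needed for \<open>t \<down> 0\<close>.\<close>

definition weak_conv_along :: "('i \<Rightarrow> real measure) \<Rightarrow> real measure \<Rightarrow> 'i filter \<Rightarrow> bool" where
  "weak_conv_along \<mu> \<mu>' F \<longleftrightarrow>
     (\<forall>x. isCont (cdf \<mu>') x \<longrightarrow> ((\<lambda>i. cdf (\<mu> i) x) \<longlongrightarrow> cdf \<mu>' x) F)"

lemma weak_conv_along_sequentially: "weak_conv_along \<mu> \<mu>' sequentially \<longleftrightarrow> weak_conv_m \<mu> \<mu>'"
  by (simp add: weak_conv_along_def weak_conv_m_def weak_conv_def)

text \<open>Defined as a scaled standard normal law so as to make sense also for \<open>v = 0\<close>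
  (Dirac mass at \<open>m\<close>), where \<^const>\<open>normal_density\<close> is unusable.\<close>

definition normal_law :: "real \<Rightarrow> real \<Rightarrow> real measure" where
  "normal_law m v = distr std_normal_distribution borel (\<lambda>x. m + sqrt v * x)"

end

theory Submission
  imports Defs
begin

(* The increments of X over the grid of mesh 1/n are i.i.d., so the second differences
   Y_k at even positions are i.i.d. too, with the law of X1_(1/n) - X2_(1/n).  This symmetrised law
   has characteristic function exp (- t (a^2 theta^2 + 2 int (1 - cos (theta u)) nu(du))), and the
   regular variation of the tail of nu at 0 makes the exponent, rescaled by t^(1/alpha), converge
   to that of a stable law.

   As psi is invariant under scaling and continuous off the origin, moments of
   psi(Y_0, Y_1) and psi(Y_1, Y_2) converge to those for stable variables, which have no atom at 0.
   The summands psi(Y_k, Y_(k+1)) are 1-dependent and bounded: Hoeffding's inequality for even and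
   for odd k together with Borel-Cantelli gives the strong law, and cutting the sum into long
   independent blocks gives the central limit theorem. *)

section \<open>The symmetrised Levy exponent near time zero\<close>

text \<open>Only existence and positivity of the limit of the rescaled exponent matter: its value is
  absorbed into a free scale constant, which \<open>\<psi>\<close> ignores. By Fubini the limit is
  formally \<open>c\<close> times the integral of sin(y) y^(-\<alpha>) over the half line, which
  does not converge absolutely for \<alpha> \<le> 1, so dominated convergence is confined to bounded
  ranges. Cutting at multiples of 2 pi leaves an error governed by the tail alone, and a Cauchy
  argument then supplies the limit. The combination a = 0, \<alpha> = 2 cannot occur, because
  integrability of min(u^2, 1) forces u^2 K(u) to tend to 0. The law and the mean of the summands
  change with n, so each n gives its own row of a triangular array, and no relation between rows is
  used; hence the strong law is drawn from tail bounds that are summable over the rows. With n = 2m,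
  a row sum of m - 1 terms has variance about m (v + 2c), where v is the variance of a summand and c
  the covariance of neighbours. The factor sqrt(2m) / (m - 1) turns this into 2 (v + 2c), the origin
  of the factors 2 and 4 in the limiting variance.\<close>

lemma one_minus_cos_le: "1 - cos x \<le> (x::real)\<^sup>2 / 2"
proof -
  have "1 - cos x = 2 * (sin (x / 2))\<^sup>2" using cos_double_sin[of "x / 2"] by simp
  also have "(sin (x / 2))\<^sup>2 \<le> (x / 2)\<^sup>2"
    by (rule abs_le_square_iff[THEN iffD1, OF abs_sin_x_le_abs_x])
  finally show ?thesis by (simp add: power2_eq_square)
qed

text \<open>Completeness in a form that needs no candidate for the limit. As \<open>F\<close> is
  proper, two eventual statements hold at a common point, so the approximate limits form a Cauchy
  sequence. It serves where every truncation level yields its own approximate limit.\<close>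

lemma tendsto_exists_of_approx:
  fixes h :: "'b \<Rightarrow> real"
  assumes F: "F \<noteq> bot" and approx: "\<And>e. 0 < e \<Longrightarrow> \<exists>l. eventually (\<lambda>x. \<bar>h x - l\<bar> < e) F"
  shows "\<exists>L. (h \<longlongrightarrow> L) F"
proof -
  have "\<exists>l. eventually (\<lambda>x. \<bar>h x - l\<bar> < inverse (real (Suc n))) F" for n by (rule approx) simp
  then obtain l where l: "\<And>n. eventually (\<lambda>x. \<bar>h x - l n\<bar> < inverse (real (Suc n))) F" by metis
  have diff: "\<bar>l m - l n\<bar> < inverse (real (Suc m)) + inverse (real (Suc n))" for m n
    using eventually_happens'[OF F eventually_conj[OF l[of m] l[of n]]] by auto
  have "Cauchy l"
  proof (rule metric_CauchyI)
    fix e :: real assume e: "0 < e"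
    then obtain k where k: "inverse (real (Suc k)) < e / 2" using reals_Archimedean[of "e / 2"] by auto
    have "dist (l m) (l n) < e" if "k \<le> m" "k \<le> n" for m n
    proof -
      have "inverse (real (Suc m)) \<le> inverse (real (Suc k))" "inverse (real (Suc n)) \<le> inverse (real (Suc k))"
        using that by (auto intro!: le_imp_inverse_le)
      then show ?thesis using diff[of m n] k unfolding dist_real_def by linarith
    qed
    then show "\<exists>M. \<forall>m\<ge>M. \<forall>n\<ge>M. dist (l m) (l n) < e" by blast
  qed
  then obtain L where L: "l \<longlonglongrightarrow> L" using Cauchy_convergent convergent_def by blast
  have "(h \<longlongrightarrow> L) F"
  proof (rule tendstoI)
    fix e :: real assume e: "0 < e"
    then obtain k where k: "inverse (real (Suc k)) < e / 2" using reals_Archimedean[of "e / 2"] by auto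
    have "eventually (\<lambda>n. dist (l n) L < e / 2 \<and> k \<le> n) sequentially"
      using e by (intro eventually_conj tendstoD[OF L] eventually_ge_at_top) simp
    then obtain n where n: "dist (l n) L < e / 2" "k \<le> n"
      using eventually_happens'[OF sequentially_bot] by blast
    have "inverse (real (Suc n)) \<le> inverse (real (Suc k))" using n by (auto intro!: le_imp_inverse_le)
    with n k have "inverse (real (Suc n)) + \<bar>l n - L\<bar> < e" unfolding dist_real_def by linarith
    then show "eventually (\<lambda>x. dist (h x) L < e) F"
      by (intro eventually_mono[OF l[of n]]) (unfold dist_real_def, linarith)
  qed
  then show ?thesis by blast
qed

section \<open>Levy measures: integrability, tails and the quadratic scale\<close>

locale levy_measure =
  fixes \<nu> :: "real measure"
  assumes sets_nu [measurable_cong]: "sets \<nu> = sets borel"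
    and no_mass_0: "emeasure \<nu> {0} = 0"
    and finite_min: "(\<integral>\<^sup>+ u. ennreal (min (u\<^sup>2) 1) \<partial>\<nu>) < \<infinity>"
begin

lemma space_nu [simp]: "space \<nu> = UNIV"
  using sets_eq_imp_space_eq[OF sets_nu] by simp

lemma integrable_min: "integrable \<nu> (\<lambda>u. min (u\<^sup>2) 1)"
  by (rule integrableI_nonneg) (use finite_min in auto)

lemma integrable_of_bound:
  fixes f :: "real \<Rightarrow> 'b :: {banach, second_countable_topology}"
  assumes "f \<in> borel_measurable borel" "\<And>u. norm (f u) \<le> C * min (u\<^sup>2) 1"
  shows "integrable \<nu> f"
  by (rule Bochner_Integration.integrable_bound[OF integrable_mult_right[OF integrable_min, of C]])
    (use assms in \<open>auto intro: order_trans[OF _ abs_ge_self]\<close>)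

lemma integrable_tail: "0 < r \<Longrightarrow> integrable \<nu> (indicator {u. r \<le> \<bar>u\<bar>} :: real \<Rightarrow> real)"
proof (rule integrable_of_bound[where C="1 / min (r\<^sup>2) 1"])
  fix u assume r: "0 < r"
  have "r\<^sup>2 \<le> u\<^sup>2" if "r \<le> \<bar>u\<bar>" using r that by (simp add: abs_le_square_iff[symmetric])
  then have "min (r\<^sup>2) 1 \<le> min (u\<^sup>2) 1" if "r \<le> \<bar>u\<bar>" using that by auto
  then show "norm (indicator {u. r \<le> \<bar>u\<bar>} u :: real) \<le> 1 / min (r\<^sup>2) 1 * min (u\<^sup>2) 1"
    using r by (auto simp: indicator_def pos_le_divide_eq)
qed simp

lemma levy_tail_eq: "levy_tail \<nu> r = (LINT u|\<nu>. indicator {u. r \<le> \<bar>u\<bar>} u)"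
proof -
  have "{..-r} \<union> {r..} = {u. r \<le> \<bar>u\<bar>}" by auto
  then show ?thesis by (simp add: levy_tail_def)
qed

lemma levy_tail_nonneg: "0 \<le> levy_tail \<nu> r"
  by (simp add: levy_tail_def)

text \<open>Needed for Fubini. The complements of shrinking intervals around 0 have finite mass and
  miss only the point 0, which is null.\<close>

lemma sigma_finite_nu: "sigma_finite_measure \<nu>"
proof
  let ?A = "insert {0} (range (\<lambda>n. {u. inverse (real (Suc n)) \<le> \<bar>u\<bar>}))"
  show "\<exists>A. countable A \<and> A \<subseteq> sets \<nu> \<and> \<Union> A = space \<nu> \<and> (\<forall>a\<in>A. emeasure \<nu> a \<noteq> \<infinity>)"
  proof (intro exI[of _ ?A] conjI ballI)
    show "\<Union> ?A = space \<nu>"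
    proof -
      have "u \<in> \<Union> ?A" for u
      proof (cases "u = 0")
        case False
        then obtain n where "inverse (real (Suc n)) < \<bar>u\<bar>" using reals_Archimedean[of "\<bar>u\<bar>"] by auto
        then show ?thesis by (auto intro!: exI[of _ n])
      qed simp
      then show ?thesis by auto
    qed
    fix a assume "a \<in> ?A"
    moreover have "emeasure \<nu> {u. inverse (real (Suc n)) \<le> \<bar>u\<bar>} < \<infinity>" for n
      using integrable_tail[of "inverse (real (Suc n))"] by (simp add: integrable_indicator_iff)
    ultimately show "emeasure \<nu> a \<noteq> \<infinity>" using no_mass_0 by (auto simp: less_top)
  qed (auto simp: sets_nu)
qed

text \<open>Dominated convergence: for r \<le> 1 the function r^2 1(r \<le> |u|) lies below min(u^2,
  1), and it is at most r^2. The substitution r = 1/x moves the limit to infinity.\<close>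

lemma tail_square_tendsto_0: "((\<lambda>r. r\<^sup>2 * levy_tail \<nu> r) \<longlongrightarrow> 0) (at_right 0)"
  unfolding filterlim_at_right_to_top levy_tail_eq integral_mult_right_zero[symmetric]
proof -
  have "((\<lambda>x. LINT u|\<nu>. (inverse x)\<^sup>2 * indicator {u. inverse x \<le> \<bar>u\<bar>} u) \<longlongrightarrow> (LINT u|\<nu>. 0)) at_top"
  proof (rule integral_dominated_convergence_at_top[where w="\<lambda>u. min (u\<^sup>2) 1"])
    show "eventually (\<lambda>x. AE u in \<nu>. norm ((inverse x)\<^sup>2 * indicator {u. inverse x \<le> \<bar>u\<bar>} u) \<le> min (u\<^sup>2) 1) at_top"
      using eventually_ge_at_top[of 1]
    proof eventually_elim
      case (elim x)
      have "(inverse x)\<^sup>2 \<le> 1" using elim by (simp add: power_le_one inverse_le_1_iff)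
      moreover have "(inverse x)\<^sup>2 \<le> u\<^sup>2" if "inverse x \<le> \<bar>u\<bar>" for u
        using that elim by (simp add: abs_le_square_iff[symmetric])
      ultimately show ?case by (auto simp: indicator_def)
    qed
    show "AE u in \<nu>. ((\<lambda>x. (inverse x)\<^sup>2 * indicator {u. inverse x \<le> \<bar>u\<bar>} u) \<longlongrightarrow> 0) at_top"
    proof (rule AE_I2)
      fix u :: real
      have "((\<lambda>x. (inverse x)\<^sup>2) \<longlongrightarrow> (0::real)\<^sup>2) at_top"
        by (intro tendsto_power tendsto_inverse_0_at_top filterlim_ident)
      then have "((\<lambda>x. (inverse x)\<^sup>2) \<longlongrightarrow> (0::real)) at_top" by simp
      then show "((\<lambda>x. (inverse x)\<^sup>2 * indicator {u. inverse x \<le> \<bar>u\<bar>} u) \<longlongrightarrow> 0) at_top"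
        by (rule Lim_null_comparison[rotated, of "\<lambda>x. (inverse x)\<^sup>2"])
          (auto simp: indicator_def)
    qed
  qed (auto simp: integrable_min)
  then show "((\<lambda>x. LINT u|\<nu>. (inverse x)\<^sup>2 * indicator {u. inverse x \<le> \<bar>u\<bar>} u) \<longlongrightarrow> 0) at_top" by simp
qed

text \<open>Such a tail would make u^2 K(u) tend to \<open>c > 0\<close>, against
  \<open>tail_square_tendsto_0\<close>. Hence the tail hypothesis forces \<alpha> < 2.\<close>

lemma not_asymp_equiv_square:
  assumes "c > 0" shows "\<not> levy_tail \<nu> \<sim>[at_right 0] (\<lambda>u. c * u powr (-2))"
proof
  assume *: "levy_tail \<nu> \<sim>[at_right 0] (\<lambda>u. c * u powr (-2))"
  have pos: "eventually (\<lambda>u. u > (0::real)) (at_right 0)" by (rule eventually_at_right_less)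
  have "((\<lambda>u. levy_tail \<nu> u / (c * u powr (-2))) \<longlongrightarrow> 1) (at_right 0)"
    using * by (rule asymp_equivD_strong) (use pos in \<open>eventually_elim, use assms in simp\<close>)
  then have "((\<lambda>u. c * (levy_tail \<nu> u / (c * u powr (-2)))) \<longlongrightarrow> c * 1) (at_right 0)"
    by (intro tendsto_intros)
  moreover have "eventually (\<lambda>u. c * (levy_tail \<nu> u / (c * u powr (-2))) = u\<^sup>2 * levy_tail \<nu> u) (at_right 0)"
    using pos by eventually_elim (use assms in \<open>simp add: powr_minus powr_numeral field_simps\<close>)
  ultimately have "((\<lambda>u. u\<^sup>2 * levy_tail \<nu> u) \<longlongrightarrow> c) (at_right 0)"
    by (simp cong: filterlim_cong)
  from tendsto_unique[OF _ this tail_square_tendsto_0] assms show False by simp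
qed

lemma integrable_one_minus_cos: "integrable \<nu> (\<lambda>u. 1 - cos (s * u))"
proof (rule integrable_of_bound[where C="s\<^sup>2 + 2"])
  fix u
  have "1 - cos (s * u) \<le> (s * u)\<^sup>2 / 2" by (rule one_minus_cos_le)
  then have 1: "1 - cos (s * u) \<le> s\<^sup>2 * u\<^sup>2" by (simp add: power_mult_distrib) (smt (verit) mult_nonneg_nonneg zero_le_power2)
  have 2: "1 - cos (s * u) \<le> 2" using cos_ge_minus_one[of "s * u"] by linarith
  have "\<bar>1 - cos (s * u)\<bar> \<le> min (s\<^sup>2 * u\<^sup>2) 2" using 1 2 by simp
  also have "\<dots> \<le> (s\<^sup>2 + 2) * min (u\<^sup>2) 1"
  proof (cases "u\<^sup>2 \<le> 1")
    case True
    have "min (s\<^sup>2 * u\<^sup>2) 2 \<le> s\<^sup>2 * u\<^sup>2 + 2 * u\<^sup>2" by (simp add: min.coboundedI1)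
    with True show ?thesis by (simp add: distrib_right)
  next
    case False
    then show ?thesis by (simp add: min.coboundedI2)
  qed
  finally show "norm (1 - cos (s * u)) \<le> (s\<^sup>2 + 2) * min (u\<^sup>2) 1" by simp
qed simp

text \<open>Jumps are negligible at the Gaussian scale, so for \<open>a > 0\<close> the limiting
  exponent comes from \<open>a\<close> alone. The majorant combines the quadratic bound on 1 - cos
  with the crude bound 2; pointwise convergence to 0 only uses that 1 - cos is bounded.\<close>

lemma one_minus_cos_quadratic:
  "((\<lambda>s. s powr (-2) * (LINT u|\<nu>. 1 - cos (s * u))) \<longlongrightarrow> 0) at_top"
proof -
  have "((\<lambda>s. LINT u|\<nu>. s powr (-2) * (1 - cos (s * u))) \<longlongrightarrow> (LINT u|\<nu>. 0)) at_top"
  proof (rule integral_dominated_convergence_at_top[where w="\<lambda>u. 2 * min (u\<^sup>2) 1"])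
    show "eventually (\<lambda>s. AE u in \<nu>. norm (s powr (-2) * (1 - cos (s * u))) \<le> 2 * min (u\<^sup>2) 1) at_top"
      using eventually_ge_at_top[of "1::real"]
    proof eventually_elim
      case (elim s)
      show ?case
      proof (rule AE_I2)
        fix u
        have s: "s powr (-2) = 1 / s\<^sup>2" using elim by (simp add: powr_minus powr_numeral field_simps)
        have "(1 - cos (s * u)) / s\<^sup>2 \<le> ((s * u)\<^sup>2 / 2) / s\<^sup>2"
          by (intro divide_right_mono one_minus_cos_le) simp
        also have "\<dots> \<le> 2 * u\<^sup>2" using elim by (simp add: power_mult_distrib)
        finally have 1: "(1 - cos (s * u)) / s\<^sup>2 \<le> 2 * u\<^sup>2" .
        have "(1 - cos (s * u)) / s\<^sup>2 \<le> 2 / 1"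
          using elim cos_ge_minus_one[of "s * u"] by (intro frac_le) (auto simp: one_le_power)
        with 1 elim show "norm (s powr (-2) * (1 - cos (s * u))) \<le> 2 * min (u\<^sup>2) 1"
          by (simp add: s abs_mult min_def)
      qed
    qed
    show "AE u in \<nu>. ((\<lambda>s. s powr (-2) * (1 - cos (s * u))) \<longlongrightarrow> 0) at_top"
    proof (rule AE_I2)
      fix u :: real
      have "((\<lambda>s::real. 2 * s powr (-2)) \<longlongrightarrow> 2 * 0) at_top"
        by (intro tendsto_intros tendsto_neg_powr filterlim_ident) simp
      then have "((\<lambda>s::real. 2 * s powr (-2)) \<longlongrightarrow> 0) at_top" by simp
      then show "((\<lambda>s. s powr (-2) * (1 - cos (s * u))) \<longlongrightarrow> 0) at_top"
      proof (rule Lim_null_comparison[rotated]; intro always_eventually allI)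
        fix s :: real
        have "\<bar>1 - cos (s * u)\<bar> \<le> 2" using cos_ge_minus_one[of "s * u"] by simp
        then have "s powr (-2) * \<bar>1 - cos (s * u)\<bar> \<le> s powr (-2) * 2" by (rule mult_left_mono) simp
        then show "norm (s powr (-2) * (1 - cos (s * u))) \<le> 2 * s powr (-2)"
          unfolding real_norm_def abs_mult by (simp only: abs_of_nonneg[OF powr_ge_zero] mult.commute)
      qed
    qed
  qed (auto simp: integrable_min)
  then show ?thesis by simp
qed

end

section \<open>The integral of 1 - cos as an integral of the tail\<close>

lemma sin_integral_truncated:
  fixes A x :: real
  assumes "0 \<le> A" "0 \<le> x"
  shows "(LINT y|lborel. indicator {0<..A} y * (indicator {y. y \<le> x} y * sin y)) = 1 - cos (min x A)"
proof -
  have "(LINT y|lborel. indicator {0<..A} y * (indicator {y. y \<le> x} y * sin y)) =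
     (LINT y|lborel. indicator {0..min x A} y *\<^sub>R sin y)"
    by (rule integral_cong_AE) (use AE_lborel_singleton[of "0::real"] assms in
      \<open>auto simp: indicator_def intro: eventually_mono\<close>)
  also have "\<dots> = (- cos (min x A)) - (- cos 0)"
    by (rule integral_FTC_Icc)
      (use assms in \<open>auto intro!: derivative_eq_intros continuous_intros simp flip: has_real_derivative_iff_has_vector_derivative\<close>)
  finally show ?thesis by simp
qed

text \<open>Used with \<open>a = 1 - \<alpha>\<close>, where the condition \<open>-1 < a\<close> is
  exactly \<alpha> < 2.\<close>

lemma set_integrable_powr_Ioc:
  fixes a A :: real
  assumes a: "-1 < a" and A: "0 \<le> A"
  shows "integrable lborel (\<lambda>y. indicator {0<..A} y * y powr a)"
proof -
  have "((\<lambda>x. x powr a) has_integral (A powr (a + 1) / (a + 1))) {0..A}"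
    by (rule has_integral_powr_from_0) (use assms in auto)
  then have "(\<lambda>x. x powr a) absolutely_integrable_on {0..A}"
    by (intro nonnegative_absolutely_integrable_1) (auto simp: integrable_on_def)
  then have "integrable lborel (\<lambda>y. indicator {0..A} y *\<^sub>R y powr a)"
    by (simp add: set_integrable_def integrable_completion)
  then show ?thesis
    by (rule Bochner_Integration.integrable_bound) (auto simp: indicator_def)
qed

context levy_measure begin

text \<open>A layer-cake formula: 1 - cos is the integral of sin, and after exchanging the integrals
  the condition y \<le> s |u| integrates over u to the tail at y / s. The cutoff \<open>A\<close>
  keeps the double integral absolutely convergent.\<close>

lemma integral_cos_truncated:
  fixes A s :: real
  assumes A: "0 \<le> A" and s: "0 < s"
  shows "(LINT u|\<nu>. 1 - cos (min (s * \<bar>u\<bar>) A)) =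
    (LINT y|lborel. indicator {0<..A} y * (sin y * levy_tail \<nu> (y / s)))"
proof -
  interpret S: sigma_finite_measure \<nu> by (rule sigma_finite_nu)
  interpret P: pair_sigma_finite \<nu> lborel ..
  define f where "f u y = indicator {0<..A} y * (indicator {y. y \<le> s * \<bar>u\<bar>} y * sin y)" for u y :: real
  have meas: "case_prod f \<in> borel_measurable (\<nu> \<Otimes>\<^sub>M lborel)"
    unfolding f_def by measurable
  have fu: "(LINT y|lborel. f u y) = 1 - cos (min (s * \<bar>u\<bar>) A)" for u
    unfolding f_def by (rule sin_integral_truncated) (use A s in auto)
  have fy: "(LINT u|\<nu>. f u y) = indicator {0<..A} y * (sin y * levy_tail \<nu> (y / s))" for y
  proof -
    have "f u y = indicator {0<..A} y * sin y * indicator {u. y / s \<le> \<bar>u\<bar>} u" for u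
      using s by (auto simp: f_def indicator_def field_simps)
    then show ?thesis by (simp add: levy_tail_eq mult.assoc)
  qed
  \<comment> \<open>From |sin y| \<le> |y|, the integral of |f u| over y is at most the square of
    \<open>min (s * |u|) A\<close>, hence at most a multiple of min(u^2, 1). This justifies Fubini
    although \<nu> may be infinite.\<close>
  have bnd: "\<bar>f u y\<bar> \<le> min (s * \<bar>u\<bar>) A * indicator {0..min (s * \<bar>u\<bar>) A} y" for u y
    using abs_sin_x_le_abs_x[of y] by (auto simp: f_def indicator_def)
  have int_bnd: "integrable lborel (\<lambda>y. min (s * \<bar>u\<bar>) A * indicator {0..min (s * \<bar>u\<bar>) A} y)" for u
    by (intro integrable_mult_right integrable_real_indicator) (simp_all add: emeasure_lborel_Icc_eq)
  have f_meas: "f u \<in> borel_measurable lborel" for u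
    unfolding f_def[abs_def] by measurable
  have int_fu: "integrable lborel (f u)" for u
    by (rule Bochner_Integration.integrable_bound[OF int_bnd[of u]])
      (use f_meas order_trans[OF bnd abs_ge_self] in \<open>simp_all only: real_norm_def AE_I2 sets_lborel\<close>)
  have "integrable (\<nu> \<Otimes>\<^sub>M lborel) (case_prod f)"
  proof (rule P.Fubini_integrable[OF meas])
    show "AE u in \<nu>. integrable lborel (\<lambda>y. case_prod f (u, y))" using int_fu by simp
    show "integrable \<nu> (\<lambda>u. LINT y|lborel. norm (case_prod f (u, y)))"
    proof (rule integrable_of_bound[where C="s\<^sup>2 + A\<^sup>2"])
      show "(\<lambda>u. LINT y|lborel. norm (case_prod f (u, y))) \<in> borel_measurable borel"
        unfolding f_def by measurable
      fix u
      let ?x = "min (s * \<bar>u\<bar>) A"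
      have x0: "0 \<le> ?x" using A s by simp
      have "(LINT y|lborel. norm (f u y)) \<le> (LINT y|lborel. ?x * indicator {0..?x} y)"
        by (rule integral_mono) (use int_fu int_bnd bnd in auto)
      also have "\<dots> = ?x\<^sup>2" using x0 by (simp add: power2_eq_square)
      also have "\<dots> \<le> (s\<^sup>2 + A\<^sup>2) * min (u\<^sup>2) 1"
      proof -
        have 1: "?x\<^sup>2 \<le> (s * \<bar>u\<bar>)\<^sup>2" using x0 by (intro power_mono) auto
        have 2: "?x\<^sup>2 \<le> A\<^sup>2" using x0 by (intro power_mono) auto
        show ?thesis
        proof (cases "u\<^sup>2 \<le> 1")
          case True
          have "?x\<^sup>2 \<le> s\<^sup>2 * u\<^sup>2" using 1 by (simp add: power_mult_distrib)
          also have "\<dots> \<le> (s\<^sup>2 + A\<^sup>2) * u\<^sup>2" by (simp add: distrib_right)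
          finally show ?thesis using True by simp
        next
          case False
          have "A\<^sup>2 \<le> s\<^sup>2 + A\<^sup>2" by simp
          with 2 have "?x\<^sup>2 \<le> s\<^sup>2 + A\<^sup>2" by linarith
          with False show ?thesis by simp
        qed
      qed
      finally show "norm (LINT y|lborel. norm (case_prod f (u, y))) \<le> (s\<^sup>2 + A\<^sup>2) * min (u\<^sup>2) 1"
        by simp
    qed
  qed
  from P.Fubini_integral[OF this] show ?thesis unfolding fu fy by simp
qed

end

section \<open>Regularly varying tails\<close>

locale regular_levy_measure = levy_measure +
  fixes \<alpha> c :: real
  assumes alpha: "0 < \<alpha>" "\<alpha> < 2" and c_pos: "0 < c"
    and tail: "levy_tail \<nu> \<sim>[at_right 0] (\<lambda>u. c * u powr (-\<alpha>))"
begin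

lemma tail_ratio: "((\<lambda>u. levy_tail \<nu> u / (c * u powr (-\<alpha>))) \<longlongrightarrow> 1) (at_right 0)"
proof (rule asymp_equivD_strong[OF tail])
  show "eventually (\<lambda>u. levy_tail \<nu> u \<noteq> 0 \<or> c * u powr (-\<alpha>) \<noteq> 0) (at_right 0)"
    using eventually_at_right_less[of "0::real"] by eventually_elim (use c_pos in simp)
qed

lemma tail_scaled:
  assumes y: "0 < y"
  shows "((\<lambda>s. s powr (-\<alpha>) * levy_tail \<nu> (y / s)) \<longlongrightarrow> c * y powr (-\<alpha>)) at_top"
proof -
  have "filterlim (\<lambda>s. y / s) (at_right 0) at_top"
    unfolding filterlim_at
  proof
    show "eventually (\<lambda>s. y / s \<in> {0<..} \<and> y / s \<noteq> 0) at_top"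
      using eventually_gt_at_top[of 0] by eventually_elim (use y in simp)
    show "((\<lambda>s. y / s) \<longlongrightarrow> 0) at_top"
      by (rule tendsto_divide_0[OF tendsto_const filterlim_at_top_imp_at_infinity[OF filterlim_ident]])
  qed
  from filterlim_compose[OF tail_ratio this]
  have "((\<lambda>s. levy_tail \<nu> (y / s) / (c * (y / s) powr (-\<alpha>)) * (c * y powr (-\<alpha>))) \<longlongrightarrow> 1 * (c * y powr (-\<alpha>))) at_top"
    by (intro tendsto_intros)
  moreover have "eventually (\<lambda>s. levy_tail \<nu> (y / s) / (c * (y / s) powr (-\<alpha>)) * (c * y powr (-\<alpha>)) =
      s powr (-\<alpha>) * levy_tail \<nu> (y / s)) at_top"
    using eventually_gt_at_top[of 0]
  proof eventually_elim
    case (elim s)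
    then show ?case using y c_pos by (simp add: powr_divide powr_minus field_simps)
  qed
  ultimately show ?thesis by (simp cong: filterlim_cong)
qed

text \<open>Dominated convergence in the layer-cake formula. Near 0 the factor sin y lowers the
  singularity y^(-\<alpha>) to y^(1 - \<alpha>), which is integrable on the bounded range.\<close>

lemma truncated_limit:
  assumes A: "0 \<le> A"
  shows "((\<lambda>s. s powr (-\<alpha>) * (LINT u|\<nu>. 1 - cos (min (s * \<bar>u\<bar>) A))) \<longlongrightarrow>
    (LINT y|lborel. indicator {0<..A} y * (sin y * (c * y powr (-\<alpha>))))) at_top"
proof -
  interpret S: sigma_finite_measure \<nu> by (rule sigma_finite_nu)
  \<comment> \<open>The ratio of the tail to its asymptotic form tends to 1, so it is below 2 near
    0. Once s > A / d, every y / s with y \<le> A falls in this range, which is the source of the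
    factor 2 in the majorant.\<close>
  obtain d where d: "0 < d" "\<And>u. 0 < u \<Longrightarrow> u < d \<Longrightarrow> levy_tail \<nu> u \<le> 2 * c * u powr (-\<alpha>)"
  proof -
    have "eventually (\<lambda>u. levy_tail \<nu> u / (c * u powr (-\<alpha>)) < 2) (at_right 0)"
      by (rule order_tendstoD(2)[OF tail_ratio]) simp
    then obtain d where "0 < d" and *: "\<And>u. 0 < u \<Longrightarrow> u < d \<Longrightarrow> levy_tail \<nu> u / (c * u powr (-\<alpha>)) < 2"
      unfolding eventually_at_right_field by auto
    show ?thesis
    proof (rule that[OF \<open>0 < d\<close>])
      fix u assume u: "0 < u" "u < d"
      then have "0 < c * u powr (-\<alpha>)" using c_pos by simp
      with *[OF u] show "levy_tail \<nu> u \<le> 2 * c * u powr (-\<alpha>)" by (simp add: pos_divide_less_eq)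
    qed
  qed
  have tail_meas [measurable]: "levy_tail \<nu> \<in> borel_measurable borel"
    unfolding levy_tail_eq[abs_def] by measurable
  have "((\<lambda>s. LINT y|lborel. s powr (-\<alpha>) * (indicator {0<..A} y * (sin y * levy_tail \<nu> (y / s)))) \<longlongrightarrow>
    (LINT y|lborel. indicator {0<..A} y * (sin y * (c * y powr (-\<alpha>))))) at_top"
  proof (rule integral_dominated_convergence_at_top[where w="\<lambda>y. 2 * c * (indicator {0<..A} y * y powr (1 - \<alpha>))"])
    show "integrable lborel (\<lambda>y. 2 * c * (indicator {0<..A} y * y powr (1 - \<alpha>)))"
      using alpha A by (intro integrable_mult_right set_integrable_powr_Ioc) auto
    show "AE y in lborel. ((\<lambda>s. s powr (-\<alpha>) * (indicator {0<..A} y * (sin y * levy_tail \<nu> (y / s)))) \<longlongrightarrow>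
        indicator {0<..A} y * (sin y * (c * y powr (-\<alpha>)))) at_top"
    proof (rule AE_I2)
      fix y :: real
      show "((\<lambda>s. s powr (-\<alpha>) * (indicator {0<..A} y * (sin y * levy_tail \<nu> (y / s)))) \<longlongrightarrow>
        indicator {0<..A} y * (sin y * (c * y powr (-\<alpha>)))) at_top"
      proof (cases "y \<in> {0<..A}")
        case True
        then have "((\<lambda>s. sin y * (s powr (-\<alpha>) * levy_tail \<nu> (y / s))) \<longlongrightarrow> sin y * (c * y powr (-\<alpha>))) at_top"
          by (intro tendsto_mult_left tail_scaled) auto
        with True show ?thesis by (simp add: mult_ac)
      qed simp
    qed
    show "eventually (\<lambda>s. AE y in lborel. norm (s powr (-\<alpha>) * (indicator {0<..A} y * (sin y * levy_tail \<nu> (y / s))))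
      \<le> 2 * c * (indicator {0<..A} y * y powr (1 - \<alpha>))) at_top"
      using eventually_gt_at_top[of "A / d"] eventually_gt_at_top[of 0]
    proof eventually_elim
      case (elim s)
      show ?case
      proof (rule AE_I2)
        fix y
        show "norm (s powr (-\<alpha>) * (indicator {0<..A} y * (sin y * levy_tail \<nu> (y / s))))
          \<le> 2 * c * (indicator {0<..A} y * y powr (1 - \<alpha>))"
        proof (cases "y \<in> {0<..A}")
          case True
          then have y: "0 < y" "y \<le> A" by auto
          have "A < s * d" using elim d by (simp add: pos_divide_less_eq mult.commute)
          then have ys: "0 < y / s" "y / s < d" using y elim by (auto simp: pos_divide_less_eq mult.commute)
          have "norm (s powr (-\<alpha>) * (indicator {0<..A} y * (sin y * levy_tail \<nu> (y / s)))) =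
             \<bar>sin y\<bar> * (s powr (-\<alpha>) * levy_tail \<nu> (y / s))"
            using True by (simp add: abs_mult levy_tail_nonneg)
          also have "\<dots> \<le> y * (s powr (-\<alpha>) * (2 * c * (y / s) powr (-\<alpha>)))"
            using abs_sin_x_le_abs_x[of y] y d(2)[OF ys]
            by (intro mult_mono mult_left_mono) (auto simp: levy_tail_nonneg)
          also have "\<dots> = 2 * c * (y * y powr (-\<alpha>))"
            using y elim by (simp add: powr_divide powr_minus field_simps)
          also have "y * y powr (-\<alpha>) = y powr (1 - \<alpha>)"
            using y by (simp add: powr_diff powr_minus field_simps)
          finally show ?thesis using True by simp
        qed simp
      qed
    qed
  qed measurable
  moreover have "eventually (\<lambda>s. (LINT y|lborel. s powr (-\<alpha>) * (indicator {0<..A} y * (sin y * levy_tail \<nu> (y / s)))) =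
      s powr (-\<alpha>) * (LINT u|\<nu>. 1 - cos (min (s * \<bar>u\<bar>) A))) at_top"
    using eventually_gt_at_top[of 0]
    by eventually_elim (simp add: integral_cos_truncated[OF A])
  ultimately show ?thesis by (rule Lim_transform_eventually)
qed

text \<open>At the multiples of \<open>2\<pi>\<close> the function \<open>1 - cos\<close> vanishes, so that the truncation
  error is at most twice the tail.\<close>

lemma truncation_error:
  assumes s: "0 < s" and N: "0 < N"
  shows "\<bar>(LINT u|\<nu>. 1 - cos (s * u)) - (LINT u|\<nu>. 1 - cos (min (s * \<bar>u\<bar>) (2 * pi * real N)))\<bar>
    \<le> 2 * levy_tail \<nu> (2 * pi * real N / s)"
proof -
  let ?A = "2 * pi * real N"
  have A: "0 < ?A" using N by simp
  have int: "integrable \<nu> (\<lambda>u. 2 * indicator {u. ?A / s \<le> \<bar>u\<bar>} u :: real)"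
    using A s by (intro integrable_mult_right integrable_tail) auto
  have diff: "\<bar>(1 - cos (s * u)) - (1 - cos (min (s * \<bar>u\<bar>) ?A))\<bar> \<le> 2 * indicator {u. ?A / s \<le> \<bar>u\<bar>} u" for u
  proof (cases "?A / s \<le> \<bar>u\<bar>")
    case True
    then have "min (s * \<bar>u\<bar>) ?A = ?A" using s by (simp add: pos_divide_le_eq mult.commute)
    moreover have "cos ?A = 1" using cos_2npi[of N] by (simp add: mult_ac)
    ultimately show ?thesis using True cos_ge_minus_one[of "s * u"] by simp
  next
    case False
    then have "s * \<bar>u\<bar> < ?A" using s by (simp add: pos_less_divide_eq not_le mult.commute)
    moreover have "cos (s * \<bar>u\<bar>) = cos (s * u)" by (cases "0 \<le> u") (simp_all add: abs_if)
    ultimately show ?thesis using False by (simp add: min_def)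
  qed
  have int2: "integrable \<nu> (\<lambda>u. 1 - cos (min (s * \<bar>u\<bar>) ?A))"
  proof -
    have "integrable \<nu> (\<lambda>u. (1 - cos (s * u)) - (1 - cos (min (s * \<bar>u\<bar>) ?A)))"
      by (rule Bochner_Integration.integrable_bound[OF int]) (use diff in \<open>auto intro: order_trans[OF _ abs_ge_self]\<close>)
    from Bochner_Integration.integrable_diff[OF integrable_one_minus_cos[of s] this] show ?thesis by simp
  qed
  have "(LINT u|\<nu>. 1 - cos (s * u)) - (LINT u|\<nu>. 1 - cos (min (s * \<bar>u\<bar>) ?A)) =
      (LINT u|\<nu>. (1 - cos (s * u)) - (1 - cos (min (s * \<bar>u\<bar>) ?A)))"
    by (rule Bochner_Integration.integral_diff[symmetric, OF integrable_one_minus_cos int2])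
  also have "\<bar>\<dots>\<bar> \<le> (LINT u|\<nu>. 2 * indicator {u. ?A / s \<le> \<bar>u\<bar>} u)"
    using Bochner_Integration.integral_norm_bound_integral[OF Bochner_Integration.integrable_diff[OF integrable_one_minus_cos int2] int] diff
    by simp
  also have "\<dots> = 2 * levy_tail \<nu> (?A / s)" by (simp add: levy_tail_eq)
  finally show ?thesis .
qed

text \<open>Existence: each tolerance is met by some truncation level, whose limit is known, and the
  approximate limits are glued by completeness. Positivity needs a separate lower bound, as the
  value of \<open>L\<close> is never computed.\<close>

lemma one_minus_cos_regular:
  "\<exists>L>0. ((\<lambda>s. s powr (-\<alpha>) * (LINT u|\<nu>. 1 - cos (s * u))) \<longlongrightarrow> L) at_top"
proof -
  let ?h = "\<lambda>s. s powr (-\<alpha>) * (LINT u|\<nu>. 1 - cos (s * u))"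
  have "\<exists>l. eventually (\<lambda>s. \<bar>?h s - l\<bar> < e) at_top" if e: "0 < e" for e
  proof -
    \<comment> \<open>Chooses \<open>N\<close> so large that the limit of the rescaled truncation
      error, as s grows, is below e / 2.\<close>
    have "filterlim (\<lambda>N. 2 * pi * real N) at_top sequentially"
      by (intro filterlim_tendsto_pos_mult_at_top[OF tendsto_const] filterlim_real_sequentially) simp
    from tendsto_neg_powr[OF _ this, of "-\<alpha>"] alpha
    have "(\<lambda>N. 2 * (c * (2 * pi * real N) powr (-\<alpha>))) \<longlonglongrightarrow> 2 * (c * 0)"
      by (intro tendsto_intros) simp
    then have "eventually (\<lambda>N. 2 * (c * (2 * pi * real N) powr (-\<alpha>)) < e / 2 \<and> 0 < N) sequentially"
      using e by (intro eventually_conj order_tendstoD(2)[of _ 0] eventually_gt_at_top) auto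
    then obtain N where N: "2 * (c * (2 * pi * real N) powr (-\<alpha>)) < e / 2" "0 < N"
      using eventually_happens'[OF sequentially_bot] by blast
    let ?A = "2 * pi * real N"
    let ?g = "\<lambda>s. s powr (-\<alpha>) * (LINT u|\<nu>. 1 - cos (min (s * \<bar>u\<bar>) ?A))"
    define l where "l = (LINT y|lborel. indicator {0<..?A} y * (sin y * (c * y powr (-\<alpha>))))"
    have 1: "eventually (\<lambda>s. dist (?g s) l < e / 2) at_top"
      unfolding l_def using e by (intro tendstoD[OF truncated_limit]) auto
    have "((\<lambda>s. 2 * (s powr (-\<alpha>) * levy_tail \<nu> (?A / s))) \<longlongrightarrow> 2 * (c * ?A powr (-\<alpha>))) at_top"
      using N by (intro tendsto_mult_left tail_scaled) simp
    from order_tendstoD(2)[OF this N(1)] 1 eventually_gt_at_top[of 0]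
    have "eventually (\<lambda>s. \<bar>?h s - l\<bar> < e) at_top"
    proof eventually_elim
      case (elim s)
      have "\<bar>?h s - ?g s\<bar> = s powr (-\<alpha>) * \<bar>(LINT u|\<nu>. 1 - cos (s * u)) - (LINT u|\<nu>. 1 - cos (min (s * \<bar>u\<bar>) ?A))\<bar>"
        by (simp only: right_diff_distrib[symmetric] abs_mult abs_of_nonneg[OF powr_ge_zero])
      also have "\<dots> \<le> s powr (-\<alpha>) * (2 * levy_tail \<nu> (?A / s))"
        by (intro mult_left_mono truncation_error elim N) simp
      finally have "\<bar>?h s - ?g s\<bar> \<le> 2 * (s powr (-\<alpha>) * levy_tail \<nu> (?A / s))" by simp
      with elim(1,2) show ?case unfolding dist_real_def by linarith
    qed
    then show ?thesis by blast
  qed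
  then obtain L where L: "(?h \<longlongrightarrow> L) at_top"
    using tendsto_exists_of_approx[of at_top ?h] by auto
  \<comment> \<open>On the shell 1 \<le> s |u| < 2 the argument of cos lies in [1, pi], so 1 - cos
    is at least 1 - cos 1 there. The \<nu>-mass of the shell is a difference of two tails, and
    \<open>k\<close> is the limit of the rescaled bound.\<close>
  define k where "k = (1 - cos (1::real)) * (c * 1 powr (-\<alpha>) - c * 2 powr (-\<alpha>))"
  have "k \<le> L"
  proof (rule tendsto_le[OF _ L])
    show "((\<lambda>s. (1 - cos 1) * (s powr (-\<alpha>) * levy_tail \<nu> (1 / s) - s powr (-\<alpha>) * levy_tail \<nu> (2 / s))) \<longlongrightarrow> k) at_top"
      unfolding k_def by (intro tendsto_mult_left tendsto_diff tail_scaled) auto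
    show "eventually (\<lambda>s. (1 - cos 1) * (s powr (-\<alpha>) * levy_tail \<nu> (1 / s) - s powr (-\<alpha>) * levy_tail \<nu> (2 / s)) \<le> ?h s) at_top"
      using eventually_gt_at_top[of 0]
    proof eventually_elim
      case (elim s)
      have int: "integrable \<nu> (\<lambda>u. (1 - cos 1) * (indicator {u. 1 / s \<le> \<bar>u\<bar>} u - indicator {u. 2 / s \<le> \<bar>u\<bar>} u) :: real)"
        using elim by (intro integrable_mult_right Bochner_Integration.integrable_diff integrable_tail) auto
      have "(1 - cos 1) * (levy_tail \<nu> (1 / s) - levy_tail \<nu> (2 / s)) =
          (LINT u|\<nu>. (1 - cos 1) * (indicator {u. 1 / s \<le> \<bar>u\<bar>} u - indicator {u. 2 / s \<le> \<bar>u\<bar>} u))"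
        using elim integrable_tail by (simp add: levy_tail_eq)
      also have "\<dots> \<le> (LINT u|\<nu>. 1 - cos (s * u))"
      proof (rule integral_mono[OF int integrable_one_minus_cos])
        fix u
        show "(1 - cos 1) * (indicator {u. 1 / s \<le> \<bar>u\<bar>} u - indicator {u. 2 / s \<le> \<bar>u\<bar>} u) \<le> 1 - cos (s * u)"
        proof (cases "1 / s \<le> \<bar>u\<bar> \<and> \<not> 2 / s \<le> \<bar>u\<bar>")
          case True
          then have "1 \<le> s * \<bar>u\<bar>" "s * \<bar>u\<bar> \<le> pi"
            using elim pi_ge_two by (auto simp: pos_divide_le_eq pos_less_divide_eq not_le mult.commute)
          then have "cos (s * \<bar>u\<bar>) \<le> cos 1" by (intro cos_monotone_0_pi_le) auto
          moreover have "cos (s * \<bar>u\<bar>) = cos (s * u)" by (cases "0 \<le> u") (simp_all add: abs_if)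
          ultimately show ?thesis using True by simp
        next
          case False
          have "2 / s \<le> \<bar>u\<bar> \<Longrightarrow> 1 / s \<le> \<bar>u\<bar>" using elim by (simp add: pos_divide_le_eq)
          with False show ?thesis by (auto simp: indicator_def)
        qed
      qed
      finally have "s powr (-\<alpha>) * ((1 - cos 1) * (levy_tail \<nu> (1 / s) - levy_tail \<nu> (2 / s))) \<le> ?h s"
        by (rule mult_left_mono) simp
      then show ?case by (simp add: algebra_simps)
    qed
  qed simp
  moreover have "0 < k"
  proof -
    have "cos (1::real) < cos 0" by (rule cos_monotone_0_pi) (use pi_ge_two in auto)
    moreover have "(2::real) powr (-\<alpha>) < 2 powr 0" using alpha by (intro powr_less_mono) auto
    ultimately show ?thesis using c_pos by (simp add: k_def)
  qed
  ultimately show ?thesis using L by (intro exI[of _ L]) simp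
qed

end

section \<open>Levy-Khintchine exponent of a symmetrised law and its scaling limit\<close>

context levy_measure begin

text \<open>For |u| \<le> 1 the compensator leaves a Taylor remainder of order u^2; for larger u the
  modulus is at most 2. Integrability at \<theta> and at -\<theta> separately is what allows the two
  integrals to be added.\<close>

lemma integrable_levy_khintchine:
  "integrable \<nu> (\<lambda>u. iexp (u * \<theta>) - 1 - \<i> * complex_of_real (u * \<theta> * (if \<bar>u\<bar> \<le> 1 then 1 else 0)))"
proof (rule integrable_of_bound[where C="\<theta>\<^sup>2 + 2"])
  fix u
  show "norm (iexp (u * \<theta>) - 1 - \<i> * complex_of_real (u * \<theta> * (if \<bar>u\<bar> \<le> 1 then 1 else 0)))
      \<le> (\<theta>\<^sup>2 + 2) * min (u\<^sup>2) 1"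
  proof (cases "\<bar>u\<bar> \<le> 1")
    case True
    then have u: "u\<^sup>2 \<le> 1" by (simp add: abs_square_le_1)
    have "cmod (iexp (u * \<theta>) - (\<Sum>k\<le>1. (\<i> * (u * \<theta>))^k / fact k)) \<le> \<bar>u * \<theta>\<bar>^(Suc 1) / fact (Suc 1)"
      by (rule iexp_approx1)
    then have "cmod (iexp (u * \<theta>) - 1 - \<i> * complex_of_real (u * \<theta>)) \<le> \<theta>\<^sup>2 * u\<^sup>2 / 2"
      by (simp add: power2_eq_square[symmetric] power_mult_distrib mult.commute diff_diff_eq)
    also have "\<dots> \<le> (\<theta>\<^sup>2 + 2) * u\<^sup>2" by (simp add: distrib_right)
    finally show ?thesis using True u by simp
  next
    case False
    then have "1 < \<bar>u\<bar>\<^sup>2" by (intro one_less_power) auto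
    then have u: "1 < u\<^sup>2" by simp
    have "cmod (iexp (u * \<theta>) - 1) \<le> cmod (iexp (u * \<theta>)) + cmod 1" by (rule norm_triangle_ineq4)
    also have "\<dots> \<le> \<theta>\<^sup>2 + 2" by simp
    finally show ?thesis using False u by simp
  qed
qed measurable

text \<open>The compensator is odd in \<theta> and cancels; the two exponentials add up to 2
  cos.\<close>

lemma levy_khintchine_symmetrised:
  "(CLINT u|\<nu>. iexp (u * \<theta>) - 1 - \<i> * complex_of_real (u * \<theta> * (if \<bar>u\<bar> \<le> 1 then 1 else 0))) +
   (CLINT u|\<nu>. iexp (u * - \<theta>) - 1 - \<i> * complex_of_real (u * - \<theta> * (if \<bar>u\<bar> \<le> 1 then 1 else 0))) =
   complex_of_real (- 2 * (LINT u|\<nu>. 1 - cos (\<theta> * u)))"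
proof -
  have "iexp (u * \<theta>) + iexp (u * - \<theta>) = complex_of_real (2 * cos (\<theta> * u))" for u
    by (simp add: complex_eq_iff Re_exp Im_exp mult.commute)
  then have eq: "(iexp (u * \<theta>) - 1 - \<i> * complex_of_real (u * \<theta> * (if \<bar>u\<bar> \<le> 1 then 1 else 0))) +
     (iexp (u * - \<theta>) - 1 - \<i> * complex_of_real (u * - \<theta> * (if \<bar>u\<bar> \<le> 1 then 1 else 0))) =
     complex_of_real (- 2 * (1 - cos (\<theta> * u)))" for u
  proof -
    have "A - 1 - \<i> * complex_of_real (u * \<theta> * e) + (B - 1 - \<i> * complex_of_real (u * - \<theta> * e)) = A + B - 2"
      for A B e by simp
    moreover have "complex_of_real (2 * cos (\<theta> * u)) - 2 = complex_of_real (- 2 * (1 - cos (\<theta> * u)))"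
      by simp
    ultimately show ?thesis using \<open>iexp (u * \<theta>) + iexp (u * - \<theta>) = complex_of_real (2 * cos (\<theta> * u))\<close>
      by (simp only:)
  qed
  show ?thesis
    by (subst Bochner_Integration.integral_add[symmetric, OF integrable_levy_khintchine integrable_levy_khintchine])
      (simp only: eq integral_complex_of_real integral_mult_right_zero)
qed

text \<open>Independence gives the product
  \<open>char \<mu> \<theta> * char \<mu> (- \<theta>)\<close>: the drift cancels and the Gaussian
  part doubles. \<open>U\<close> and \<open>W\<close> are arbitrary because the lemma serves both
  the two copies of the process and two adjacent increments of one process.\<close>

lemma char_symmetrised:
  assumes N: "prob_space N" and indep: "prob_space.indep_var N borel U borel W"
    and law: "distr N borel U = \<mu>" "distr N borel W = \<mu>"
    and char_mu: "\<And>\<theta>. char \<mu> \<theta> = exp (complex_of_real t *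
          (\<i> * complex_of_real (\<gamma> * \<theta>) - complex_of_real (a\<^sup>2 * \<theta>\<^sup>2 / 2) +
           (CLINT u|\<nu>. iexp (u * \<theta>) - 1
              - \<i> * complex_of_real (u * \<theta> * (if \<bar>u\<bar> \<le> 1 then 1 else 0)))))"
  shows "char (distr N borel (\<lambda>\<omega>. U \<omega> - W \<omega>)) \<theta> =
    exp (complex_of_real (- (t * (a\<^sup>2 * \<theta>\<^sup>2 + 2 * (LINT u|\<nu>. 1 - cos (\<theta> * u))))))"
proof -
  interpret N: prob_space N by fact
  have [measurable]: "U \<in> borel_measurable N" "W \<in> borel_measurable N"
    using indep by (auto dest: N.indep_var_rv1 N.indep_var_rv2)
  have "N.indep_var borel (id \<circ> U) borel (uminus \<circ> W)"
    by (rule N.indep_var_compose[OF indep]) auto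
  then have ind: "N.indep_var borel U borel (\<lambda>\<omega>. - W \<omega>)" by (simp add: comp_def)
  have "char (distr N borel (\<lambda>\<omega>. - W \<omega>)) \<theta> = char (distr N borel W) (- \<theta>)"
    by (simp add: char_def integral_distr)
  with N.char_distr_add[OF ind, of \<theta>]
  have "char (distr N borel (\<lambda>\<omega>. U \<omega> - W \<omega>)) \<theta> = char \<mu> \<theta> * char \<mu> (- \<theta>)" by (simp add: law)
  also have "\<dots> = exp (complex_of_real t * (- complex_of_real (a\<^sup>2 * \<theta>\<^sup>2) +
     ((CLINT u|\<nu>. iexp (u * \<theta>) - 1 - \<i> * complex_of_real (u * \<theta> * (if \<bar>u\<bar> \<le> 1 then 1 else 0))) +
   (CLINT u|\<nu>. iexp (u * - \<theta>) - 1 - \<i> * complex_of_real (u * - \<theta> * (if \<bar>u\<bar> \<le> 1 then 1 else 0))))))"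
    unfolding char_mu exp_add[symmetric] by (rule arg_cong[where f=exp]) (simp add: algebra_simps)
  also have "\<dots> = exp (complex_of_real (- (t * (a\<^sup>2 * \<theta>\<^sup>2 + 2 * (LINT u|\<nu>. 1 - cos (\<theta> * u))))))"
    unfolding levy_khintchine_symmetrised by (rule arg_cong[where f=exp]) (simp add: algebra_simps)
  finally show ?thesis .
qed

text \<open>With s = |\<theta>| t^(-1/\<alpha>) one has t = |\<theta>|^\<alpha> s^(-\<alpha>), so
  small t becomes large s and the limits of the rescaled cosine integral apply.\<close>

lemma exponent_scaling:
  assumes a: "a \<ge> 0"
    and cases: "(a > 0 \<and> \<alpha> = 2) \<or> (a = 0 \<and> 0 < \<alpha> \<and> \<alpha> \<le> 2 \<and>
        (\<exists>c>0. levy_tail \<nu> \<sim>[at_right 0] (\<lambda>u. c * u powr (-\<alpha>))))"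
  shows "\<exists>k>0. \<forall>\<theta>. ((\<lambda>t. t * (a\<^sup>2 * (t powr (-1 / \<alpha>) * \<theta>)\<^sup>2 +
      2 * (LINT u|\<nu>. 1 - cos (t powr (-1 / \<alpha>) * \<theta> * u)))) \<longlongrightarrow> \<bar>k * \<theta>\<bar> powr \<alpha>) (at_right 0)"
proof -
  have alpha: "0 < \<alpha>" using cases by auto
  \<comment> \<open>Merges the two cases: \<open>L = 0\<close> if \<open>a > 0\<close>, and
    \<open>L > 0\<close> if \<open>a = 0\<close>. The fact \<open>quad\<close> is needed because the
    Gaussian term t (t^(-1/\<alpha>) \<theta>)^2 is free of t only for \<alpha> = 2.\<close>
  obtain L where L: "((\<lambda>s. s powr (-\<alpha>) * (LINT u|\<nu>. 1 - cos (s * u))) \<longlongrightarrow> L) at_top"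
    and pos: "0 < a\<^sup>2 + 2 * L" and quad: "a = 0 \<or> \<alpha> = 2"
  proof (cases "a > 0")
    case True
    then have "\<alpha> = 2" using cases by auto
    with one_minus_cos_quadratic True show ?thesis by (intro that[of 0]) auto
  next
    case False
    with a cases obtain c where c: "c > 0" "levy_tail \<nu> \<sim>[at_right 0] (\<lambda>u. c * u powr (-\<alpha>))"
      and al: "a = 0" "\<alpha> \<le> 2" by auto
    have "\<alpha> \<noteq> 2" using not_asymp_equiv_square[OF c(1)] c(2) by auto
    with al alpha c interpret regular_levy_measure \<nu> \<alpha> c by unfold_locales auto
    from one_minus_cos_regular al show ?thesis using that by auto
  qed
  define k where "k = (a\<^sup>2 + 2 * L) powr (1 / \<alpha>)"
  have k: "0 < k" "k powr \<alpha> = a\<^sup>2 + 2 * L" using pos alpha by (simp_all add: k_def powr_powr)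
  have "((\<lambda>t. t * (a\<^sup>2 * (t powr (-1 / \<alpha>) * \<theta>)\<^sup>2 +
      2 * (LINT u|\<nu>. 1 - cos (t powr (-1 / \<alpha>) * \<theta> * u)))) \<longlongrightarrow> \<bar>k * \<theta>\<bar> powr \<alpha>) (at_right 0)" for \<theta>
  proof (cases "\<theta> = 0")
    case False
    have "filterlim (\<lambda>t::real. t powr (-1 / \<alpha>)) at_top (at_right 0)"
    proof -
      have "((\<lambda>t::real. t powr (1 / \<alpha>)) \<longlongrightarrow> 0 powr (1 / \<alpha>)) (at_right 0)"
        using alpha by (intro tendsto_powr2 tendsto_intros) (auto intro: eventually_at_right_less[THEN eventually_mono])
      then have "filterlim (\<lambda>t::real. inverse (t powr (1 / \<alpha>))) at_top (at_right 0)"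
        by (intro filterlim_inverse_at_top)
          (auto intro: eventually_at_right_less[THEN eventually_mono])
      then show ?thesis by (simp add: powr_minus minus_divide_left[symmetric])
    qed
    then have "filterlim (\<lambda>t::real. \<bar>\<theta>\<bar> * t powr (-1 / \<alpha>)) at_top (at_right 0)"
      using False by (intro filterlim_tendsto_pos_mult_at_top[OF tendsto_const]) auto
    from filterlim_compose[OF L this]
    have "((\<lambda>t. \<bar>\<theta>\<bar> powr \<alpha> * (a\<^sup>2 + 2 * ((\<bar>\<theta>\<bar> * t powr (-1 / \<alpha>)) powr (-\<alpha>) *
        (LINT u|\<nu>. 1 - cos (\<bar>\<theta>\<bar> * t powr (-1 / \<alpha>) * u))))) \<longlongrightarrow> \<bar>\<theta>\<bar> powr \<alpha> * (a\<^sup>2 + 2 * L)) (at_right 0)"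
      by (intro tendsto_intros)
    then have "((\<lambda>t. t * (a\<^sup>2 * (t powr (-1 / \<alpha>) * \<theta>)\<^sup>2 +
        2 * (LINT u|\<nu>. 1 - cos (t powr (-1 / \<alpha>) * \<theta> * u)))) \<longlongrightarrow> \<bar>\<theta>\<bar> powr \<alpha> * (a\<^sup>2 + 2 * L)) (at_right 0)"
    proof (rule Lim_transform_eventually)
      show "eventually (\<lambda>t. \<bar>\<theta>\<bar> powr \<alpha> * (a\<^sup>2 + 2 * ((\<bar>\<theta>\<bar> * t powr (-1 / \<alpha>)) powr (-\<alpha>) *
          (LINT u|\<nu>. 1 - cos (\<bar>\<theta>\<bar> * t powr (-1 / \<alpha>) * u)))) =
        t * (a\<^sup>2 * (t powr (-1 / \<alpha>) * \<theta>)\<^sup>2 + 2 * (LINT u|\<nu>. 1 - cos (t powr (-1 / \<alpha>) * \<theta> * u)))) (at_right 0)"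
        using eventually_at_right_less[of 0]
      proof eventually_elim
        case (elim t)
        have "cos (\<bar>\<theta>\<bar> * t powr (-1 / \<alpha>) * u) = cos (t powr (-1 / \<alpha>) * \<theta> * u)" for u
          by (cases "0 \<le> \<theta>") (simp_all add: mult_ac)
        moreover have "\<bar>\<theta>\<bar> powr \<alpha> * (\<bar>\<theta>\<bar> * t powr (-1 / \<alpha>)) powr (-\<alpha>) = t"
        proof -
          define x where "x = t powr (-1 / \<alpha>)"
          have "x powr (-\<alpha>) = t" unfolding x_def powr_powr using alpha elim by simp
          then show ?thesis unfolding x_def[symmetric] using False by (simp add: powr_mult powr_minus)
        qed
        moreover have "\<bar>\<theta>\<bar> powr \<alpha> * a\<^sup>2 = t * (a\<^sup>2 * (t powr (-1 / \<alpha>) * \<theta>)\<^sup>2)"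
        proof (cases "a = 0")
          case nz: False
          with quad have \<alpha>: "\<alpha> = 2" by simp
          have "(t powr (-1 / 2))\<^sup>2 = t powr (-1)"
            using elim by (simp add: power2_eq_square flip: powr_add)
          then have "t * (t powr (-1 / 2))\<^sup>2 = 1" using elim by (simp add: powr_minus)
          moreover have "\<bar>\<theta>\<bar> powr 2 = \<theta>\<^sup>2" using False by (subst powr_numeral) auto
          ultimately show ?thesis unfolding \<alpha> by (simp add: power_mult_distrib) 
        qed simp
        moreover have "x * (y + 2 * (z * I)) = x * y + 2 * (x * z) * I" "t * (y + 2 * I) = t * y + 2 * t * I"
          for x y z I :: real by (simp_all add: algebra_simps)
        ultimately show ?case by (simp only:)
      qed
    qed
    moreover have "\<bar>k * \<theta>\<bar> powr \<alpha> = \<bar>\<theta>\<bar> powr \<alpha> * (a\<^sup>2 + 2 * L)"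
      using k by (simp add: abs_mult powr_mult)
    ultimately show ?thesis by (simp only:)
  qed simp
  with k show ?thesis by blast
qed

end

section \<open>Weak convergence\<close>

text \<open>A limit at 0 from the right may be tested along positive null sequences, and to each of
  them Levy's continuity theorem applies.\<close>

lemma weak_conv_along_at_right_of_char:
  fixes \<mu> :: "real \<Rightarrow> real measure"
  assumes \<mu>: "\<And>t. t > 0 \<Longrightarrow> real_distribution (\<mu> t)" and \<mu>': "real_distribution \<mu>'"
    and lim: "\<And>\<theta>. ((\<lambda>t. char (\<mu> t) \<theta>) \<longlongrightarrow> char \<mu>' \<theta>) (at_right 0)"
  shows "weak_conv_along \<mu> \<mu>' (at_right 0)"
  unfolding weak_conv_along_def
proof (intro allI impI)
  fix x assume x: "isCont (cdf \<mu>') x"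
  show "((\<lambda>t. cdf (\<mu> t) x) \<longlongrightarrow> cdf \<mu>' x) (at_right 0)"
    unfolding tendsto_at_iff_sequentially comp_def
  proof (intro allI impI)
    fix t :: "nat \<Rightarrow> real" assume t: "\<forall>i. t i \<in> {0<..} - {0}" "t \<longlonglongrightarrow> 0"
    have "weak_conv_m (\<lambda>n. \<mu> (t n)) \<mu>'"
    proof (rule levy_continuity[OF _ \<mu>'])
      show "real_distribution (\<mu> (t n))" for n using t(1) by (intro \<mu>) auto
      show "(\<lambda>n. char (\<mu> (t n)) \<theta>) \<longlonglongrightarrow> char \<mu>' \<theta>" for \<theta>
        using lim[of \<theta>] t unfolding tendsto_at_iff_sequentially comp_def by blast
    qed
    then show "(\<lambda>n. cdf (\<mu> (t n)) x) \<longlonglongrightarrow> cdf \<mu>' x"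
      using x by (simp add: weak_conv_m_def weak_conv_def)
  qed
qed

text \<open>Gaussian smoothing exchanges the roles of the law and its characteristic function:
  \<open>E exp (- n\<^sup>2 Z\<^sup>2 / 2) = E \<phi> (n G)\<close> for a standard normal \<open>G\<close>. As \<open>n\<close> grows, the left side tends to
  \<open>P (Z = 0)\<close> and the right side to \<open>0\<close>.\<close>

lemma stable_no_atom:
  fixes \<mu> :: "real measure"
  assumes "real_distribution \<mu>" and \<alpha>: "0 < \<alpha>"
    and char: "\<And>\<theta>. char \<mu> \<theta> = complex_of_real (exp (- (\<bar>\<theta>\<bar> powr \<alpha>)))"
  shows "measure \<mu> {0} = 0"
proof -
  interpret \<mu>: real_distribution \<mu> by fact
  let ?G = "std_normal_distribution"
  interpret G: real_distribution ?G by (rule real_dist_normal_dist)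
  interpret P: pair_prob_space \<mu> ?G ..
  have meas [measurable]: "(\<lambda>(z, x). iexp (real n * z * x)) \<in> borel_measurable (\<mu> \<Otimes>\<^sub>M ?G)" for n
    by measurable
  have swap: "(LINT z|\<mu>. complex_of_real (exp (- (real n * z)\<^sup>2 / 2))) =
      (LINT x|?G. complex_of_real (exp (- (\<bar>real n * x\<bar> powr \<alpha>))))" for n
  proof -
    have "complex_of_real (exp (- (real n * z)\<^sup>2 / 2)) = (LINT x|?G. iexp (real n * z * x))" for z
      using fun_cong[OF char_std_normal_distribution, of "real n * z"] unfolding char_def by (rule sym)
    then have "(LINT z|\<mu>. complex_of_real (exp (- (real n * z)\<^sup>2 / 2))) =
        (LINT z|\<mu>. LINT x|?G. iexp (real n * z * x))" by (simp only:)
    also have "\<dots> = (LINT x|?G. LINT z|\<mu>. iexp (real n * z * x))"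
    proof (rule P.Fubini_integral[symmetric])
      show "integrable (\<mu> \<Otimes>\<^sub>M ?G) (\<lambda>(z, x). iexp (real n * z * x))"
        by (rule P.P.integrable_const_bound[where B=1]) (auto split: prod.split)
    qed
    also have "\<dots> = (LINT x|?G. char \<mu> (real n * x))"
      unfolding char_def by (simp add: mult_ac)
    finally show ?thesis by (simp only: char)
  qed
  have "(\<lambda>n. LINT z|\<mu>. complex_of_real (exp (- (real n * z)\<^sup>2 / 2))) \<longlonglongrightarrow>
      (LINT z|\<mu>. complex_of_real (indicator {0} z))"
  proof (rule integral_dominated_convergence[where w="\<lambda>_. 1"])
    show "AE z in \<mu>. (\<lambda>n. complex_of_real (exp (- (real n * z)\<^sup>2 / 2))) \<longlonglongrightarrow> complex_of_real (indicator {0} z)"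
    proof (rule AE_I2)
      fix z :: real
      show "(\<lambda>n. complex_of_real (exp (- (real n * z)\<^sup>2 / 2))) \<longlonglongrightarrow> complex_of_real (indicator {0} z)"
      proof (cases "z = 0")
        case False
        have "filterlim (\<lambda>n. (z\<^sup>2 / 2) * (real n)\<^sup>2) at_top sequentially"
          using False by (intro filterlim_tendsto_pos_mult_at_top[OF tendsto_const]
            filterlim_pow_at_top filterlim_real_sequentially) auto
        then have "filterlim (\<lambda>n. - ((z\<^sup>2 / 2) * (real n)\<^sup>2)) at_bot sequentially"
          by (simp add: filterlim_uminus_at_bot)
        from filterlim_compose[OF exp_at_bot this]
        have "(\<lambda>n. exp (- (real n * z)\<^sup>2 / 2)) \<longlonglongrightarrow> 0"
          by (simp add: power_mult_distrib mult.commute)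
        from tendsto_of_real[OF this] False show ?thesis by simp
      qed simp
    qed
  qed auto
  moreover have "(\<lambda>n. LINT x|?G. complex_of_real (exp (- (\<bar>real n * x\<bar> powr \<alpha>)))) \<longlonglongrightarrow>
      (LINT x|?G. complex_of_real 0)"
  proof (rule integral_dominated_convergence[where w="\<lambda>_. 1"])
    have "AE x in lborel. x \<noteq> (0::real)" by (rule AE_lborel_singleton)
    then have "AE x in ?G. x \<noteq> 0" by (subst AE_density) auto
    then show "AE x in ?G. (\<lambda>n. complex_of_real (exp (- (\<bar>real n * x\<bar> powr \<alpha>)))) \<longlonglongrightarrow> complex_of_real 0"
    proof eventually_elim
      case (elim x)
      have "filterlim (\<lambda>n. real n * \<bar>x\<bar>) at_top sequentially"
        using elim by (intro filterlim_at_top_mult_tendsto_pos[OF tendsto_const _ filterlim_real_sequentially]) auto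
      from tendsto_neg_powr[OF _ this, of "-\<alpha>"] \<alpha>
      have 0: "(\<lambda>n. (real n * \<bar>x\<bar>) powr (- \<alpha>)) \<longlonglongrightarrow> 0" by simp
      have "filterlim (\<lambda>n. (real n * \<bar>x\<bar>) powr \<alpha>) at_top sequentially"
      proof -
        have "filterlim (\<lambda>n. inverse ((real n * \<bar>x\<bar>) powr (- \<alpha>))) at_top sequentially"
          by (rule filterlim_inverse_at_top[OF 0])
            (use eventually_gt_at_top[of 0] in \<open>eventually_elim, use elim in simp\<close>)
        then show ?thesis by (simp add: powr_minus)
      qed
      then have "filterlim (\<lambda>n. - ((real n * \<bar>x\<bar>) powr \<alpha>)) at_bot sequentially"
        by (simp add: filterlim_uminus_at_bot)
      from filterlim_compose[OF exp_at_bot this]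
      have "(\<lambda>n. exp (- (\<bar>real n * x\<bar> powr \<alpha>))) \<longlonglongrightarrow> 0" by (simp add: abs_mult)
      from tendsto_of_real[OF this] show ?case by simp
    qed
  qed auto
  ultimately have "(LINT z|\<mu>. complex_of_real (indicator {0} z)) = (LINT x|?G. complex_of_real 0)"
    unfolding swap by (rule LIMSEQ_unique)
  then show ?thesis by simp
qed

section \<open>Laws of independent triples\<close>

text \<open>Three coordinates, because the covariance of neighbouring summands involves
  \<open>\<psi> x y\<close> together with \<open>\<psi> y z\<close>; the mean and the second moment
  are read off the same measure.\<close>

definition cube_measure :: "real measure \<Rightarrow> (real \<times> real \<times> real) measure" where
  "cube_measure \<mu> = \<mu> \<Otimes>\<^sub>M (\<mu> \<Otimes>\<^sub>M \<mu>)"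

lemma cube_measure_distr:
  assumes "prob_space M" and [measurable]: "Y \<in> borel_measurable M"
  shows "cube_measure (distr M borel Y) =
    distr (M \<Otimes>\<^sub>M (M \<Otimes>\<^sub>M M)) (borel \<Otimes>\<^sub>M (borel \<Otimes>\<^sub>M borel)) (\<lambda>(x, y, z). (Y x, Y y, Y z))"
proof -
  interpret M: prob_space M by fact
  interpret D: prob_space "distr M borel Y" by (rule M.prob_space_distr) simp
  interpret MM: pair_prob_space M M ..
  have 1: "distr M borel Y \<Otimes>\<^sub>M distr M borel Y = distr (M \<Otimes>\<^sub>M M) (borel \<Otimes>\<^sub>M borel) (\<lambda>(x, y). (Y x, Y y))"
    by (rule pair_measure_distr) (simp_all add: D.sigma_finite_measure_axioms)
  interpret DD: prob_space "distr (M \<Otimes>\<^sub>M M) (borel \<Otimes>\<^sub>M borel) (\<lambda>(x, y). (Y x, Y y))"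
    by (rule MM.P.prob_space_distr) measurable
  show ?thesis
    unfolding cube_measure_def 1
    using DD.sigma_finite_measure_axioms by (subst pair_measure_distr) (simp_all add: case_prod_beta')
qed

text \<open>Skorohod's theorem realises the weak convergence pointwise on some \<Omega>. The
  threefold product of \<Omega> carries three independent realisations that still converge
  pointwise. The limit has no atom at 0, so almost every limit triple is a continuity point of
  \<open>f\<close>, and dominated convergence concludes.\<close>

lemma cube_measure_tendsto:
  fixes f :: "real \<Rightarrow> real \<Rightarrow> real \<Rightarrow> real"
  assumes \<mu>: "\<And>n. real_distribution (\<mu> n)" "real_distribution \<mu>'" and conv: "weak_conv_m \<mu> \<mu>'"
    and atom: "measure \<mu>' {0} = 0"
    and meas [measurable]: "(\<lambda>(x, y, z). f x y z) \<in> borel_measurable (borel \<Otimes>\<^sub>M (borel \<Otimes>\<^sub>M borel))"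
    and bound: "\<And>x y z. \<bar>f x y z\<bar> \<le> B"
    and cont: "\<And>X Y Z x y z. X \<longlonglongrightarrow> x \<Longrightarrow> Y \<longlonglongrightarrow> y \<Longrightarrow> Z \<longlonglongrightarrow> z \<Longrightarrow> x \<noteq> 0 \<Longrightarrow> y \<noteq> 0 \<Longrightarrow> z \<noteq> 0 \<Longrightarrow>
        (\<lambda>n. f (X n) (Y n) (Z n)) \<longlonglongrightarrow> f x y z"
  shows "(\<lambda>n. LINT (x, y, z)|cube_measure (\<mu> n). f x y z) \<longlonglongrightarrow> (LINT (x, y, z)|cube_measure \<mu>'. f x y z)"
proof -
  obtain \<Omega> :: "real measure" and Yn Y where \<Omega>: "prob_space \<Omega>"
    and Yn [measurable]: "\<And>n. Yn n \<in> borel_measurable \<Omega>" and dn: "\<And>n. distr \<Omega> borel (Yn n) = \<mu> n"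
    and Y': "Y \<in> measurable \<Omega> lborel" and d: "distr \<Omega> borel Y = \<mu>'"
    and lim: "\<And>x. x \<in> space \<Omega> \<Longrightarrow> (\<lambda>n. Yn n x) \<longlonglongrightarrow> Y x"
    using Skorohod[OF \<mu> conv] by blast
  have Y [measurable]: "Y \<in> borel_measurable \<Omega>" using Y' by simp
  interpret \<Omega>: prob_space \<Omega> by fact
  interpret O2: pair_prob_space \<Omega> \<Omega> ..
  interpret O3: pair_prob_space \<Omega> "\<Omega> \<Otimes>\<^sub>M \<Omega>" ..
  interpret \<mu>': real_distribution \<mu>' by fact
  let ?O = "\<Omega> \<Otimes>\<^sub>M (\<Omega> \<Otimes>\<^sub>M \<Omega>)"
  have fm: "(\<lambda>(x, y, z). f (W x) (W y) (W z)) \<in> borel_measurable ?O"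
    if [measurable]: "W \<in> borel_measurable \<Omega>" for W
  proof -
    have "(\<lambda>(x, y, z). (W x, W y, W z)) \<in> ?O \<rightarrow>\<^sub>M borel \<Otimes>\<^sub>M (borel \<Otimes>\<^sub>M borel)" by measurable
    from measurable_compose[OF this meas] show ?thesis by (simp add: split_def)
  qed
  have eq: "(LINT (x, y, z)|cube_measure (distr \<Omega> borel W). f x y z) = (LINT (x, y, z)|?O. f (W x) (W y) (W z))"
    if [measurable]: "W \<in> borel_measurable \<Omega>" for W
    unfolding cube_measure_distr[OF \<Omega> that]
    using meas by (subst integral_distr) (auto simp: split_def)
  have "AE x in \<mu>'. x \<notin> {0}"
    using atom by (intro AE_not_in) (auto simp: null_sets_def \<mu>'.emeasure_eq_measure)
  then have nz: "AE x in \<Omega>. Y x \<noteq> 0" unfolding d[symmetric] by (subst (asm) AE_distr_iff) auto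
  have nz3: "AE w in ?O. Y (fst w) \<noteq> 0 \<and> Y (fst (snd w)) \<noteq> 0 \<and> Y (snd (snd w)) \<noteq> 0"
  proof (rule O3.AE_pair_measure)
    have "AE w in \<Omega> \<Otimes>\<^sub>M \<Omega>. Y (fst w) \<noteq> 0 \<and> Y (snd w) \<noteq> 0"
      by (rule O2.AE_pair_measure) (use nz in auto)
    then show "AE x in \<Omega>. AE y in \<Omega> \<Otimes>\<^sub>M \<Omega>. Y (fst (x, y)) \<noteq> 0 \<and> Y (fst (snd (x, y))) \<noteq> 0 \<and> Y (snd (snd (x, y))) \<noteq> 0"
      using nz by auto
  qed measurable
  have "(\<lambda>n. LINT (x, y, z)|?O. f (Yn n x) (Yn n y) (Yn n z)) \<longlonglongrightarrow> (LINT (x, y, z)|?O. f (Y x) (Y y) (Y z))"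
  proof (rule integral_dominated_convergence[where w="\<lambda>_. B"])
    show "AE w in ?O. (\<lambda>n. case w of (x, y, z) \<Rightarrow> f (Yn n x) (Yn n y) (Yn n z)) \<longlonglongrightarrow>
        (case w of (x, y, z) \<Rightarrow> f (Y x) (Y y) (Y z))"
      using nz3 AE_space
      by eventually_elim (auto simp: space_pair_measure intro!: cont lim)
    show "integrable ?O (\<lambda>_. B)" by (rule O3.P.integrable_const)
  qed (auto simp: bound fm split: prod.split)
  then show ?thesis unfolding eq[OF Yn, unfolded dn] eq[OF Y, unfolded d] .
qed

lemma (in prob_space) distr_iid_triple:
  fixes Y :: "'i \<Rightarrow> 'a \<Rightarrow> real"
  assumes indep: "indep_vars (\<lambda>_. borel) Y {i, j, k}" and neq: "i \<noteq> j" "j \<noteq> k" "i \<noteq> k"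
    and law: "distr M borel (Y i) = \<mu>" "distr M borel (Y j) = \<mu>" "distr M borel (Y k) = \<mu>"
  shows "distr M (borel \<Otimes>\<^sub>M (borel \<Otimes>\<^sub>M borel)) (\<lambda>\<omega>. (Y i \<omega>, Y j \<omega>, Y k \<omega>)) = cube_measure \<mu>"
proof -
  have meas [measurable]: "Y i \<in> borel_measurable M" "Y j \<in> borel_measurable M" "Y k \<in> borel_measurable M"
    using indep by (auto simp: indep_vars_def2)
  interpret \<mu>: real_distribution \<mu> unfolding law(1)[symmetric] by simp
  interpret \<mu>2: pair_prob_space \<mu> \<mu> ..
  \<comment> \<open>Splits one coordinate \<open>l\<close> off a block \<open>B\<close> of others;
    applied first to separate \<open>j\<close> from \<open>k\<close>, then \<open>i\<close> from
    that pair. Agreement on rectangles suffices, and independence enters through products of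
    indicators.\<close>
  have factor: "distr M S f = distr M borel (Y l) \<Otimes>\<^sub>M distr M N (\<lambda>\<omega>. h (restrict (\<lambda>i. Y i \<omega>) B))"
    if l: "l \<in> {i, j, k}" "l \<notin> B" "B \<subseteq> {i, j, k}" and h [measurable]: "h \<in> PiM B (\<lambda>_. borel) \<rightarrow>\<^sub>M N"
      and S: "S = borel \<Otimes>\<^sub>M N" and f: "f = (\<lambda>\<omega>. (Y l \<omega>, h (restrict (\<lambda>i. Y i \<omega>) B)))"
    for l B and h :: "('i \<Rightarrow> real) \<Rightarrow> 'c" and N S f
  proof (rule pair_measure_eqI[symmetric])
    have r [measurable]: "(\<lambda>\<omega>. restrict (\<lambda>i. Y i \<omega>) B) \<in> M \<rightarrow>\<^sub>M PiM B (\<lambda>_. borel)"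
      using l meas by (intro measurable_restrict) auto
    have Yl [measurable]: "Y l \<in> borel_measurable M" using l meas by auto
    show "sigma_finite_measure (distr M borel (Y l))"
      "sigma_finite_measure (distr M N (\<lambda>\<omega>. h (restrict (\<lambda>i. Y i \<omega>) B)))"
      by (intro prob_space_imp_sigma_finite prob_space_distr; measurable)+
    show "sets (distr M borel (Y l) \<Otimes>\<^sub>M distr M N (\<lambda>\<omega>. h (restrict (\<lambda>i. Y i \<omega>) B))) = sets (distr M S f)"
      unfolding S by (simp cong: sets_pair_measure_cong)
    fix C D assume C: "C \<in> sets (distr M borel (Y l))" and D: "D \<in> sets (distr M N (\<lambda>\<omega>. h (restrict (\<lambda>i. Y i \<omega>) B)))"
    then have [measurable]: "C \<in> sets borel" "D \<in> sets N" by simp_all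
    have "indep_var borel ((\<lambda>g. indicator C (g l) :: real) \<circ> (\<lambda>\<omega>. restrict (\<lambda>i. Y i \<omega>) {l}))
        borel ((\<lambda>g. indicator D (h g) :: real) \<circ> (\<lambda>\<omega>. restrict (\<lambda>i. Y i \<omega>) B))"
      by (rule indep_var_compose[OF indep_var_restrict[OF indep]]) (use l in auto)
    then have ind: "indep_var borel (\<lambda>\<omega>. indicator C (Y l \<omega>) :: real)
        borel (\<lambda>\<omega>. indicator D (h (restrict (\<lambda>i. Y i \<omega>) B)) :: real)" by (simp add: comp_def)
    have e: "expectation (\<lambda>\<omega>. indicator C (Y l \<omega>) * indicator D (h (restrict (\<lambda>i. Y i \<omega>) B)) :: real) =
        expectation (\<lambda>\<omega>. indicator C (Y l \<omega>) :: real) * expectation (\<lambda>\<omega>. indicator D (h (restrict (\<lambda>i. Y i \<omega>) B)))"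
      by (rule indep_var_lebesgue_integral[OF ind]) (auto intro!: integrable_const_bound[where B=1])
    have "(\<lambda>\<omega>. indicator C (Y l \<omega>) :: real) = indicator (Y l -` C)"
      "(\<lambda>\<omega>. indicator D (h (restrict (\<lambda>i. Y i \<omega>) B)) :: real) =
        indicator ((\<lambda>\<omega>. h (restrict (\<lambda>i. Y i \<omega>) B)) -` D)"
      "(\<lambda>\<omega>. indicator C (Y l \<omega>) * indicator D (h (restrict (\<lambda>i. Y i \<omega>) B)) :: real) =
        indicator (f -` (C \<times> D))" by (auto simp: indicator_def f)
    note e[unfolded this(3), unfolded this(1,2)]
    then have "prob (f -` (C \<times> D) \<inter> space M) = prob (Y l -` C \<inter> space M) *
        prob ((\<lambda>\<omega>. h (restrict (\<lambda>i. Y i \<omega>) B)) -` D \<inter> space M)"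
      by simp
    then show "emeasure (distr M borel (Y l)) C * emeasure (distr M N (\<lambda>\<omega>. h (restrict (\<lambda>i. Y i \<omega>) B))) D =
        emeasure (distr M S f) (C \<times> D)"
      unfolding S f by (simp add: emeasure_distr emeasure_eq_measure ennreal_mult)
  qed
  have "distr M (borel \<Otimes>\<^sub>M borel) (\<lambda>\<omega>. (Y j \<omega>, Y k \<omega>)) = \<mu> \<Otimes>\<^sub>M \<mu>"
    using factor[of j "{k}" "\<lambda>g. g k" borel _ "\<lambda>\<omega>. (Y j \<omega>, Y k \<omega>)"] neq by (simp add: law)
  then show ?thesis unfolding cube_measure_def
    using factor[of i "{j, k}" "\<lambda>g. (g j, g k)" "borel \<Otimes>\<^sub>M borel" _ "\<lambda>\<omega>. (Y i \<omega>, Y j \<omega>, Y k \<omega>)"] neq by (simp add: law)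
qed

section \<open>Sums of 1-dependent bounded variables\<close>

text \<open>One row of a triangular array. The function \<open>g\<close> and the moments are
  parameters because the centring, and with it every moment, depends on the row. The
  \<open>m\<close> variables give \<open>m - 1\<close> summands, hence the conditions
  \<open>Suc k < m\<close>.\<close>

locale pair_array = prob_space M for M :: "'a measure" +
  fixes Y :: "nat \<Rightarrow> 'a \<Rightarrow> real" and g :: "real \<Rightarrow> real \<Rightarrow> real" and m :: nat and v c :: real
  assumes indep: "indep_vars (\<lambda>_. borel) Y {..<m}"
    and g_measurable: "(\<lambda>p. g (fst p) (snd p)) \<in> borel_measurable (borel \<Otimes>\<^sub>M borel)"
    and g_bound: "\<bar>g x y\<bar> \<le> 1"
    and mean: "Suc k < m \<Longrightarrow> expectation (\<lambda>\<omega>. g (Y k \<omega>) (Y (Suc k) \<omega>)) = 0"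
    and second_moment: "Suc k < m \<Longrightarrow> expectation (\<lambda>\<omega>. (g (Y k \<omega>) (Y (Suc k) \<omega>))\<^sup>2) = v"
    and cov: "Suc (Suc k) < m \<Longrightarrow>
      expectation (\<lambda>\<omega>. g (Y k \<omega>) (Y (Suc k) \<omega>) * g (Y (Suc k) \<omega>) (Y (Suc (Suc k)) \<omega>)) = c"
begin

definition V :: "nat \<Rightarrow> 'a \<Rightarrow> real" where
  "V k \<omega> = g (Y k \<omega>) (Y (Suc k) \<omega>)"

lemma Y_measurable [measurable]: "k < m \<Longrightarrow> Y k \<in> borel_measurable M"
  using indep by (auto simp: indep_vars_def2)

lemma V_measurable [measurable]: "Suc k < m \<Longrightarrow> V k \<in> borel_measurable M"
  unfolding V_def
  using measurable_compose[OF measurable_Pair[OF Y_measurable Y_measurable] g_measurable, of k "Suc k"]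
  by simp

lemma V_bound: "\<bar>V k \<omega>\<bar> \<le> 1"
  by (simp add: V_def g_bound)

lemma integrable_V: "Suc k < m \<Longrightarrow> integrable M (V k)"
  by (rule integrable_const_bound[where B=1]) (auto simp: V_bound)

lemma V_prod_bound: "\<bar>V j \<omega> * V k \<omega>\<bar> \<le> 1"
  unfolding abs_mult by (rule mult_le_one) (simp_all add: V_bound)

lemma integrable_V_prod: "Suc j < m \<Longrightarrow> Suc k < m \<Longrightarrow> integrable M (\<lambda>\<omega>. V j \<omega> * V k \<omega>)"
  by (rule integrable_const_bound[where B=1]) (auto simp: V_prod_bound)

text \<open>\<open>V k\<close> reads only \<open>Y k\<close> and \<open>Y (Suc k)\<close>, so the
  sum over \<open>J j\<close> is a function of the variables indexed by \<open>K j\<close>, and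
  disjoint \<open>K j\<close> give independence. Used for isolated summands and for long
  blocks.\<close>

lemma indep_block_sums:
  assumes K: "\<And>j. j \<in> L \<Longrightarrow> K j \<subseteq> {..<m}" and disj: "disjoint_family_on K L"
    and J: "\<And>j k. j \<in> L \<Longrightarrow> k \<in> J j \<Longrightarrow> k \<in> K j \<and> Suc k \<in> K j"
  shows "indep_vars (\<lambda>_. borel) (\<lambda>j \<omega>. \<Sum>k\<in>J j. V k \<omega>) L"
proof -
  have 1: "indep_vars (\<lambda>j. PiM (K j) (\<lambda>_. borel)) (\<lambda>j \<omega>. restrict (\<lambda>i. Y i \<omega>) (K j)) L"
    using indep_vars_restrict[OF indep K disj] .
  have "indep_vars (\<lambda>_. borel) (\<lambda>j \<omega>. (\<Sum>k\<in>J j. g (restrict (\<lambda>i. Y i \<omega>) (K j) k)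
      (restrict (\<lambda>i. Y i \<omega>) (K j) (Suc k)))) L"
  proof (rule indep_vars_compose2[OF 1, where Y="\<lambda>j f. \<Sum>k\<in>J j. g (f k) (f (Suc k))"])
    fix j assume j: "j \<in> L"
    show "(\<lambda>f. \<Sum>k\<in>J j. g (f k) (f (Suc k))) \<in> borel_measurable (PiM (K j) (\<lambda>_. borel))"
    proof (rule borel_measurable_sum)
      fix k assume k: "k \<in> J j"
      have "(\<lambda>f. (f k, f (Suc k))) \<in> PiM (K j) (\<lambda>_. borel) \<rightarrow>\<^sub>M borel \<Otimes>\<^sub>M borel"
        using J[OF j k] by (auto intro!: measurable_Pair measurable_component_singleton)
      from measurable_compose[OF this g_measurable]
      show "(\<lambda>f. g (f k) (f (Suc k))) \<in> borel_measurable (PiM (K j) (\<lambda>_. borel))" by simp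
    qed
  qed
  moreover have "(\<lambda>\<omega>. (\<Sum>k\<in>J j. g (restrict (\<lambda>i. Y i \<omega>) (K j) k)
      (restrict (\<lambda>i. Y i \<omega>) (K j) (Suc k)))) = (\<lambda>\<omega>. \<Sum>k\<in>J j. V k \<omega>)" if "j \<in> L" for j
    using J[OF that] by (auto simp: V_def fun_eq_iff intro!: sum.cong)
  ultimately show ?thesis
    by (subst indep_vars_cong[OF refl _ refl]) auto
qed

lemma indep_V_single:
  assumes L: "\<And>k. k \<in> L \<Longrightarrow> Suc k < m"
    and gap: "\<And>j k. j \<in> L \<Longrightarrow> k \<in> L \<Longrightarrow> j < k \<Longrightarrow> Suc j < k"
  shows "indep_vars (\<lambda>_. borel) V L"
proof -
  have "indep_vars (\<lambda>_. borel) (\<lambda>j \<omega>. \<Sum>k\<in>{j}. V k \<omega>) L"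
  proof (rule indep_block_sums)
    show "disjoint_family_on (\<lambda>j. {j, Suc j}) L"
      using gap by (force simp: disjoint_family_on_def dest: linorder_neqE_nat)
  qed (use L in \<open>auto dest: Suc_lessD\<close>)
  then show ?thesis by simp
qed

lemma expectation_V_prod_far:
  assumes "Suc j < k" "Suc k < m"
  shows "expectation (\<lambda>\<omega>. V j \<omega> * V k \<omega>) = 0"
proof -
  have "indep_vars (\<lambda>_. borel) V {j, k}"
    by (rule indep_V_single) (use assms in auto)
  then have "expectation (\<lambda>\<omega>. \<Prod>i\<in>{j,k}. V i \<omega>) = (\<Prod>i\<in>{j,k}. expectation (V i))"
    by (rule indep_vars_lebesgue_integral[rotated]) (use assms integrable_V in auto)
  moreover have "expectation (V j) = 0"
    using mean[of j] assms by (simp add: V_def[abs_def])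
  ultimately show ?thesis using assms by simp
qed

text \<open>By 1-dependence each index correlates with at most three indices, itself and its
  neighbours, and each product has modulus at most 1. This controls the summands that the block
  decomposition discards.\<close>

lemma second_moment_sum_le:
  assumes G: "G \<subseteq> {..<m - 1}"
  shows "expectation (\<lambda>\<omega>. (\<Sum>k\<in>G. V k \<omega>)\<^sup>2) \<le> 3 * card G"
proof -
  have fin: "finite G" using G finite_subset by blast
  have lt: "Suc k < m" if "k \<in> G" for k using G that by auto
  have "expectation (\<lambda>\<omega>. (\<Sum>k\<in>G. V k \<omega>)\<^sup>2) = (\<Sum>j\<in>G. \<Sum>k\<in>G. expectation (\<lambda>\<omega>. V j \<omega> * V k \<omega>))"
    by (simp add: power2_eq_square sum_product integrable_V_prod lt)
  also have "\<dots> \<le> (\<Sum>j\<in>G. \<Sum>k\<in>G. indicator {j - 1..Suc j} k)"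
  proof (intro sum_mono)
    fix j k assume jk: "j \<in> G" "k \<in> G"
    show "expectation (\<lambda>\<omega>. V j \<omega> * V k \<omega>) \<le> indicator {j - 1..Suc j} k"
    proof (cases "k \<in> {j - 1..Suc j}")
      case True
      have "expectation (\<lambda>\<omega>. V j \<omega> * V k \<omega>) \<le> expectation (\<lambda>\<omega>. 1)"
        by (rule integral_mono) (use jk lt V_prod_bound integrable_V_prod in \<open>auto simp: abs_le_iff\<close>)
      with True show ?thesis by (simp add: prob_space)
    next
      case False
      then have "Suc j < k \<or> Suc k < j" by auto
      then have "expectation (\<lambda>\<omega>. V j \<omega> * V k \<omega>) = 0"
        using expectation_V_prod_far[of j k] expectation_V_prod_far[of k j] jk lt
        by (auto simp: mult.commute)
      then show ?thesis by simp
    qed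
  qed
  also have "\<dots> \<le> (\<Sum>j\<in>G. 3)"
  proof (rule sum_mono)
    fix j
    have "(\<Sum>k\<in>G. indicator {j - 1..Suc j} k) = (\<Sum>k\<in>G \<inter> {j - 1..Suc j}. (1::real))"
      unfolding sum.inter_restrict[OF fin] by (intro sum.cong) (auto simp: indicator_def)
    also have "\<dots> \<le> card {j - 1..Suc j}"
      by (simp del: card_atLeastAtMost) (rule card_mono, auto)
    also have "\<dots> \<le> 3" by simp
    finally show "(\<Sum>k\<in>G. indicator {j - 1..Suc j} k) \<le> (3::real)" .
  qed
  finally show ?thesis by (simp add: mult.commute)
qed

text \<open>Among \<open>Suc r\<close> consecutive summands only the \<open>r\<close> neighbouring
  pairs have nonzero cross terms; each induction step adds one \<open>v\<close> and one
  \<open>2 * c\<close>.\<close>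

lemma second_moment_block:
  assumes "a + Suc r < m"
  shows "expectation (\<lambda>\<omega>. (\<Sum>k = a..<a + Suc r. V k \<omega>)\<^sup>2) = Suc r * v + 2 * r * c"
  using assms
proof (induction r)
  case 0
  then show ?case using second_moment[of a] by (simp add: V_def)
next
  case (Suc r)
  let ?S = "\<lambda>\<omega>. \<Sum>k = a..<a + Suc r. V k \<omega>"
  have int: "integrable M (\<lambda>\<omega>. V k \<omega> * V (a + Suc r) \<omega>)" if "k < a + Suc r" for k
    using that Suc.prems by (intro integrable_V_prod) auto
  have intS: "integrable M (\<lambda>\<omega>. ?S \<omega> * V (a + Suc r) \<omega>)"
    unfolding sum_distrib_right by (intro Bochner_Integration.integrable_sum int) auto
  have intS2: "integrable M (\<lambda>\<omega>. (?S \<omega>)\<^sup>2)"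
    unfolding power2_eq_square sum_product
    by (intro Bochner_Integration.integrable_sum integrable_V_prod) (use Suc.prems in auto)
  have intV2: "integrable M (\<lambda>\<omega>. (V (a + Suc r) \<omega>)\<^sup>2)"
    unfolding power2_eq_square by (intro integrable_V_prod) (use Suc.prems in auto)
  have "expectation (\<lambda>\<omega>. ?S \<omega> * V (a + Suc r) \<omega>) =
      (\<Sum>k = a..<a + Suc r. expectation (\<lambda>\<omega>. V k \<omega> * V (a + Suc r) \<omega>))"
    unfolding sum_distrib_right by (intro Bochner_Integration.integral_sum int) auto
  also have "\<dots> = (\<Sum>k = a..<a + r. expectation (\<lambda>\<omega>. V k \<omega> * V (a + Suc r) \<omega>)) +
      expectation (\<lambda>\<omega>. V (a + r) \<omega> * V (a + Suc r) \<omega>)"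
    by simp
  also have "expectation (\<lambda>\<omega>. V (a + r) \<omega> * V (a + Suc r) \<omega>) = c"
    using cov[of "a + r"] Suc.prems by (simp add: V_def)
  also have "(\<Sum>k = a..<a + r. expectation (\<lambda>\<omega>. V k \<omega> * V (a + Suc r) \<omega>)) = 0"
    by (rule sum.neutral) (use Suc.prems in \<open>auto intro!: expectation_V_prod_far\<close>)
  finally have cross: "expectation (\<lambda>\<omega>. ?S \<omega> * V (a + Suc r) \<omega>) = c" by simp
  have "expectation (\<lambda>\<omega>. (\<Sum>k = a..<a + Suc (Suc r). V k \<omega>)\<^sup>2) =
     expectation (\<lambda>\<omega>. (?S \<omega>)\<^sup>2 + 2 * (?S \<omega> * V (a + Suc r) \<omega>) + (V (a + Suc r) \<omega>)\<^sup>2)"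
    by (rule Bochner_Integration.integral_cong) (simp_all add: power2_eq_square algebra_simps)
  also have "\<dots> = expectation (\<lambda>\<omega>. (?S \<omega>)\<^sup>2) + 2 * c + expectation (\<lambda>\<omega>. (V (a + Suc r) \<omega>)\<^sup>2)"
    using intS intS2 intV2 cross by simp
  also have "expectation (\<lambda>\<omega>. (V (a + Suc r) \<omega>)\<^sup>2) = v"
    using second_moment[of "a + Suc r"] Suc.prems by (simp add: V_def)
  finally show ?case using Suc by (simp add: algebra_simps)
qed

end

section \<open>Characteristic function estimates and the central limit theorem\<close>

text \<open>Both sides are compared with 1 - s^2 w / 2: Taylor expansion costs a third moment on the
  left, and e^(-x) differs from 1 - x by at most x^2 / 2 on the right, where w \<le> b^2. Numerical
  constants are given away.\<close>

lemma (in prob_space) char_near_gaussian: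
  fixes X :: "'a \<Rightarrow> real"
  assumes X [measurable]: "X \<in> borel_measurable M"
    and bound: "\<And>\<omega>. \<bar>X \<omega>\<bar> \<le> b" and mean: "expectation X = 0"
    and var: "expectation (\<lambda>\<omega>. (X \<omega>)\<^sup>2) = w"
  shows "cmod (char (distr M borel X) s - exp (- (s\<^sup>2 * w / 2))) \<le> \<bar>s\<bar>^3 * b^3 + s^4 * b^4"
proof -
  have b0: "0 \<le> b" using bound[of undefined] by linarith
  have intX: "integrable M X" by (rule integrable_const_bound[where B=b]) (auto simp: bound)
  have sq: "(X \<omega>)\<^sup>2 \<le> b\<^sup>2" for \<omega> using bound[of \<omega>] b0 by (simp add: abs_le_square_iff[symmetric])
  have intX2: "integrable M (\<lambda>\<omega>. (X \<omega>)\<^sup>2)"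
    by (rule integrable_const_bound[where B="b\<^sup>2"]) (auto simp: sq)
  have w0: "0 \<le> w" unfolding var[symmetric] by simp
  have wb: "w \<le> b\<^sup>2"
  proof -
    have "w \<le> expectation (\<lambda>\<omega>. b\<^sup>2)" unfolding var[symmetric] by (rule integral_mono[OF intX2]) (auto simp: sq)
    then show ?thesis by (simp add: prob_space)
  qed
  have "cmod (char (distr M borel X) s - (1 - s\<^sup>2 * w / 2)) \<le>
      (s\<^sup>2 / 6) * expectation (\<lambda>\<omega>. min (6 * (X \<omega>)\<^sup>2) (\<bar>s\<bar> * \<bar>X \<omega>\<bar>^3))"
    using intX intX2 mean var by (intro char_approx3') auto
  also have "\<dots> \<le> (s\<^sup>2 / 6) * expectation (\<lambda>\<omega>. \<bar>s\<bar> * b^3)"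
  proof (intro mult_left_mono integral_mono)
    have "\<bar>min (6 * (X \<omega>)\<^sup>2) (\<bar>s\<bar> * \<bar>X \<omega>\<bar>^3)\<bar> \<le> 6 * b\<^sup>2" for \<omega>
      using sq[of \<omega>] by (simp add: min_def)
    then show "integrable M (\<lambda>\<omega>. min (6 * (X \<omega>)\<^sup>2) (\<bar>s\<bar> * \<bar>X \<omega>\<bar>^3))"
      by (intro integrable_const_bound[where B="6 * b\<^sup>2"]) auto
    show "min (6 * (X \<omega>)\<^sup>2) (\<bar>s\<bar> * \<bar>X \<omega>\<bar>^3) \<le> \<bar>s\<bar> * b^3" for \<omega>
      using power_mono[OF bound[of \<omega>], of 3] by (intro min.coboundedI2 mult_left_mono) auto
  qed auto
  also have "\<dots> = \<bar>s\<bar>^3 * b^3 / 6"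
    by (simp add: prob_space power2_eq_square power3_eq_cube abs_mult_self_eq flip: abs_mult)
  also have "\<dots> \<le> \<bar>s\<bar>^3 * b^3" using b0 by simp
  finally have 1: "cmod (char (distr M borel X) s - (1 - s\<^sup>2 * w / 2)) \<le> \<bar>s\<bar>^3 * b^3" .
  define x where "x = s\<^sup>2 * w / 2"
  have x0: "0 \<le> x" using w0 by (simp add: x_def)
  have "\<bar>(1 - x) - exp (- x)\<bar> \<le> x\<^sup>2 / 2"
  proof -
    have "1 - x \<le> exp (- x)" using exp_ge_add_one_self[of "-x"] by simp
    moreover have "exp (- x) \<le> 1 - x + x\<^sup>2 / 2"
    proof -
      have d: "((\<lambda>x. 1 - x + x\<^sup>2 / 2 - exp (- x)) has_real_derivative (- 1 + y + exp (- y))) (at y)" for y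
        by (auto intro!: derivative_eq_intros)
      have "1 - 0 + 0\<^sup>2 / 2 - exp (- 0) \<le> 1 - x + x\<^sup>2 / 2 - exp (- x)"
        by (rule DERIV_nonneg_imp_nondecreasing[OF x0])
          (use d exp_ge_add_one_self[of "- y" for y] in \<open>force simp: algebra_simps intro!: exI\<close>)
      then show ?thesis by simp
    qed
    ultimately show ?thesis using x0 by (simp add: abs_le_iff)
  qed
  also have "x\<^sup>2 / 2 = s^4 * w\<^sup>2 / 8" by (simp add: x_def power2_eq_square field_simps eval_nat_numeral)
  also have "\<dots> \<le> s^4 * (b\<^sup>2)\<^sup>2 / 8" using w0 wb by (intro divide_right_mono mult_left_mono power_mono) auto
  also have "\<dots> \<le> s^4 * b^4" by (simp flip: power_mult)
  finally have 2: "\<bar>(1 - x) - exp (- x)\<bar> \<le> s^4 * b^4" .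
  have "cmod (char (distr M borel X) s - exp (- x)) \<le>
     cmod (char (distr M borel X) s - (1 - x)) + cmod (complex_of_real ((1 - x) - exp (- x)))"
    by (rule order_trans[OF _ norm_triangle_ineq]) simp
  with 1 2 show ?thesis unfolding norm_of_real x_def by simp
qed

text \<open>\<open>iexp\<close> is 1-Lipschitz, and the first absolute moment is at most the root of
  the second because the variance of |U - W| is nonnegative.\<close>

lemma (in prob_space) char_diff_le:
  fixes U W :: "'a \<Rightarrow> real"
  assumes [measurable]: "U \<in> borel_measurable M" "W \<in> borel_measurable M"
    and int: "integrable M (\<lambda>\<omega>. (U \<omega> - W \<omega>)\<^sup>2)"
  shows "cmod (char (distr M borel U) s - char (distr M borel W) s)
    \<le> \<bar>s\<bar> * sqrt (expectation (\<lambda>\<omega>. (U \<omega> - W \<omega>)\<^sup>2))"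
proof -
  have int1: "integrable M (\<lambda>\<omega>. \<bar>U \<omega> - W \<omega>\<bar>)"
    by (rule square_integrable_imp_integrable) (use int in simp_all)
  have b: "cmod (iexp x - iexp y) \<le> \<bar>x - y\<bar>" for x y :: real
  proof -
    have "iexp x - iexp y = iexp y * (iexp (x - y) - 1)"
      by (simp add: right_diff_distrib exp_diff exp_minus field_simps)
    then have "cmod (iexp x - iexp y) = cmod (iexp (x - y) - 1)" by (simp add: norm_mult)
    also have "\<dots> \<le> \<bar>x - y\<bar>" using iexp_approx1[of "x - y" 0] by simp
    finally show ?thesis .
  qed
  have "char (distr M borel U) s - char (distr M borel W) s =
      expectation (\<lambda>\<omega>. iexp (s * U \<omega>)) - expectation (\<lambda>\<omega>. iexp (s * W \<omega>))"
    by (simp add: char_def integral_distr)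
  also have "\<dots> = expectation (\<lambda>\<omega>. iexp (s * U \<omega>) - iexp (s * W \<omega>))"
    by (subst Bochner_Integration.integral_diff) (auto intro!: integrable_iexp)
  also have "cmod \<dots> \<le> expectation (\<lambda>\<omega>. \<bar>s\<bar> * \<bar>U \<omega> - W \<omega>\<bar>)"
  proof (rule order_trans[OF integral_norm_bound integral_mono])
    show "cmod (iexp (s * U \<omega>) - iexp (s * W \<omega>)) \<le> \<bar>s\<bar> * \<bar>U \<omega> - W \<omega>\<bar>" for \<omega>
      using b[of "s * U \<omega>" "s * W \<omega>"] by (simp add: abs_mult flip: right_diff_distrib)
    show "integrable M (\<lambda>\<omega>. cmod (iexp (s * U \<omega>) - iexp (s * W \<omega>)))"
      by (intro integrable_norm Bochner_Integration.integrable_diff integrable_iexp) auto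
  qed (use int1 in simp)
  also have "\<dots> = \<bar>s\<bar> * expectation (\<lambda>\<omega>. \<bar>U \<omega> - W \<omega>\<bar>)" by simp
  also have "\<dots> \<le> \<bar>s\<bar> * sqrt (expectation (\<lambda>\<omega>. (U \<omega> - W \<omega>)\<^sup>2))"
  proof (intro mult_left_mono real_le_rsqrt)
    have "0 \<le> variance (\<lambda>\<omega>. \<bar>U \<omega> - W \<omega>\<bar>)" by (rule variance_positive)
    also have "\<dots> = expectation (\<lambda>\<omega>. (U \<omega> - W \<omega>)\<^sup>2) - (expectation (\<lambda>\<omega>. \<bar>U \<omega> - W \<omega>\<bar>))\<^sup>2"
      by (subst variance_eq) (use int int1 in simp_all)
    finally show "(expectation (\<lambda>\<omega>. \<bar>U \<omega> - W \<omega>\<bar>))\<^sup>2 \<le> expectation (\<lambda>\<omega>. (U \<omega> - W \<omega>)\<^sup>2)" by simp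
  qed simp
  finally show ?thesis .
qed

context pair_array begin

text \<open>Cutting the \<open>Y\<close>'s into blocks of length \<open>p\<close> makes the sums of the \<open>V k\<close> inside the blocks
  independent; the \<open>V k\<close> that straddle two blocks, and the incomplete last block, only cost the
  first error term, which is small compared with the standard deviation once \<open>p\<close> is large.\<close>

lemma char_sum_bound:
  assumes p: "2 \<le> p" "p \<le> m"
  defines "w \<equiv> (real p - 1) * v + 2 * (real p - 2) * c"
  shows "cmod (char (distr M borel (\<lambda>\<omega>. \<Sum>k<m - 1. V k \<omega>)) s - exp (- (real (m div p) * (s\<^sup>2 * w / 2))))
    \<le> \<bar>s\<bar> * sqrt (3 * (real (m div p) + p)) + real (m div p) * (\<bar>s\<bar>^3 * p^3 + s^4 * p^4)"
proof -
  define q where "q = m div p"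
  \<comment> \<open>A block of \<open>p\<close> variables determines only \<open>p - 1\<close>
    summands, so \<open>J j\<close> stops one short of the block end. The coefficients
    \<open>p - 1\<close> and \<open>p - 2\<close> in \<open>w\<close> count summands and
    neighbouring pairs.\<close>
  define J where "J j = {j * p..<j * p + (p - 1)}" for j
  define B where "B j \<omega> = (\<Sum>k\<in>J j. V k \<omega>)" for j \<omega>
  define G where "G = {..<m - 1} - (\<Union>j<q. J j)"
  obtain r where r: "p = Suc (Suc r)" using p by (metis le_Suc_ex add_2_eq_Suc)
  have qp: "q * p \<le> m" "m < q * p + p" using p
    using dividend_less_div_times[of p m] by (auto simp: q_def div_times_less_eq_dividend)
  have jq: "j * p + p \<le> q * p" if "j < q" for j
    using mult_le_mono1[of "Suc j" q p] that by simp
  have B_lt: "Suc k < m" if "j < q" "k \<in> J j" for j k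
    using that jq[of j] qp p by (auto simp: J_def)
  have disjK: "disjoint_family_on (\<lambda>j. {j * p..<j * p + p}) {..<q}"
    unfolding disjoint_family_on_def
  proof (intro ballI impI)
    fix i j :: nat assume "i \<noteq> j"
    have "i' * p + p \<le> j' * p" if "i' < j'" for i' j' :: nat
      using mult_le_mono1[of "Suc i'" j' p] that by simp
    then have "i * p + p \<le> j * p \<or> j * p + p \<le> i * p"
      using \<open>i \<noteq> j\<close> linorder_neqE_nat by blast
    then show "{i * p..<i * p + p} \<inter> {j * p..<j * p + p} = {}" by auto
  qed
  have finJ: "finite (J j)" for j by (simp add: J_def)
  from disjK have disjJ: "disjoint_family_on J {..<q}"
    by (fastforce simp: disjoint_family_on_def J_def)
  have indepB: "indep_vars (\<lambda>_. borel) B {..<q}"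
    unfolding B_def[abs_def]
  proof (rule indep_block_sums[where K="\<lambda>j. {j * p..<j * p + p}"])
    show "{j * p..<j * p + p} \<subseteq> {..<m}" if "j \<in> {..<q}" for j
      using jq[of j] that qp by auto
  qed (use disjK in \<open>auto simp: J_def\<close>)
  have B_meas [measurable]: "B j \<in> borel_measurable M" if "j < q" for j
    unfolding B_def[abs_def] using B_lt that by (intro borel_measurable_sum V_measurable) auto
  have S: "(\<Sum>k<m - 1. V k \<omega>) = (\<Sum>j<q. B j \<omega>) + (\<Sum>k\<in>G. V k \<omega>)" for \<omega>
  proof -
    have "(\<Sum>k<m - 1. V k \<omega>) = (\<Sum>k\<in>(\<Union>j<q. J j). V k \<omega>) + (\<Sum>k\<in>G. V k \<omega>)"
      unfolding G_def using B_lt by (subst sum.subset_diff[of "\<Union>j<q. J j"]) (force simp: less_diff_conv)+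
    also have "(\<Sum>k\<in>(\<Union>j<q. J j). V k \<omega>) = (\<Sum>j<q. B j \<omega>)"
      unfolding B_def using finJ disjJ by (intro sum.UNION_disjoint_family) auto
    finally show ?thesis .
  qed
  \<comment> \<open>One straddling index per block, and at most \<open>p\<close> indices from the
    incomplete last block.\<close>
  have cardG: "card G \<le> q + p"
  proof -
    have "card (\<Union>j<q. J j) = (\<Sum>j<q. card (J j))"
      using finJ disjJ by (intro card_UN_disjoint') auto
    also have "\<dots> = q * (p - 1)" by (simp add: J_def)
    finally have "card (\<Union>j<q. J j) = q * (p - 1)" .
    moreover have "card G = card {..<m - 1} - card (\<Union>j<q. J j)"
      unfolding G_def using B_lt by (intro card_Diff_subset) (force simp: J_def less_diff_conv)+
    ultimately have "card G = m - 1 - q * (p - 1)" by simp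
    also have "\<dots> \<le> q + p" using qp r by (simp add: algebra_simps)
    finally show ?thesis .
  qed
  have G_lt: "Suc k < m" if "k \<in> G" for k using that by (auto simp: G_def)
  have finG: "finite G" by (simp add: G_def)
  have meas_sumB: "(\<lambda>\<omega>. \<Sum>j<q. B j \<omega>) \<in> borel_measurable M" by measurable
  have S_meas: "(\<lambda>\<omega>. \<Sum>k<m - 1. V k \<omega>) \<in> borel_measurable M"
    by (intro borel_measurable_sum V_measurable) auto
  have "cmod (char (distr M borel (\<lambda>\<omega>. \<Sum>k<m - 1. V k \<omega>)) s - char (distr M borel (\<lambda>\<omega>. \<Sum>j<q. B j \<omega>)) s)
    \<le> \<bar>s\<bar> * sqrt (expectation (\<lambda>\<omega>. ((\<Sum>k<m - 1. V k \<omega>) - (\<Sum>j<q. B j \<omega>))\<^sup>2))"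
  proof (rule char_diff_le[OF S_meas meas_sumB])
    show "integrable M (\<lambda>\<omega>. ((\<Sum>k<m - 1. V k \<omega>) - (\<Sum>j<q. B j \<omega>))\<^sup>2)"
      unfolding S power2_eq_square
      by (simp add: sum_product) (intro Bochner_Integration.integrable_sum integrable_V_prod G_lt)
  qed
  also have "\<dots> \<le> \<bar>s\<bar> * sqrt (3 * (real q + p))"
  proof (intro mult_left_mono real_sqrt_le_mono)
    have "expectation (\<lambda>\<omega>. ((\<Sum>k<m - 1. V k \<omega>) - (\<Sum>j<q. B j \<omega>))\<^sup>2) = expectation (\<lambda>\<omega>. (\<Sum>k\<in>G. V k \<omega>)\<^sup>2)"
      unfolding S by simp
    also have "\<dots> \<le> 3 * card G" by (rule second_moment_sum_le) (auto simp: G_def)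
    also have "real (3 * card G) \<le> 3 * (real q + p)" using cardG by simp
    finally show "expectation (\<lambda>\<omega>. ((\<Sum>k<m - 1. V k \<omega>) - (\<Sum>j<q. B j \<omega>))\<^sup>2) \<le> 3 * (real q + p)" by simp
  qed simp
  finally have 1: "cmod (char (distr M borel (\<lambda>\<omega>. \<Sum>k<m - 1. V k \<omega>)) s
      - char (distr M borel (\<lambda>\<omega>. \<Sum>j<q. B j \<omega>)) s) \<le> \<bar>s\<bar> * sqrt (3 * (real q + p))" .
  have blk: "cmod (char (distr M borel (B j)) s - exp (- (s\<^sup>2 * w / 2))) \<le> \<bar>s\<bar>^3 * p^3 + s^4 * p^4"
    and w0: "0 \<le> w" if j: "j < q" for j
  proof -
    have "\<bar>B j \<omega>\<bar> \<le> (\<Sum>k\<in>J j. 1)" for \<omega>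
      unfolding B_def by (rule order_trans[OF sum_abs]) (intro sum_mono V_bound)
    then have bound: "\<bar>B j \<omega>\<bar> \<le> real p" for \<omega>
      by (rule order_trans) (simp add: J_def)
    have meanV: "expectation (V k) = 0" if "k \<in> J j" for k
      using mean[OF B_lt[OF j that]] by (simp add: V_def[abs_def])
    have "expectation (B j) = (\<Sum>k\<in>J j. expectation (V k))"
      unfolding B_def[abs_def] using B_lt[OF j] by (intro Bochner_Integration.integral_sum integrable_V)
    then have mn: "expectation (B j) = 0" using meanV by simp
    have "expectation (\<lambda>\<omega>. (\<Sum>k = j * p..<j * p + Suc r. V k \<omega>)\<^sup>2) =
        real (Suc r) * v + 2 * real r * c"
      by (rule second_moment_block) (use jq[OF j] qp r in linarith)
    then have vr: "expectation (\<lambda>\<omega>. (B j \<omega>)\<^sup>2) = w"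
      unfolding B_def J_def w_def r by simp
    show "0 \<le> w" unfolding vr[symmetric] by simp
    show "cmod (char (distr M borel (B j)) s - exp (- (s\<^sup>2 * w / 2))) \<le> \<bar>s\<bar>^3 * p^3 + s^4 * p^4"
      using char_near_gaussian[OF B_meas[OF j] bound mn vr] by simp
  qed
  \<comment> \<open>Two products of factors of modulus at most 1 differ by at most the sum of the
    differences. For the Gaussian factors this requires \<open>0 \<le> w\<close>, known because
    \<open>w\<close> is the second moment of a block sum.\<close>
  have "cmod ((\<Prod>j<q. char (distr M borel (B j)) s) - (\<Prod>j<q. complex_of_real (exp (- (s\<^sup>2 * w / 2)))))
      \<le> (\<Sum>j<q. cmod (char (distr M borel (B j)) s - exp (- (s\<^sup>2 * w / 2))))"
  proof (rule norm_prod_diff)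
    fix j assume "j \<in> {..<q}"
    then interpret D: real_distribution "distr M borel (B j)" by simp
    show "cmod (char (distr M borel (B j)) s) \<le> 1" by (rule D.cmod_char_le_1)
    show "cmod (complex_of_real (exp (- (s\<^sup>2 * w / 2)))) \<le> 1"
      using w0[of j] \<open>j \<in> {..<q}\<close> by simp
  qed
  also have "\<dots> \<le> (\<Sum>j<q. \<bar>s\<bar>^3 * p^3 + s^4 * p^4)" by (intro sum_mono blk) simp
  also have "\<dots> = q * (\<bar>s\<bar>^3 * p^3 + s^4 * p^4)" by simp
  also have "(\<Prod>j<q. char (distr M borel (B j)) s) = char (distr M borel (\<lambda>\<omega>. \<Sum>j<q. B j \<omega>)) s"
    by (rule char_distr_sum[OF indepB, symmetric])
  also have "(\<Prod>j<q. complex_of_real (exp (- (s\<^sup>2 * w / 2)))) = exp (- (real q * (s\<^sup>2 * w / 2)))"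
    by (simp add: exp_of_nat_mult[symmetric] flip: of_real_power)
  finally have 2: "cmod (char (distr M borel (\<lambda>\<omega>. \<Sum>j<q. B j \<omega>)) s - exp (- (real q * (s\<^sup>2 * w / 2))))
    \<le> q * (\<bar>s\<bar>^3 * p^3 + s^4 * p^4)" .
  from norm_triangle_le[OF add_mono[OF 1 2]] show ?thesis unfolding q_def by simp
qed

end

lemma tendsto_zero_of_le:
  fixes f g :: "'b \<Rightarrow> real"
  assumes "(g \<longlongrightarrow> 0) F" "eventually (\<lambda>x. 0 \<le> f x) F" "eventually (\<lambda>x. f x \<le> g x) F"
  shows "(f \<longlongrightarrow> 0) F"
  by (rule tendsto_sandwich[OF assms(2,3) tendsto_const assms(1)])

text \<open>For n = 2m the factor sqrt(2m) / (m - 1) equals sqrt n / (n / 2 - 1). The limit is the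
  characteristic function of a centred normal law with variance 2 (v0 + 2 c0).\<close>

lemma char_pair_array_tendsto:
  fixes Y :: "nat \<Rightarrow> nat \<Rightarrow> 'a \<Rightarrow> real" and g :: "nat \<Rightarrow> real \<Rightarrow> real \<Rightarrow> real"
  assumes arr: "eventually (\<lambda>m. pair_array M (Y m) (g m) m (v m) (c m)) sequentially"
    and v: "v \<longlonglongrightarrow> v0" and c: "c \<longlonglongrightarrow> c0"
  shows "(\<lambda>m. char (distr M borel (\<lambda>\<omega>. sqrt (2 * real m) / (real m - 1) *
      (\<Sum>k<m - 1. g m (Y m k \<omega>) (Y m (Suc k) \<omega>)))) t) \<longlonglongrightarrow> exp (- (t\<^sup>2 * (v0 + 2 * c0)))"
proof -
  \<comment> \<open>The error terms of \<open>char_sum_bound\<close> vanish when \<open>p \<rightarrow> \<infinity>\<close> with \<open>p\<^sup>4 = o(m)\<close>.\<close>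
  define p where "p m = nat \<lfloor>real m powr (1/12)\<rfloor>" for m :: nat
  \<comment> \<open>The normalisation is moved into the argument, so the bound applies to the plain
    sum at \<open>s m\<close>. Since m (s m)^2 tends to 2 t^2, \<open>s m\<close> has order
    m^(-1/2).\<close>
  define s where "s m = t * (sqrt (2 * real m) / (real m - 1))" for m :: nat
  define w where "w m = (real (p m) - 1) * v m + 2 * (real (p m) - 2) * c m" for m
  define q where "q m = m div p m" for m
  define S where "S m \<omega> = (\<Sum>k<m - 1. g m (Y m k \<omega>) (Y m (Suc k) \<omega>))" for m \<omega>
  have p_le: "real (p m) \<le> real m powr (1/12)" for m
    unfolding p_def by (simp add: of_nat_floor)
  have p_top: "filterlim p at_top sequentially"
    unfolding filterlim_at_top
  proof
    fix Z :: nat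
    show "eventually (\<lambda>m. Z \<le> p m) sequentially"
      using eventually_ge_at_top[of "Suc Z ^ 12"]
    proof eventually_elim
      case (elim m)
      have "real (Suc Z) = (real (Suc Z) powr 12) powr (1/12)"
        by (subst powr_powr) simp
      also have "real (Suc Z) powr 12 = real (Suc Z ^ 12)"
        by (subst powr_numeral) auto
      also have "real (Suc Z ^ 12) powr (1/12) \<le> real m powr (1/12)"
        using elim by (intro powr_mono2) (auto simp flip: of_nat_power)
      finally have "real Z \<le> real m powr (1/12)" by simp
      then show ?case unfolding p_def by (simp add: le_nat_floor)
    qed
  qed
  then have p_real_top: "filterlim (\<lambda>m. real (p m)) at_top sequentially"
    by (rule filterlim_compose[OF filterlim_real_sequentially])
  have p_ge: "eventually (\<lambda>m. 2 \<le> p m) sequentially" using p_top by (auto simp: filterlim_at_top)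
  have m_ge: "eventually (\<lambda>m::nat. 2 \<le> m) sequentially" by (rule eventually_ge_at_top)
  have inv_p: "(\<lambda>m. 1 / real (p m)) \<longlonglongrightarrow> 0"
    by (rule tendsto_divide_0[OF tendsto_const filterlim_at_top_imp_at_infinity[OF p_real_top]])
  have powr_lim: "(\<lambda>m. real m powr a) \<longlonglongrightarrow> 0" if "a < 0" for a
    using tendsto_neg_powr[OF that filterlim_real_sequentially] .
  have p_pow: "real (p m) ^ k \<le> real m powr (real k / 12)" if "2 \<le> m" for m k
  proof -
    have "real (p m) ^ k \<le> (real m powr (1/12)) ^ k" by (rule power_mono[OF p_le]) simp
    also have "\<dots> = real m powr (real k / 12)" using that by (simp add: powr_power)
    finally show ?thesis .
  qed
  have p_small: "(\<lambda>m. real (p m) ^ k / real m powr a) \<longlonglongrightarrow> 0" if "real k / 12 < a" for k a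
  proof (rule tendsto_zero_of_le[OF powr_lim])
    show "real k / 12 - a < 0" using that by simp
    show "eventually (\<lambda>m. real (p m) ^ k / real m powr a \<le> real m powr (real k / 12 - a)) sequentially"
      using m_ge by eventually_elim (use p_pow in \<open>auto simp: powr_diff intro!: divide_right_mono\<close>)
  qed auto
  have p_m: "(\<lambda>m. real (p m) / real m) \<longlonglongrightarrow> 0"
    using p_small[of 1 1] by (simp add: powr_one)
  have p_le_m: "eventually (\<lambda>m. p m \<le> m) sequentially"
    using order_tendstoD(2)[OF p_m zero_less_one] m_ge by eventually_elim (simp add: field_simps)
  have m1: "(\<lambda>m. real m / (real m - 1)) \<longlonglongrightarrow> 1"
  proof -
    have "(\<lambda>m. 1 / (1 - 1 / real m)) \<longlonglongrightarrow> 1 / (1 - 0)"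
      by (intro tendsto_intros lim_1_over_n) simp
    then show ?thesis
      unfolding diff_zero div_by_1
      by (rule Lim_transform_eventually) (use m_ge in \<open>eventually_elim, simp add: field_simps\<close>)
  qed
  have s2: "(\<lambda>m. real m * (s m)\<^sup>2) \<longlonglongrightarrow> 2 * t\<^sup>2"
  proof -
    have "(\<lambda>m. 2 * t\<^sup>2 * (real m / (real m - 1))\<^sup>2) \<longlonglongrightarrow> 2 * t\<^sup>2 * 1\<^sup>2"
      by (intro tendsto_intros m1)
    moreover have "2 * t\<^sup>2 * (real m / (real m - 1))\<^sup>2 = real m * (s m)\<^sup>2" for m
      by (simp add: s_def power_mult_distrib power_divide power2_eq_square)
    ultimately show ?thesis by simp
  qed
  have s1: "(\<lambda>m. sqrt (real m) * \<bar>s m\<bar>) \<longlonglongrightarrow> sqrt (2 * t\<^sup>2)"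
    using tendsto_real_sqrt[OF s2] by (simp add: real_sqrt_mult)
  have q_le: "real (q m) \<le> real m / real (p m)" for m
    unfolding q_def by (rule of_nat_div_le_of_nat)
  have q_ge: "real m / real (p m) - 1 \<le> real (q m)" for m
  proof -
    have "real (m mod p m) / real (p m) \<le> 1"
      by (cases "p m = 0") (simp_all add: less_imp_le)
    then show ?thesis
      using of_nat_of_nat_div_aux[of m "p m", where 'a=real] by (simp add: q_def)
  qed
  have qp: "(\<lambda>m. real (q m) * real (p m) / real m) \<longlonglongrightarrow> 1"
  proof (rule tendsto_sandwich)
    show "(\<lambda>m. 1 - real (p m) / real m) \<longlonglongrightarrow> 1" using tendsto_diff[OF tendsto_const p_m, of 1] by simp
    show "eventually (\<lambda>m. 1 - real (p m) / real m \<le> real (q m) * real (p m) / real m) sequentially"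
      using m_ge p_ge
    proof eventually_elim
      case (elim m)
      have "(real m / real (p m) - 1) * real (p m) \<le> real (q m) * real (p m)"
        by (intro mult_right_mono q_ge) simp
      moreover have "(real m / real (p m) - 1) * real (p m) = real m - real (p m)"
        using elim by (simp add: left_diff_distrib)
      ultimately have "real m - real (p m) \<le> real (q m) * real (p m)" by simp
      then have "(real m - real (p m)) / real m \<le> real (q m) * real (p m) / real m"
        by (rule divide_right_mono) simp
      with elim show ?case by (simp add: diff_divide_distrib)
    qed
    show "eventually (\<lambda>m. real (q m) * real (p m) / real m \<le> 1) sequentially"
      using m_ge p_ge
    proof eventually_elim
      case (elim m)
      have "real (q m) * real (p m) \<le> real m / real (p m) * real (p m)"
        by (intro mult_right_mono q_le) simp
      with elim have "real (q m) * real (p m) \<le> real m" by simp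
      with elim show ?case by (simp add: field_simps)
    qed
  qed simp
  have w_lim: "(\<lambda>m. w m / real (p m)) \<longlonglongrightarrow> v0 + 2 * c0"
  proof -
    have "(\<lambda>m. (1 - 1 / real (p m)) * v m + 2 * (1 - 2 * (1 / real (p m))) * c m) \<longlonglongrightarrow>
      (1 - 0) * v0 + 2 * (1 - 2 * 0) * c0"
      by (intro tendsto_intros inv_p v c)
    then have "(\<lambda>m. (1 - 1 / real (p m)) * v m + 2 * (1 - 2 * (1 / real (p m))) * c m) \<longlonglongrightarrow> v0 + 2 * c0"
      by simp
    then show ?thesis
      by (rule Lim_transform_eventually) (use p_ge in \<open>eventually_elim, simp add: w_def field_simps\<close>)
  qed
  have main: "(\<lambda>m. real (q m) * ((s m)\<^sup>2 * w m / 2)) \<longlonglongrightarrow> t\<^sup>2 * (v0 + 2 * c0)"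
  proof -
    have "(\<lambda>m. (real (q m) * real (p m) / real m) * (real m * (s m)\<^sup>2) * (w m / real (p m)) / 2) \<longlonglongrightarrow>
        1 * (2 * t\<^sup>2) * (v0 + 2 * c0) / 2"
      by (intro tendsto_intros qp s2 w_lim) simp
    then have "(\<lambda>m. (real (q m) * real (p m) / real m) * (real m * (s m)\<^sup>2) * (w m / real (p m)) / 2) \<longlonglongrightarrow>
        t\<^sup>2 * (v0 + 2 * c0)" by simp
    then show ?thesis
      by (rule Lim_transform_eventually) (use p_ge m_ge in \<open>eventually_elim, simp\<close>)
  qed
  have err1: "(\<lambda>m. \<bar>s m\<bar> * sqrt (3 * (real (q m) + real (p m)))) \<longlonglongrightarrow> 0"
  proof (rule tendsto_zero_of_le)
    have "(\<lambda>m. sqrt (real m) * \<bar>s m\<bar> * sqrt (3 * (1 / real (p m) + real (p m) / real m))) \<longlonglongrightarrow>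
       sqrt (2 * t\<^sup>2) * sqrt (3 * (0 + 0))"
      by (intro tendsto_intros s1 inv_p p_m)
    then show "(\<lambda>m. sqrt (real m) * \<bar>s m\<bar> * sqrt (3 * (1 / real (p m) + real (p m) / real m))) \<longlonglongrightarrow> 0" by simp
    show "eventually (\<lambda>m. \<bar>s m\<bar> * sqrt (3 * (real (q m) + real (p m))) \<le>
        sqrt (real m) * \<bar>s m\<bar> * sqrt (3 * (1 / real (p m) + real (p m) / real m))) sequentially"
      using m_ge
    proof eventually_elim
      case (elim m)
      have e: "real m * (3 * (1 / real (p m) + real (p m) / real m)) = 3 * (real m / real (p m) + real (p m))"
        using elim by (simp add: distrib_left)
      have "sqrt (3 * (real (q m) + real (p m))) \<le> sqrt (real m * (3 * (1 / real (p m) + real (p m) / real m)))"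
        unfolding e using q_le[of m] by (intro real_sqrt_le_mono) simp
      also have "\<dots> = sqrt (real m) * sqrt (3 * (1 / real (p m) + real (p m) / real m))"
        by (rule real_sqrt_mult)
      finally show ?case by (simp add: mult_left_mono mult.assoc mult.left_commute)
    qed
  qed auto
  have err2: "(\<lambda>m. real (q m) * (\<bar>s m\<bar>^3 * real (p m)^3 + s m^4 * real (p m)^4)) \<longlonglongrightarrow> 0"
  proof (rule tendsto_zero_of_le)
    \<comment> \<open>Each power of |s m| is paired with a factor sqrt m, giving a convergent
      quantity. With \<open>q m\<close> at most m / p, what remains is p^2 / m^(1/2) and p^3 / m,
      both covered by \<open>p_small\<close>.\<close>
    let ?h = "\<lambda>m. (sqrt (real m) * \<bar>s m\<bar>)^3 * (real (p m)^2 / real m powr (1/2))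
        + (sqrt (real m) * \<bar>s m\<bar>)^4 * (real (p m)^3 / real m powr 1)"
    have "?h \<longlonglongrightarrow> sqrt (2 * t\<^sup>2)^3 * 0 + sqrt (2 * t\<^sup>2)^4 * 0"
      by (intro tendsto_intros s1 p_small) simp_all
    then show "?h \<longlonglongrightarrow> 0" by simp
    show "eventually (\<lambda>m. real (q m) * (\<bar>s m\<bar>^3 * real (p m)^3 + s m^4 * real (p m)^4) \<le> ?h m) sequentially"
      using m_ge p_ge
    proof eventually_elim
      case (elim m)
      have sq: "sqrt (real m) * sqrt (real m) = real m" by simp
      have "real (q m) * (\<bar>s m\<bar>^3 * real (p m)^3 + s m^4 * real (p m)^4) \<le>
          real m / real (p m) * (\<bar>s m\<bar>^3 * real (p m)^3 + s m^4 * real (p m)^4)"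
        by (intro mult_right_mono q_le) simp
      also have "\<dots> = real m * (\<bar>s m\<bar>^3 * real (p m)^2 + s m^4 * real (p m)^3)"
        using elim by (simp add: field_simps eval_nat_numeral)
      also have "\<dots> = ?h m"
      proof -
        have "sqrt (real m) ^ 3 / sqrt (real m) = real m"
          using elim by (simp add: eval_nat_numeral)
        moreover have "sqrt (real m) ^ 4 / real m = real m"
          using elim by (simp add: eval_nat_numeral)
        ultimately show ?thesis using elim
          by (simp add: powr_half_sqrt power_mult_distrib distrib_left power_even_abs
              flip: times_divide_eq_left)
      qed
      finally show ?case .
    qed
  qed auto
  have "(\<lambda>m. char (distr M borel (S m)) (s m) - exp (- (real (q m) * ((s m)\<^sup>2 * w m / 2)))) \<longlonglongrightarrow> 0"
  proof (rule Lim_null_comparison)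
    show "(\<lambda>m. \<bar>s m\<bar> * sqrt (3 * (real (q m) + real (p m))) +
        real (q m) * (\<bar>s m\<bar>^3 * real (p m)^3 + s m^4 * real (p m)^4)) \<longlonglongrightarrow> 0"
      using tendsto_add[OF err1 err2] by simp
    show "eventually (\<lambda>m. cmod (char (distr M borel (S m)) (s m) - exp (- (real (q m) * ((s m)\<^sup>2 * w m / 2))))
      \<le> \<bar>s m\<bar> * sqrt (3 * (real (q m) + real (p m))) +
        real (q m) * (\<bar>s m\<bar>^3 * real (p m)^3 + s m^4 * real (p m)^4)) sequentially"
      using arr p_ge p_le_m
    proof eventually_elim
      case (elim m)
      interpret pair_array M "Y m" "g m" m "v m" "c m" by fact
      have Sm: "S m = (\<lambda>\<omega>. \<Sum>k<m - 1. V k \<omega>)" by (simp add: S_def V_def fun_eq_iff)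
      show ?case using char_sum_bound[OF elim(2,3), of "s m"]
        unfolding Sm q_def w_def by simp
    qed
  qed
  moreover have "(\<lambda>m. complex_of_real (exp (- (real (q m) * ((s m)\<^sup>2 * w m / 2))))) \<longlonglongrightarrow>
      complex_of_real (exp (- (t\<^sup>2 * (v0 + 2 * c0))))"
    by (intro tendsto_intros main)
  ultimately have "(\<lambda>m. char (distr M borel (S m)) (s m)) \<longlonglongrightarrow> complex_of_real (exp (- (t\<^sup>2 * (v0 + 2 * c0))))"
    using tendsto_add by force
  then show ?thesis
  proof (rule Lim_transform_eventually)
    show "eventually (\<lambda>m. char (distr M borel (S m)) (s m) = char (distr M borel (\<lambda>\<omega>. sqrt (2 * real m) / (real m - 1) *
      (\<Sum>k<m - 1. g m (Y m k \<omega>) (Y m (Suc k) \<omega>)))) t) sequentially"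
      using arr
    proof eventually_elim
      case (elim m)
      interpret pair_array M "Y m" "g m" m "v m" "c m" by fact
      have [measurable]: "S m \<in> borel_measurable M"
        unfolding S_def[abs_def] V_def[symmetric] by (intro borel_measurable_sum V_measurable) auto
      show ?case unfolding S_def[symmetric]
        by (simp add: char_def integral_distr s_def mult.assoc)
    qed
  qed
qed

section \<open>Exponential bounds and the strong law\<close>

context pair_array begin

text \<open>Indices at distance at least 2 give independent summands with values in an interval of
  length 2, so Hoeffding's denominator is 4 \<open>card L\<close>, and
  \<open>card L \<le> m\<close>. The empty set is treated apart because this denominator must be
  positive.\<close>

lemma hoeffding_separated:
  assumes L: "L \<subseteq> {..<m - 1}" and gap: "\<And>j k. j \<in> L \<Longrightarrow> k \<in> L \<Longrightarrow> j < k \<Longrightarrow> Suc j < k"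
    and e: "0 < e"
  shows "prob {\<omega> \<in> space M. e \<le> \<bar>\<Sum>k\<in>L. V k \<omega>\<bar>} \<le> 2 * exp (- (e\<^sup>2 / (2 * m)))"
proof (cases "L = {}")
  case True
  then show ?thesis using e by (simp add: less_le_not_le)
next
  case False
  have fin: "finite L" using L finite_subset by blast
  have lt: "Suc k < m" if "k \<in> L" for k using L that by auto
  have "indep_interval_bounded_random_variables M L V (\<lambda>_. -1) (\<lambda>_. 1)"
  proof
    show "indep_vars (\<lambda>_. borel) V L" using lt gap by (rule indep_V_single)
    show "AE x in M. V i x \<in> {-1..1}" for i using V_bound by (auto simp: abs_le_iff minus_le_iff)
  qed (rule fin)
  then interpret H: Hoeffding_ineq M L V "\<lambda>_. -1" "\<lambda>_. 1" "\<Sum>i\<in>L. expectation (V i)"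
    by (simp add: Hoeffding_ineq_def)
  have mean0: "(\<Sum>i\<in>L. expectation (V i)) = 0"
    using mean lt by (intro sum.neutral) (auto simp: V_def[abs_def])
  have card: "0 < card L" "card L \<le> m"
    using False fin card_mono[OF _ L] by (auto simp: card_gt_0_iff)
  have "prob {\<omega> \<in> space M. e \<le> \<bar>\<Sum>k\<in>L. V k \<omega>\<bar>} \<le> 2 * exp (-2 * e\<^sup>2 / (\<Sum>i\<in>L. (1 - (-1 :: real))\<^sup>2))"
    using H.Hoeffding_ineq_abs_ge[of e] e card by (simp add: mean0)
  also have "\<dots> \<le> 2 * exp (- (e\<^sup>2 / (2 * m)))"
  proof -
    have "e\<^sup>2 / (2 * m) \<le> e\<^sup>2 / (2 * card L)" using card by (intro divide_left_mono) auto
    then show ?thesis by simp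
  qed
  finally show ?thesis .
qed

text \<open>Indices of equal parity are never adjacent. If the whole sum reaches
  \<open>d * m\<close>, one of the two parity sums reaches half of it, which yields the exponent m
  d^2 / 8 and the prefactor 2 + 2. The bound is geometric in \<open>m\<close>, hence
  summable.\<close>

lemma hoeffding_sum:
  fixes d :: real
  assumes d: "0 < d" and m: "0 < m"
  shows "prob {\<omega> \<in> space M. d * m \<le> \<bar>\<Sum>k<m - 1. V k \<omega>\<bar>} \<le> 4 * exp (- (d\<^sup>2 / 8)) ^ m"
proof -
  define L where "L b = {k \<in> {..<m - 1}. even k = b}" for b
  have L: "L b \<subseteq> {..<m - 1}" for b by (auto simp: L_def)
  have gap: "Suc j < k" if "j \<in> L b" "k \<in> L b" "j < k" for j k b
  proof -
    have "k \<noteq> Suc j" using that by (auto simp: L_def)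
    with that show ?thesis by simp
  qed
  define E where "E b = {\<omega> \<in> space M. d * m / 2 \<le> \<bar>\<Sum>k\<in>L b. V k \<omega>\<bar>}" for b
  have E_meas [measurable]: "E b \<in> events" for b
  proof -
    have [measurable]: "(\<lambda>\<omega>. \<Sum>k\<in>L b. V k \<omega>) \<in> borel_measurable M"
      using L[of b] by (intro borel_measurable_sum V_measurable) auto
    show ?thesis unfolding E_def by measurable
  qed
  have PE: "prob (E b) \<le> 2 * exp (- (d\<^sup>2 / 8)) ^ m" for b
  proof -
    have "prob (E b) \<le> 2 * exp (- ((d * m / 2)\<^sup>2 / (2 * m)))"
      unfolding E_def using d m by (intro hoeffding_separated L gap) auto
    also have "(d * m / 2)\<^sup>2 / (2 * m) = m * (d\<^sup>2 / 8)"
      using m by (simp add: power2_eq_square field_simps)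
    finally show ?thesis by (simp add: exp_of_nat_mult[symmetric])
  qed
  have split: "(\<Sum>k<m - 1. V k \<omega>) = (\<Sum>k\<in>L True. V k \<omega>) + (\<Sum>k\<in>L False. V k \<omega>)" for \<omega>
    by (subst sum.union_disjoint[symmetric]) (auto simp: L_def intro!: sum.cong)
  have "{\<omega> \<in> space M. d * m \<le> \<bar>\<Sum>k<m - 1. V k \<omega>\<bar>} \<subseteq> E True \<union> E False"
    unfolding split E_def by auto
  then have "prob {\<omega> \<in> space M. d * m \<le> \<bar>\<Sum>k<m - 1. V k \<omega>\<bar>} \<le> prob (E True \<union> E False)"
    by (intro finite_measure_mono) auto
  also have "\<dots> \<le> prob (E True) + prob (E False)" by (rule measure_Un_le) auto
  finally show ?thesis using PE[of True] PE[of False] by simp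
qed

end

text \<open>The first Borel-Cantelli lemma asks only for summable probabilities, so the rows may
  depend on one another arbitrarily.\<close>

lemma pair_array_strong_law:
  fixes Y :: "nat \<Rightarrow> nat \<Rightarrow> 'a \<Rightarrow> real" and g :: "nat \<Rightarrow> real \<Rightarrow> real \<Rightarrow> real"
  assumes M: "prob_space M"
    and arr: "\<And>m. m0 \<le> m \<Longrightarrow> pair_array M (Y m) (g m) m (v m) (c m)"
  shows "AE \<omega> in M. (\<lambda>m. 1 / (real m - 1) * (\<Sum>k<m - 1. g m (Y m k \<omega>) (Y m (Suc k) \<omega>))) \<longlonglongrightarrow> 0"
proof -
  interpret prob_space M by (rule M)
  define S where "S m \<omega> = (\<Sum>k<m - 1. g m (Y m k \<omega>) (Y m (Suc k) \<omega>))" for m \<omega>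
  define n0 where "n0 = max m0 2"
  \<comment> \<open>The thresholds 1 / (d + 1) are countably many, so the exceptional null sets can
    be united. Before \<open>n0\<close> the event is empty, which keeps it measurable and the bound
    valid for all \<open>m\<close>.\<close>
  define E where "E d m = (if n0 \<le> m then {\<omega> \<in> space M. inverse (real (Suc d)) * m \<le> \<bar>S m \<omega>\<bar>} else {})" for d m :: nat
  have prob_E: "E d m \<in> events \<and> prob (E d m) \<le> 4 * exp (- ((inverse (real (Suc d)))\<^sup>2 / 8)) ^ m" for d m
  proof (cases "n0 \<le> m")
    case True
    then interpret pair_array M "Y m" "g m" m "v m" "c m" by (intro arr) (simp add: n0_def)
    have [measurable]: "(\<lambda>\<omega>. \<Sum>k<m - 1. V k \<omega>) \<in> borel_measurable M"
      by (intro borel_measurable_sum V_measurable) auto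
    have E: "E d m = {\<omega> \<in> space M. inverse (real (Suc d)) * m \<le> \<bar>\<Sum>k<m - 1. V k \<omega>\<bar>}"
      using True by (simp add: E_def S_def V_def)
    show ?thesis
    proof
      show "E d m \<in> events" unfolding E by measurable
      show "prob (E d m) \<le> 4 * exp (- ((inverse (real (Suc d)))\<^sup>2 / 8)) ^ m"
        unfolding E by (rule hoeffding_sum) (use True in \<open>auto simp: n0_def\<close>)
    qed
  qed (simp add: E_def)
  have ev: "AE \<omega> in M. \<forall>d. eventually (\<lambda>m. \<omega> \<in> space M - E d m) sequentially"
    unfolding AE_all_countable
  proof
    fix d
    show "AE \<omega> in M. eventually (\<lambda>m. \<omega> \<in> space M - E d m) sequentially"
    proof (rule borel_cantelli_AE1)
      show "summable (\<lambda>m. prob (E d m))"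
      proof (rule summable_comparison_test')
        show "summable (\<lambda>m. 4 * exp (- ((inverse (real (Suc d)))\<^sup>2 / 8)) ^ m)"
          by (intro summable_mult summable_geometric) simp
        show "norm (prob (E d m)) \<le> 4 * exp (- ((inverse (real (Suc d)))\<^sup>2 / 8)) ^ m" for m
          using prob_E[of d m] by simp
      qed
    qed (use prob_E in \<open>auto simp: emeasure_eq_measure\<close>)
  qed
  then show ?thesis
  proof eventually_elim
    case (elim \<omega>)
    have "(\<lambda>m. 1 / (real m - 1) * S m \<omega>) \<longlonglongrightarrow> 0"
    proof (rule tendstoI)
      fix e :: real assume "0 < e"
      then obtain d where d: "inverse (real (Suc d)) < e / 2" using reals_Archimedean[of "e / 2"] by auto
      from elim[rule_format, of d] eventually_ge_at_top[of n0]
      show "eventually (\<lambda>m. dist (1 / (real m - 1) * S m \<omega>) 0 < e) sequentially"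
      proof eventually_elim
        case (elim m)
        then have m: "2 \<le> real m" and "\<bar>S m \<omega>\<bar> < inverse (real (Suc d)) * m"
          by (auto simp: E_def n0_def)
        note this(2)
        also have "inverse (real (Suc d)) * m \<le> e / 2 * m" using d m by (intro mult_right_mono) auto
        \<comment> \<open>For m \<ge> 2 one has m / 2 \<le> m - 1; this is why \<open>d\<close> was
          chosen against e / 2.\<close>
        also have "\<dots> \<le> e * (real m - 1)" using mult_left_mono[OF m, of e] \<open>0 < e\<close> unfolding right_diff_distrib by linarith
        finally have "\<bar>S m \<omega>\<bar> / (real m - 1) < e" using m by (simp add: pos_divide_less_eq)
        then show ?case using m by (simp add: dist_real_def abs_mult)
      qed
    qed
    then show ?case by (simp add: S_def)
  qed
qed

section \<open>The increment ratio statistic of a Levy process\<close>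

lemma psi_nonneg: "0 \<le> \<psi> x y" and psi_le_1: "\<psi> x y \<le> 1"
proof -
  have "\<bar>x + y\<bar> / (\<bar>x\<bar> + \<bar>y\<bar>) \<le> 1" if "\<not> (x = 0 \<and> y = 0)"
    using that abs_triangle_ineq[of x y] by (subst pos_divide_le_eq) auto
  then show "0 \<le> \<psi> x y" "\<psi> x y \<le> 1" by (auto simp: \<psi>_def)
qed

lemma psi_scale: "k \<noteq> 0 \<Longrightarrow> \<psi> (k * x) (k * y) = \<psi> x y"
  by (simp add: \<psi>_def abs_mult flip: distrib_left)

lemma psi_measurable [measurable (raw)]:
  assumes [measurable]: "f \<in> borel_measurable M" "g \<in> borel_measurable M"
  shows "(\<lambda>w. \<psi> (f w) (g w)) \<in> borel_measurable M"
  unfolding \<psi>_def by measurable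

lemma psi_prod_bound: "\<bar>\<psi> x y * \<psi> x' y'\<bar> \<le> 1"
  unfolding abs_mult by (intro mult_le_one) (auto simp: psi_nonneg psi_le_1)

lemma (in prob_space) integrable_psi:
  assumes "f \<in> borel_measurable M" "g \<in> borel_measurable M"
  shows "integrable M (\<lambda>\<omega>. \<psi> (f \<omega>) (g \<omega>))"
  by (rule integrable_const_bound[where B=1]) (use assms in \<open>auto simp: psi_nonneg psi_le_1\<close>)

lemma (in prob_space) integrable_psi_prod:
  assumes [measurable]: "f \<in> borel_measurable M" "g \<in> borel_measurable M"
    and [measurable]: "f' \<in> borel_measurable M" "g' \<in> borel_measurable M"
  shows "integrable M (\<lambda>\<omega>. \<psi> (f \<omega>) (g \<omega>) * \<psi> (f' \<omega>) (g' \<omega>))"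
proof (rule integrable_const_bound[where B=1])
  show "AE \<omega> in M. norm (\<psi> (f \<omega>) (g \<omega>) * \<psi> (f' \<omega>) (g' \<omega>)) \<le> 1"
    by (rule AE_I2) (unfold real_norm_def, rule psi_prod_bound)
qed measurable

text \<open>A nonzero limit coordinate keeps the denominator away from 0, so the value prescribed at
  the origin never enters eventually.\<close>

lemma psi_tendsto:
  assumes "X \<longlonglongrightarrow> x" "Y \<longlonglongrightarrow> y" "x \<noteq> 0"
  shows "(\<lambda>n. \<psi> (X n) (Y n)) \<longlonglongrightarrow> \<psi> x y"
proof -
  have "eventually (\<lambda>n. X n \<noteq> 0) sequentially"
    using assms(1,3) by (rule tendsto_imp_eventually_ne)
  then have "eventually (\<lambda>n. \<bar>X n + Y n\<bar> / (\<bar>X n\<bar> + \<bar>Y n\<bar>) = \<psi> (X n) (Y n)) sequentially"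
    by eventually_elim (simp add: \<psi>_def)
  moreover have "(\<lambda>n. \<bar>X n + Y n\<bar> / (\<bar>X n\<bar> + \<bar>Y n\<bar>)) \<longlonglongrightarrow> \<bar>x + y\<bar> / (\<bar>x\<bar> + \<bar>y\<bar>)"
    using assms by (intro tendsto_intros) auto
  ultimately show ?thesis
    using assms(3) Lim_transform_eventually by (fastforce simp: \<psi>_def)
qed

lemma cube_measure_psi_measurable:
  assumes F: "(\<lambda>p. F (fst p) (snd p)) \<in> borel_measurable (borel \<Otimes>\<^sub>M borel)"
  shows "(\<lambda>(x, y, z). F (\<psi> x y) (\<psi> y z)) \<in> borel_measurable (borel \<Otimes>\<^sub>M (borel \<Otimes>\<^sub>M borel))"
proof -
  have "(\<lambda>(x, y, z). (\<psi> x y, \<psi> y z)) \<in> borel \<Otimes>\<^sub>M (borel \<Otimes>\<^sub>M borel) \<rightarrow>\<^sub>M borel \<Otimes>\<^sub>M borel"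
    by measurable
  from measurable_compose[OF this F] show ?thesis by (simp add: split_def)
qed

text \<open>Removes normalisations: the second differences converge only after rescaling, but their
  moments through \<open>\<psi>\<close> do not see the factor, nor the scale of the stable
  limit.\<close>

lemma cube_measure_psi_scale:
  fixes F :: "real \<Rightarrow> real \<Rightarrow> real"
  assumes M: "prob_space M" and Y [measurable]: "Y \<in> borel_measurable M" and k: "k \<noteq> 0"
    and F: "(\<lambda>p. F (fst p) (snd p)) \<in> borel_measurable (borel \<Otimes>\<^sub>M borel)"
  shows "(LINT (x, y, z)|cube_measure (distr M borel (\<lambda>\<omega>. k * Y \<omega>)). F (\<psi> x y) (\<psi> y z)) =
    (LINT (x, y, z)|cube_measure (distr M borel Y). F (\<psi> x y) (\<psi> y z))"
proof -
  have kY: "(\<lambda>\<omega>. k * Y \<omega>) \<in> borel_measurable M" by measurable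
  note Fm = cube_measure_psi_measurable[OF F]
  show ?thesis
    unfolding cube_measure_distr[OF M Y] cube_measure_distr[OF M kY]
    by (subst (1 2) integral_distr) (use Fm in \<open>auto simp: split_def psi_scale[OF k]\<close>)
qed

text \<open>A general \<open>F\<close> of two overlapping values of \<open>\<psi>\<close> covers
  mean, second moment and mixed moment at once. The expectation becomes a functional of the common
  law \<mu> alone.\<close>

lemma (in prob_space) expectation_psi_triple:
  fixes F :: "real \<Rightarrow> real \<Rightarrow> real"
  assumes indep: "indep_vars (\<lambda>_. borel) Y {..<m}" and law: "\<And>k. k < m \<Longrightarrow> distr M borel (Y k) = \<mu>"
    and ijk: "i < m" "j < m" "k < m" "i \<noteq> j" "j \<noteq> k" "i \<noteq> k"
    and F: "(\<lambda>p. F (fst p) (snd p)) \<in> borel_measurable (borel \<Otimes>\<^sub>M borel)"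
  shows "expectation (\<lambda>\<omega>. F (\<psi> (Y i \<omega>) (Y j \<omega>)) (\<psi> (Y j \<omega>) (Y k \<omega>))) =
    (LINT (x, y, z)|cube_measure \<mu>. F (\<psi> x y) (\<psi> y z))"
proof -
  have [measurable]: "Y i \<in> borel_measurable M" "Y j \<in> borel_measurable M" "Y k \<in> borel_measurable M"
    using indep ijk by (auto simp: indep_vars_def2)
  have "cube_measure \<mu> = distr M (borel \<Otimes>\<^sub>M (borel \<Otimes>\<^sub>M borel)) (\<lambda>\<omega>. (Y i \<omega>, Y j \<omega>, Y k \<omega>))"
    using ijk by (intro distr_iid_triple[symmetric] indep_vars_subset[OF indep] law) auto
  then show ?thesis
    using cube_measure_psi_measurable[OF F] by (simp add: integral_distr)
qed

lemma cube_measure_psi_tendsto: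
  fixes F :: "real \<Rightarrow> real \<Rightarrow> real"
  assumes "\<And>n. real_distribution (\<mu> n)" "real_distribution \<mu>'" "weak_conv_m \<mu> \<mu>'" "measure \<mu>' {0} = 0"
    and F: "(\<lambda>p. F (fst p) (snd p)) \<in> borel_measurable (borel \<Otimes>\<^sub>M borel)"
    and bound: "\<And>p q. 0 \<le> p \<Longrightarrow> p \<le> 1 \<Longrightarrow> 0 \<le> q \<Longrightarrow> q \<le> 1 \<Longrightarrow> \<bar>F p q\<bar> \<le> 1"
    and cont: "\<And>P Q p q. P \<longlonglongrightarrow> p \<Longrightarrow> Q \<longlonglongrightarrow> q \<Longrightarrow> (\<lambda>n. F (P n) (Q n)) \<longlonglongrightarrow> F p q"
  shows "(\<lambda>n. LINT (x, y, z)|cube_measure (\<mu> n). F (\<psi> x y) (\<psi> y z)) \<longlonglongrightarrow>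
    (LINT (x, y, z)|cube_measure \<mu>'. F (\<psi> x y) (\<psi> y z))"
  by (rule cube_measure_tendsto[OF assms(1-4) cube_measure_psi_measurable[OF F], where B=1])
    (auto intro!: bound cont psi_tendsto psi_nonneg psi_le_1)

lemma char_distr_scale:
  fixes W :: "'b \<Rightarrow> real"
  assumes [measurable]: "W \<in> borel_measurable N"
  shows "char (distr N borel (\<lambda>\<omega>. s * W \<omega>)) \<theta> = char (distr N borel W) (s * \<theta>)"
  by (simp add: char_def integral_distr mult_ac)

text \<open>For n = 2m the last index (n - 4) / 2 is m - 2, so there are m - 1 summands, matching
  the prefactor 1 / (n / 2 - 1).\<close>

lemma R2_even:
  assumes "2 \<le> m"
  shows "R2 X (2 * m) \<omega> = 1 / (real m - 1) *
    (\<Sum>k<m - 1. \<psi> (second_diff X (2 * m) (2 * k) \<omega>) (second_diff X (2 * m) (2 * Suc k) \<omega>))"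
proof -
  have "{0..(2 * m - 4) div 2} = {..<m - 1}" using assms by auto
  then show ?thesis by (simp add: R2_def)
qed

lemma generating_triplet_levy_measure:
  "generating_triplet M X a \<gamma> \<nu> \<Longrightarrow> levy_measure \<nu>"
  by (simp add: generating_triplet_def levy_measure_def)

section \<open>Second differences of a Levy process on a grid\<close>

context levy_process begin

lemma second_diff_measurable [measurable]: "second_diff X n j \<in> borel_measurable M"
proof -
  have [measurable]: "X (real i / real n) \<in> borel_measurable M" for i by (rule random_variable_at) simp
  show ?thesis unfolding second_diff_def[abs_def] by measurable
qed

lemma R2_measurable [measurable]: "R2 X n \<in> borel_measurable M"
  unfolding R2_def[abs_def] by measurable

definition grid_increment :: "nat \<Rightarrow> nat \<Rightarrow> 'a \<Rightarrow> real" where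
  "grid_increment n i \<omega> = X (real (Suc i) / real n) \<omega> - X (real i / real n) \<omega>"

lemma indep_grid_increments: "indep_vars (\<lambda>_. borel) (grid_increment n) {..<n}"
  unfolding grid_increment_def[abs_def]
  by (rule indep_increments[of "\<lambda>i. real i / real n"]) (auto intro!: monoI divide_right_mono)

lemma second_diff_eq_grid:
  "second_diff X n (2 * k) \<omega> = grid_increment n (Suc (2 * k)) \<omega> - grid_increment n (2 * k) \<omega>"
  by (simp add: second_diff_def grid_increment_def)

text \<open>The second difference at position j uses the increments j and j + 1. At even positions
  these pairs are disjoint, whereas adjacent positions would share an increment.\<close>

lemma indep_second_diffs: "indep_vars (\<lambda>_. borel) (\<lambda>k. second_diff X (2 * m) (2 * k)) {..<m}"
proof -
  let ?K = "\<lambda>k::nat. {2 * k, Suc (2 * k)}"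
  have "indep_vars (\<lambda>k. PiM (?K k) (\<lambda>_. borel)) (\<lambda>k \<omega>. restrict (\<lambda>i. grid_increment (2 * m) i \<omega>) (?K k)) {..<m}"
  proof (rule indep_vars_restrict[OF indep_grid_increments])
    show "disjoint_family_on ?K {..<m}"
      unfolding disjoint_family_on_def
    proof (intro ballI impI)
      fix i j :: nat assume "i \<noteq> j"
      moreover from this have "2 * i \<noteq> Suc (2 * j)" "Suc (2 * i) \<noteq> 2 * j" by presburger+
      ultimately show "?K i \<inter> ?K j = {}" by auto
    qed
  qed auto
  then have "indep_vars (\<lambda>_. borel) (\<lambda>k \<omega>. restrict (\<lambda>i. grid_increment (2 * m) i \<omega>) (?K k) (Suc (2 * k)) -
      restrict (\<lambda>i. grid_increment (2 * m) i \<omega>) (?K k) (2 * k)) {..<m}"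
    by (rule indep_vars_compose2) measurable
  then show ?thesis by (simp add: second_diff_eq_grid[abs_def])
qed

lemma distr_grid_increment:
  "distr M borel (grid_increment n i) = distr M borel (X (1 / real n))"
proof -
  have "grid_increment n i = (\<lambda>\<omega>. X (real i / real n + 1 / real n) \<omega> - X (real i / real n) \<omega>)"
    by (simp add: grid_increment_def fun_eq_iff add.commute flip: add_divide_distrib)
  then show ?thesis using stationary_increments[of "real i / real n" "1 / real n"] by simp
qed

text \<open>A difference of two independent increments over time 1 / (2m), hence the symmetrised law
  at that time.\<close>

lemma char_second_diff:
  assumes triplet: "generating_triplet M X a \<gamma> \<nu>" and k: "k < m"
  shows "char (distr M borel (second_diff X (2 * m) (2 * k))) \<theta> =
    exp (complex_of_real (- (1 / real (2 * m) * (a\<^sup>2 * \<theta>\<^sup>2 + 2 * (LINT u|\<nu>. 1 - cos (\<theta> * u))))))"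
proof -
  interpret L: levy_measure \<nu> using triplet by (rule generating_triplet_levy_measure)
  let ?I = "grid_increment (2 * m)"
  have "indep_var borel ((\<lambda>f. f (Suc (2 * k))) \<circ> (\<lambda>\<omega>. restrict (\<lambda>i. ?I i \<omega>) {Suc (2 * k)}))
      borel ((\<lambda>f. f (2 * k)) \<circ> (\<lambda>\<omega>. restrict (\<lambda>i. ?I i \<omega>) {2 * k}))"
    by (rule indep_var_compose[OF indep_var_restrict[OF indep_grid_increments]]) (use k in auto)
  then have ind: "indep_var borel (?I (Suc (2 * k))) borel (?I (2 * k))" by (simp add: comp_def)
  show ?thesis unfolding second_diff_eq_grid[abs_def]
    by (rule L.char_symmetrised[OF prob_space_axioms ind distr_grid_increment distr_grid_increment])
      (use triplet in \<open>simp add: generating_triplet_def\<close>)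
qed

lemma distr_second_diff:
  assumes "generating_triplet M X a \<gamma> \<nu>" "k < m"
  shows "distr M borel (second_diff X (2 * m) (2 * k)) = distr M borel (second_diff X (2 * m) 0)"
proof (rule Levy_uniqueness)
  show "char (distr M borel (second_diff X (2 * m) (2 * k))) = char (distr M borel (second_diff X (2 * m) 0))"
    using char_second_diff[OF assms] char_second_diff[OF assms(1), of 0 m] assms(2) by (auto simp: fun_eq_iff)
qed auto

end

text \<open>Evaluation at \<open>t\<close> is a measurable map on path space, so independence and
  equality of path laws pass to the time marginals.\<close>

lemma indep_process_copies_at:
  assumes copies: "indep_process_copies N X1 X2 M X" and X: "X t \<in> borel_measurable M"
    and path: "path_of X \<in> M \<rightarrow>\<^sub>M path_space" and t: "0 \<le> t"
  shows "prob_space.indep_var N borel (X1 t) borel (X2 t)"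
    "distr N borel (X1 t) = distr M borel (X t)" "distr N borel (X2 t) = distr M borel (X t)"
proof -
  interpret N: prob_space N using copies by (simp add: indep_process_copies_def)
  have ind: "N.indep_var path_space (path_of X1) path_space (path_of X2)"
    and law: "distr N path_space (path_of X1) = distr M path_space (path_of X)"
      "distr N path_space (path_of X2) = distr M path_space (path_of X)"
    using copies by (auto simp: indep_process_copies_def)
  have ev: "(\<lambda>f. f t) \<in> path_space \<rightarrow>\<^sub>M borel" using t by (intro measurable_component_singleton) simp
  have path_t: "(\<lambda>f. f t) \<circ> path_of W = W t" for W :: "real \<Rightarrow> 'c \<Rightarrow> real"
    using t by (auto simp: path_of_def)
  show "N.indep_var borel (X1 t) borel (X2 t)"
    using N.indep_var_compose[OF ind ev ev] unfolding path_t .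
  have *: "distr N borel (W t) = distr M borel (X t)"
    if "path_of W \<in> N \<rightarrow>\<^sub>M path_space" "distr N path_space (path_of W) = distr M path_space (path_of X)" for W
    using distr_distr[OF ev that(1)] distr_distr[OF ev path] that(2) unfolding path_t by metis
  show "distr N borel (X1 t) = distr M borel (X t)" "distr N borel (X2 t) = distr M borel (X t)"
    by (rule *; use N.indep_var_rv1[OF ind] N.indep_var_rv2[OF ind] law in blast)+
qed

lemma char_normal_law:
  assumes "0 \<le> v" shows "char (normal_law 0 v) t = exp (- (t\<^sup>2 * v / 2))"
  using assms char_distr_scale[of "\<lambda>x. x" std_normal_distribution "sqrt v" t]
  by (simp add: normal_law_def char_std_normal_distribution power_mult_distrib distr_id2 mult.commute[of v])

theorem proposition5p2:
  fixes M :: "'a measure" and X :: "real \<Rightarrow> 'a \<Rightarrow> real"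
    and N :: "'b measure" and X1 X2 :: "real \<Rightarrow> 'b \<Rightarrow> real"
    and P :: "'c measure" and Z Z1 Z2 Z3 :: "'c \<Rightarrow> real"
    and a \<gamma> \<alpha> :: real and \<nu> :: "real measure"
    and \<Lambda> \<sigma>2 :: real
  assumes levy: "levy_process M X"
    and right_cont: "as_right_continuous M X"
    and triplet: "generating_triplet M X a \<gamma> \<nu>"
    and cases:
      "(a > 0 \<and> \<alpha> = 2) \<or>
       (a = 0 \<and> 0 < \<alpha> \<and> \<alpha> \<le> 2 \<and>
        (\<exists>c>0. levy_tail \<nu> \<sim>[at_right 0] (\<lambda>u. c * u powr (-\<alpha>))))"
    and copies_X: "indep_process_copies N X1 X2 M X"
    and prob_P: "prob_space P"
    and Z_meas: "Z \<in> borel_measurable P"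
    and Z_char: "\<And>\<theta>. char (distr P borel Z) \<theta> = complex_of_real (exp (- (\<bar>\<theta>\<bar> powr \<alpha>)))"
    and Z_indep: "prob_space.indep_vars P (\<lambda>_. borel) (\<lambda>i. [Z1, Z2, Z3] ! i) {..<3}"
    and Z_copies:
      "distr P borel Z1 = distr P borel Z"
      "distr P borel Z2 = distr P borel Z"
      "distr P borel Z3 = distr P borel Z"
  defines "\<Lambda> \<equiv> prob_space.expectation P (\<lambda>\<omega>. \<psi> (Z1 \<omega>) (Z2 \<omega>))"
    and "\<sigma>2 \<equiv> 2 * prob_space.variance P (\<lambda>\<omega>. \<psi> (Z1 \<omega>) (Z2 \<omega>))
           + 4 * covariance P (\<lambda>\<omega>. \<psi> (Z1 \<omega>) (Z2 \<omega>)) (\<lambda>\<omega>. \<psi> (Z2 \<omega>) (Z3 \<omega>))"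
  shows
    "(\<exists>c>0. weak_conv_along
        (\<lambda>t. distr N borel (\<lambda>\<omega>. t powr (-1 / \<alpha>) * (X1 t \<omega> - X2 t \<omega>)))
        (distr P borel (\<lambda>\<omega>. c * Z \<omega>)) (at_right 0)) \<and>
     (\<lambda>m. prob_space.expectation M (R2 X (2 * m))) \<longlonglongrightarrow> \<Lambda> \<and>
     (AE \<omega> in M. (\<lambda>m. R2 X (2 * m) \<omega>) \<longlonglongrightarrow> \<Lambda>) \<and>
     weak_conv_m
       (\<lambda>m. distr M borel (\<lambda>\<omega>. sqrt (real (2 * m)) *
               (R2 X (2 * m) \<omega> - prob_space.expectation M (R2 X (2 * m)))))
       (normal_law 0 \<sigma>2)"
proof -
  interpret X: levy_process M X by (rule levy)
  interpret L: levy_measure \<nu> using triplet by (rule generating_triplet_levy_measure)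
  interpret P: prob_space P by (rule prob_P)
  interpret N: prob_space N using copies_X by (simp add: indep_process_copies_def)
  note [measurable] = Z_meas
  have a: "a \<ge> 0" using triplet by (simp add: generating_triplet_def)
  have alpha: "0 < \<alpha>" using cases by auto
  \<comment> \<open>Minus the logarithm of the characteristic function of the symmetrised law at
    time \<open>t\<close>. The same limit along t to 0 feeds the first claim and, at t = 1 / (2m),
    the second differences.\<close>
  define E where "E t \<theta> = t * (a\<^sup>2 * \<theta>\<^sup>2 + 2 * (LINT u|\<nu>. 1 - cos (\<theta> * u)))" for t \<theta>
  obtain c where c: "0 < c"
    and E_lim: "\<And>\<theta>. ((\<lambda>t. E t (t powr (-1 / \<alpha>) * \<theta>)) \<longlongrightarrow> \<bar>c * \<theta>\<bar> powr \<alpha>) (at_right 0)"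
    using L.exponent_scaling[OF a cases] unfolding E_def by blast
  have exp_lim: "((\<lambda>t. exp (complex_of_real (- E t (t powr (-1 / \<alpha>) * \<theta>)))) \<longlongrightarrow>
      char (distr P borel (\<lambda>\<omega>. c * Z \<omega>)) \<theta>) (at_right 0)" for \<theta>
  proof -
    have "((\<lambda>t. exp (complex_of_real (- E t (t powr (-1 / \<alpha>) * \<theta>)))) \<longlongrightarrow>
        exp (complex_of_real (- (\<bar>c * \<theta>\<bar> powr \<alpha>)))) (at_right 0)"
      by (intro tendsto_intros E_lim)
    then show ?thesis unfolding exp_of_real by (simp add: char_distr_scale Z_char)
  qed

  have part1: "weak_conv_along (\<lambda>t. distr N borel (\<lambda>\<omega>. t powr (-1 / \<alpha>) * (X1 t \<omega> - X2 t \<omega>)))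
        (distr P borel (\<lambda>\<omega>. c * Z \<omega>)) (at_right 0)"
  proof (rule weak_conv_along_at_right_of_char)
    have path: "path_of X \<in> M \<rightarrow>\<^sub>M path_space"
      unfolding path_of_def[abs_def] by (intro measurable_restrict X.random_variable_at) simp
    have ind: "N.indep_var borel (X1 t) borel (X2 t)"
      and law: "distr N borel (X1 t) = distr M borel (X t)" "distr N borel (X2 t) = distr M borel (X t)"
      if "0 < t" for t
      using indep_process_copies_at[OF copies_X X.random_variable_at path, of t] that by auto
    have meas: "(\<lambda>\<omega>. X1 t \<omega> - X2 t \<omega>) \<in> borel_measurable N" if "0 < t" for t
      using N.indep_var_rv1[OF ind[OF that]] N.indep_var_rv2[OF ind[OF that]] by measurable
    show "real_distribution (distr N borel (\<lambda>\<omega>. t powr (-1 / \<alpha>) * (X1 t \<omega> - X2 t \<omega>)))" if "0 < t" for t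
      using meas[OF that] by (intro N.real_distribution_distr) simp
    show "real_distribution (distr P borel (\<lambda>\<omega>. c * Z \<omega>))" by simp
    fix \<theta>
    show "((\<lambda>t. char (distr N borel (\<lambda>\<omega>. t powr (-1 / \<alpha>) * (X1 t \<omega> - X2 t \<omega>))) \<theta>) \<longlongrightarrow>
        char (distr P borel (\<lambda>\<omega>. c * Z \<omega>)) \<theta>) (at_right 0)"
    proof (rule Lim_transform_eventually[OF exp_lim])
      show "eventually (\<lambda>t. exp (complex_of_real (- E t (t powr (-1 / \<alpha>) * \<theta>))) =
        char (distr N borel (\<lambda>\<omega>. t powr (-1 / \<alpha>) * (X1 t \<omega> - X2 t \<omega>))) \<theta>) (at_right 0)"
        using eventually_at_right_less[of "0::real"]
      proof eventually_elim
        case (elim t)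
        have "char (distr N borel (\<lambda>\<omega>. X1 t \<omega> - X2 t \<omega>)) \<theta>' = exp (complex_of_real (- E t \<theta>'))" for \<theta>'
          unfolding E_def
          by (rule L.char_symmetrised[OF N.prob_space_axioms ind law])
            (use elim triplet in \<open>auto simp: generating_triplet_def\<close>)
        then show ?case by (simp add: char_distr_scale[OF meas[OF elim]])
      qed
    qed
  qed

  define Y where "Y m k = second_diff X (2 * m) (2 * k)" for m k
  \<comment> \<open>This is n^(1/\<alpha>) for n = 2m, the factor t^(-1/\<alpha>) at t = 1 /
    n.\<close>
  define r where "r m = (1 / real (2 * m)) powr (-1 / \<alpha>)" for m
  have Y_meas [measurable]: "Y m k \<in> borel_measurable M" for m k
    unfolding Y_def by (rule X.second_diff_measurable)
  have Y_indep: "X.indep_vars (\<lambda>_. borel) (Y m) {..<m}" for m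
    using X.indep_second_diffs unfolding Y_def .
  have Y_law: "distr M borel (Y m k) = distr M borel (Y m 0)" if "k < m" for m k
    using X.distr_second_diff[OF triplet that] by (simp add: Y_def)
  have Y_conv: "weak_conv_m (\<lambda>m. distr M borel (\<lambda>\<omega>. r m * Y m 0 \<omega>)) (distr P borel (\<lambda>\<omega>. c * Z \<omega>))"
  proof (rule levy_continuity)
    fix \<theta>
    have t: "filterlim (\<lambda>m. 1 / real (2 * m)) (at_right 0) sequentially"
      unfolding filterlim_at
    proof
      show "eventually (\<lambda>m. 1 / real (2 * m) \<in> {0<..} \<and> 1 / real (2 * m) \<noteq> 0) sequentially"
        using eventually_gt_at_top[of 0] by eventually_elim simp
      have "(\<lambda>m. 1 / 2 * (1 / real m)) \<longlonglongrightarrow> 1 / 2 * 0" by (intro tendsto_intros lim_1_over_n)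
      then show "(\<lambda>m. 1 / real (2 * m)) \<longlonglongrightarrow> 0" by simp
    qed
    show "(\<lambda>m. char (distr M borel (\<lambda>\<omega>. r m * Y m 0 \<omega>)) \<theta>) \<longlonglongrightarrow> char (distr P borel (\<lambda>\<omega>. c * Z \<omega>)) \<theta>"
    proof (rule Lim_transform_eventually[OF filterlim_compose[OF exp_lim t]])
      show "eventually (\<lambda>m. exp (complex_of_real (- E (1 / real (2 * m)) ((1 / real (2 * m)) powr (-1 / \<alpha>) * \<theta>))) =
          char (distr M borel (\<lambda>\<omega>. r m * Y m 0 \<omega>)) \<theta>) sequentially"
        using eventually_gt_at_top[of 0]
      proof eventually_elim
        case (elim m)
        have "char (distr M borel (Y m 0)) \<theta>' = exp (complex_of_real (- E (1 / real (2 * m)) \<theta>'))" for \<theta>'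
          using X.char_second_diff[OF triplet elim, of \<theta>'] unfolding E_def Y_def .
        then show ?case by (simp add: char_distr_scale r_def)
      qed
    qed
  qed auto

  \<comment> \<open>The law of an unscaled second difference. It is the rescaled one that converges,
    and \<open>I_lim\<close> bridges the two by scale invariance.\<close>
  define \<mu> where "\<mu> m = distr M borel (Y m 0)" for m
  define I where "I F Q = (LINT (x, y, z)|cube_measure Q. F (\<psi> x y) (\<psi> y z))" for F :: "real \<Rightarrow> real \<Rightarrow> real" and Q
  have Z_rv: "Z1 \<in> borel_measurable P" "Z2 \<in> borel_measurable P" "Z3 \<in> borel_measurable P"
    using Z_indep by (auto simp: P.indep_vars_def2 lessThan_nat_numeral numeral_eq_Suc lessThan_Suc)
  have Z_law: "distr P borel ([Z1, Z2, Z3] ! k) = distr P borel Z" if "k < 3" for k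
    using that Z_copies by (auto simp: numeral_eq_Suc less_Suc_eq)
  have I_Z: "I F (distr P borel Z) = P.expectation (\<lambda>\<omega>. F (\<psi> (Z1 \<omega>) (Z2 \<omega>)) (\<psi> (Z2 \<omega>) (Z3 \<omega>)))"
    if F: "(\<lambda>p. F (fst p) (snd p)) \<in> borel_measurable (borel \<Otimes>\<^sub>M borel)" for F
    using P.expectation_psi_triple[OF Z_indep Z_law, of 0 1 2, OF _ _ _ _ _ _ _ F]
    by (simp add: I_def)
  have I_Y: "X.expectation (\<lambda>\<omega>. F (\<psi> (Y m i \<omega>) (Y m j \<omega>)) (\<psi> (Y m j \<omega>) (Y m k \<omega>))) = I F (\<mu> m)"
    if F: "(\<lambda>p. F (fst p) (snd p)) \<in> borel_measurable (borel \<Otimes>\<^sub>M borel)"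
      and "i < m" "j < m" "k < m" "i \<noteq> j" "j \<noteq> k" "i \<noteq> k" for F m i j k
    unfolding I_def \<mu>_def
    by (rule X.expectation_psi_triple[OF Y_indep Y_law]) (use that in auto)
  have I_lim: "(\<lambda>m. I F (\<mu> m)) \<longlonglongrightarrow> I F (distr P borel Z)"
    if F: "(\<lambda>p. F (fst p) (snd p)) \<in> borel_measurable (borel \<Otimes>\<^sub>M borel)"
      and bound: "\<And>p q. 0 \<le> p \<Longrightarrow> p \<le> 1 \<Longrightarrow> 0 \<le> q \<Longrightarrow> q \<le> 1 \<Longrightarrow> \<bar>F p q\<bar> \<le> 1"
      and cont: "\<And>P Q p q. P \<longlonglongrightarrow> p \<Longrightarrow> Q \<longlonglongrightarrow> q \<Longrightarrow> (\<lambda>n. F (P n) (Q n)) \<longlonglongrightarrow> F p q" for F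
  proof -
    have "measure (distr P borel Z) {0} = 0"
      by (rule stable_no_atom[OF _ alpha Z_char]) simp
    then have atom: "measure (distr P borel (\<lambda>\<omega>. c * Z \<omega>)) {0} = 0"
      using c by (simp add: measure_distr vimage_def)
    have "(\<lambda>m. I F (distr M borel (\<lambda>\<omega>. r m * Y m 0 \<omega>))) \<longlonglongrightarrow> I F (distr P borel (\<lambda>\<omega>. c * Z \<omega>))"
      unfolding I_def by (rule cube_measure_psi_tendsto[OF _ _ Y_conv atom F bound cont]) auto
    also have "I F (distr P borel (\<lambda>\<omega>. c * Z \<omega>)) = I F (distr P borel Z)"
      unfolding I_def using c by (intro cube_measure_psi_scale F prob_P Z_meas) simp
    finally show ?thesis
    proof (rule Lim_transform_eventually)
      show "eventually (\<lambda>m. I F (distr M borel (\<lambda>\<omega>. r m * Y m 0 \<omega>)) = I F (\<mu> m)) sequentially"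
        \<comment> \<open>The row \<open>m = 0\<close> is excluded because there
          \<open>r m = 0\<close>, division by zero being 0.\<close>
        using eventually_gt_at_top[of 0]
        by eventually_elim
          (auto simp: I_def \<mu>_def r_def intro!: cube_measure_psi_scale F X.prob_space_axioms Y_meas)
    qed
  qed

  \<comment> \<open>Mean, second moment and mixed moment of neighbouring values of
    \<open>\<psi>\<close>; centring turns the last two into variance and covariance.\<close>
  let ?F1 = "\<lambda>(p::real) (q::real). p" and ?F2 = "\<lambda>(p::real) (q::real). p\<^sup>2" and ?F3 = "\<lambda>(p::real) (q::real). p * q"
  have F_meas: "(\<lambda>p. ?F1 (fst p) (snd p)) \<in> borel_measurable (borel \<Otimes>\<^sub>M borel)"
    "(\<lambda>p. ?F2 (fst p) (snd p)) \<in> borel_measurable (borel \<Otimes>\<^sub>M borel)"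
    "(\<lambda>p. ?F3 (fst p) (snd p)) \<in> borel_measurable (borel \<Otimes>\<^sub>M borel)"
    by measurable
  define \<theta> where "\<theta> m = I ?F1 (\<mu> m)" for m
  define v where "v m = I ?F2 (\<mu> m) - (\<theta> m)\<^sup>2" for m
  define w where "w m = I ?F3 (\<mu> m) - (\<theta> m)\<^sup>2" for m
  define V0 where "V0 = P.variance (\<lambda>\<omega>. \<psi> (Z1 \<omega>) (Z2 \<omega>))"
  define W0 where "W0 = covariance P (\<lambda>\<omega>. \<psi> (Z1 \<omega>) (Z2 \<omega>)) (\<lambda>\<omega>. \<psi> (Z2 \<omega>) (Z3 \<omega>))"
  have \<theta>_lim: "\<theta> \<longlonglongrightarrow> \<Lambda>"
    using I_lim[OF F_meas(1)] unfolding \<theta>_def \<Lambda>_def I_Z[OF F_meas(1)] by simp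
  have v_lim: "v \<longlonglongrightarrow> V0"
  proof -
    have "(\<lambda>m. I ?F2 (\<mu> m)) \<longlonglongrightarrow> I ?F2 (distr P borel Z)"
      by (rule I_lim[OF F_meas(2)]) (auto intro: tendsto_power simp: power_le_one)
    then have "v \<longlonglongrightarrow> I ?F2 (distr P borel Z) - \<Lambda>\<^sup>2"
      unfolding v_def by (intro tendsto_intros \<theta>_lim)
    moreover have "V0 = I ?F2 (distr P borel Z) - \<Lambda>\<^sup>2"
      unfolding V0_def I_Z[OF F_meas(2)] \<Lambda>_def
      by (rule P.variance_eq[OF P.integrable_psi P.integrable_psi_prod[of Z1 Z2 Z1 Z2, folded power2_eq_square]])
        (rule Z_rv)+
    ultimately show ?thesis by simp
  qed
  have w_lim: "w \<longlonglongrightarrow> W0"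
  proof -
    have "(\<lambda>m. I ?F3 (\<mu> m)) \<longlonglongrightarrow> I ?F3 (distr P borel Z)"
      by (rule I_lim[OF F_meas(3)]) (auto intro: tendsto_mult mult_le_one simp: abs_mult)
    then have "w \<longlonglongrightarrow> I ?F3 (distr P borel Z) - \<Lambda>\<^sup>2"
      unfolding w_def by (intro tendsto_intros \<theta>_lim)
    moreover have "W0 = I ?F3 (distr P borel Z) - \<Lambda>\<^sup>2"
    proof -
      have i: "integrable P (\<lambda>\<omega>. \<psi> (Z1 \<omega>) (Z2 \<omega>) * \<psi> (Z2 \<omega>) (Z3 \<omega>))"
        by (intro P.integrable_psi_prod Z_rv)
      \<comment> \<open>The indices 1, 2 are the pair of interest; 0 only fills the third
        coordinate, which \<open>?F1\<close> ignores.\<close>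
      have "P.expectation (\<lambda>\<omega>. \<psi> (Z2 \<omega>) (Z3 \<omega>)) = I ?F1 (distr P borel Z)"
        using P.expectation_psi_triple[OF Z_indep Z_law, of 1 2 0, OF _ _ _ _ _ _ _ F_meas(1)]
        by (simp add: I_def)
      then have m23: "P.expectation (\<lambda>\<omega>. \<psi> (Z2 \<omega>) (Z3 \<omega>)) = \<Lambda>"
        unfolding I_Z[OF F_meas(1)] \<Lambda>_def .
      have "W0 = P.expectation (\<lambda>\<omega>. \<psi> (Z1 \<omega>) (Z2 \<omega>) * \<psi> (Z2 \<omega>) (Z3 \<omega>) - \<Lambda> * \<psi> (Z2 \<omega>) (Z3 \<omega>)
          - \<Lambda> * \<psi> (Z1 \<omega>) (Z2 \<omega>) + \<Lambda>\<^sup>2)"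
        unfolding W0_def covariance_def m23 \<Lambda>_def[symmetric]
        by (simp add: algebra_simps power2_eq_square)
      also have "\<dots> = P.expectation (\<lambda>\<omega>. \<psi> (Z1 \<omega>) (Z2 \<omega>) * \<psi> (Z2 \<omega>) (Z3 \<omega>)) - \<Lambda> * \<Lambda> - \<Lambda> * \<Lambda> + \<Lambda>\<^sup>2"
        using i P.integrable_psi Z_rv by (simp add: m23 P.prob_space) (simp add: \<Lambda>_def)
      finally show ?thesis unfolding I_Z[OF F_meas(3)] by (simp add: power2_eq_square)
    qed
    ultimately show ?thesis by simp
  qed

  \<comment> \<open>Three distinct indices must exist, since even the mean is expressed through a
    law of triples; hence \<open>3 \<le> m\<close>.\<close>
  have \<theta>01: "0 \<le> \<theta> m \<and> \<theta> m \<le> 1" if "3 \<le> m" for m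
  proof -
    have "\<theta> m = X.expectation (\<lambda>\<omega>. \<psi> (Y m 0 \<omega>) (Y m 1 \<omega>))"
      using I_Y[OF F_meas(1), of 0 m 1 2] that by (simp add: \<theta>_def)
    moreover have "X.expectation (\<lambda>\<omega>. \<psi> (Y m 0 \<omega>) (Y m 1 \<omega>)) \<le> X.expectation (\<lambda>\<omega>. 1)"
      by (rule integral_mono[OF X.integrable_const_bound[where B=1]]) (auto simp: psi_nonneg psi_le_1)
    ultimately show ?thesis by (simp add: psi_nonneg X.prob_space)
  qed
  have psi_int_X: "integrable M (\<lambda>\<omega>. \<psi> (Y m i \<omega>) (Y m j \<omega>))"
    "integrable M (\<lambda>\<omega>. \<psi> (Y m i \<omega>) (Y m j \<omega>) * \<psi> (Y m i' \<omega>) (Y m j' \<omega>))" for m i j i' j'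
    by (intro X.integrable_psi X.integrable_psi_prod Y_meas)+
  have pair_mean: "X.expectation (\<lambda>\<omega>. \<psi> (Y m k \<omega>) (Y m (Suc k) \<omega>)) = \<theta> m"
    and pair_square: "X.expectation (\<lambda>\<omega>. (\<psi> (Y m k \<omega>) (Y m (Suc k) \<omega>))\<^sup>2) = I ?F2 (\<mu> m)"
    if "3 \<le> m" "Suc k < m" for m k
  proof -
    \<comment> \<open>A third index below \<open>m\<close>, different from \<open>k\<close> and
      \<open>Suc k\<close>, to complete the triple.\<close>
    define l :: nat where "l = (if k = 0 then 2 else 0)"
    have l: "l < m" "Suc k \<noteq> l" "k \<noteq> l" using that by (auto simp: l_def)
    show "X.expectation (\<lambda>\<omega>. \<psi> (Y m k \<omega>) (Y m (Suc k) \<omega>)) = \<theta> m"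
      unfolding \<theta>_def by (rule I_Y[OF F_meas(1)]) (use that l in auto)
    show "X.expectation (\<lambda>\<omega>. (\<psi> (Y m k \<omega>) (Y m (Suc k) \<omega>))\<^sup>2) = I ?F2 (\<mu> m)"
      by (rule I_Y[OF F_meas(2)]) (use that l in auto)
  qed
  have arr: "pair_array M (Y m) (\<lambda>x y. \<psi> x y - \<theta> m) m (v m) (w m)" if m: "3 \<le> m" for m
  proof
    show "X.indep_vars (\<lambda>_. borel) (Y m) {..<m}" by (rule Y_indep)
    show "(\<lambda>p. \<psi> (fst p) (snd p) - \<theta> m) \<in> borel_measurable (borel \<Otimes>\<^sub>M borel)" by measurable
    show "\<bar>\<psi> x y - \<theta> m\<bar> \<le> 1" for x y
      using psi_nonneg[of x y] psi_le_1[of x y] \<theta>01[OF m] by (simp add: abs_le_iff)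
    show "X.expectation (\<lambda>\<omega>. \<psi> (Y m k \<omega>) (Y m (Suc k) \<omega>) - \<theta> m) = 0" if "Suc k < m" for k
      using pair_mean[OF m that] psi_int_X by (simp add: X.prob_space)
    show "X.expectation (\<lambda>\<omega>. (\<psi> (Y m k \<omega>) (Y m (Suc k) \<omega>) - \<theta> m)\<^sup>2) = v m" if k: "Suc k < m" for k
      using X.variance_eq[OF psi_int_X(1) psi_int_X(2)[of m k "Suc k" k "Suc k", folded power2_eq_square]]
      unfolding pair_mean[OF m k] pair_square[OF m k] v_def .
    show "X.expectation (\<lambda>\<omega>. (\<psi> (Y m k \<omega>) (Y m (Suc k) \<omega>) - \<theta> m) *
        (\<psi> (Y m (Suc k) \<omega>) (Y m (Suc (Suc k)) \<omega>) - \<theta> m)) = w m" if k: "Suc (Suc k) < m" for k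
    proof -
      have p: "X.expectation (\<lambda>\<omega>. \<psi> (Y m k \<omega>) (Y m (Suc k) \<omega>) * \<psi> (Y m (Suc k) \<omega>) (Y m (Suc (Suc k)) \<omega>)) = I ?F3 (\<mu> m)"
        by (rule I_Y[OF F_meas(3)]) (use k in auto)
      have "X.expectation (\<lambda>\<omega>. (\<psi> (Y m k \<omega>) (Y m (Suc k) \<omega>) - \<theta> m) *
          (\<psi> (Y m (Suc k) \<omega>) (Y m (Suc (Suc k)) \<omega>) - \<theta> m)) =
        X.expectation (\<lambda>\<omega>. \<psi> (Y m k \<omega>) (Y m (Suc k) \<omega>) * \<psi> (Y m (Suc k) \<omega>) (Y m (Suc (Suc k)) \<omega>)
          - \<theta> m * \<psi> (Y m (Suc k) \<omega>) (Y m (Suc (Suc k)) \<omega>) - \<theta> m * \<psi> (Y m k \<omega>) (Y m (Suc k) \<omega>) + (\<theta> m)\<^sup>2)"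
        by (simp add: algebra_simps power2_eq_square)
      also have "\<dots> = I ?F3 (\<mu> m) - \<theta> m * \<theta> m - \<theta> m * \<theta> m + (\<theta> m)\<^sup>2"
        using psi_int_X pair_mean[OF m, of k] pair_mean[OF m, of "Suc k"] k by (simp add: p X.prob_space)
      finally show ?thesis by (simp add: w_def power2_eq_square)
    qed
  qed
  have R2_Y: "R2 X (2 * m) \<omega> = 1 / (real m - 1) * (\<Sum>k<m - 1. \<psi> (Y m k \<omega>) (Y m (Suc k) \<omega>))" if "3 \<le> m" for m \<omega>
    using that unfolding Y_def by (intro R2_even) simp
  have R2_mean: "X.expectation (R2 X (2 * m)) = \<theta> m" if m: "3 \<le> m" for m
  proof -
    have "X.expectation (R2 X (2 * m)) = 1 / (real m - 1) * (\<Sum>k<m - 1. X.expectation (\<lambda>\<omega>. \<psi> (Y m k \<omega>) (Y m (Suc k) \<omega>)))"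
      unfolding ext[OF R2_Y[OF m]] using psi_int_X by simp
    also have "(\<Sum>k<m - 1. X.expectation (\<lambda>\<omega>. \<psi> (Y m k \<omega>) (Y m (Suc k) \<omega>))) = (real m - 1) * \<theta> m"
      using m pair_mean[OF m] by (simp add: of_nat_diff)
    finally show ?thesis using m by simp
  qed
  have R2_centred: "R2 X (2 * m) \<omega> - \<theta> m = 1 / (real m - 1) * (\<Sum>k<m - 1. \<psi> (Y m k \<omega>) (Y m (Suc k) \<omega>) - \<theta> m)"
    if m: "3 \<le> m" for m \<omega>
    using m by (simp add: R2_Y[OF m] sum_subtractf of_nat_diff right_diff_distrib)
  have ge3: "eventually (\<lambda>m::nat. 3 \<le> m) sequentially" by (rule eventually_ge_at_top)

  have part2: "(\<lambda>m. X.expectation (R2 X (2 * m))) \<longlonglongrightarrow> \<Lambda>"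
    using \<theta>_lim by (rule Lim_transform_eventually) (use ge3 in \<open>eventually_elim, simp add: R2_mean\<close>)

  have "AE \<omega> in M. (\<lambda>m. 1 / (real m - 1) *
      (\<Sum>k<m - 1. \<psi> (Y m k \<omega>) (Y m (Suc k) \<omega>) - \<theta> m)) \<longlonglongrightarrow> 0"
    by (rule pair_array_strong_law[OF X.prob_space_axioms arr])
  then have part3: "AE \<omega> in M. (\<lambda>m. R2 X (2 * m) \<omega>) \<longlonglongrightarrow> \<Lambda>"
  proof eventually_elim
    case (elim \<omega>)
    from tendsto_add[OF elim \<theta>_lim]
    have "(\<lambda>m. 1 / (real m - 1) * (\<Sum>k<m - 1. \<psi> (Y m k \<omega>) (Y m (Suc k) \<omega>) - \<theta> m) + \<theta> m) \<longlonglongrightarrow> \<Lambda>" by simp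
    then show ?case
    proof (rule Lim_transform_eventually)
      show "eventually (\<lambda>m. 1 / (real m - 1) * (\<Sum>k<m - 1. \<psi> (Y m k \<omega>) (Y m (Suc k) \<omega>) - \<theta> m) + \<theta> m =
          R2 X (2 * m) \<omega>) sequentially"
        using ge3 by eventually_elim (simp only: R2_centred[symmetric] diff_add_cancel)
    qed
  qed

  have char_lim: "(\<lambda>m. char (distr M borel (\<lambda>\<omega>. sqrt (real (2 * m)) *
      (R2 X (2 * m) \<omega> - X.expectation (R2 X (2 * m))))) t) \<longlonglongrightarrow> complex_of_real (exp (- (t\<^sup>2 * (V0 + 2 * W0))))" for t
  proof -
    have "eventually (\<lambda>m. pair_array M (Y m) (\<lambda>x y. \<psi> x y - \<theta> m) m (v m) (w m)) sequentially"
      using ge3 by eventually_elim (rule arr)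
    from char_pair_array_tendsto[OF this v_lim w_lim, of t] show ?thesis
    proof (rule Lim_transform_eventually)
      show "eventually (\<lambda>m. char (distr M borel (\<lambda>\<omega>. sqrt (2 * real m) / (real m - 1) *
          (\<Sum>k<m - 1. \<psi> (Y m k \<omega>) (Y m (Suc k) \<omega>) - \<theta> m))) t =
        char (distr M borel (\<lambda>\<omega>. sqrt (real (2 * m)) * (R2 X (2 * m) \<omega> - X.expectation (R2 X (2 * m))))) t) sequentially"
        using ge3 by eventually_elim (simp add: R2_mean R2_centred)
    qed
  qed
  have real_distr: "real_distribution (distr M borel (\<lambda>\<omega>. sqrt (real (2 * m)) *
      (R2 X (2 * m) \<omega> - X.expectation (R2 X (2 * m)))))" for m
    by (rule X.real_distribution_distr) measurable
  \<comment> \<open>The sign of the limiting variance is read off the limit itself: characteristic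
    functions have modulus at most 1, hence so has exp(-(V0 + 2 W0)). It is needed because
    \<open>normal_law\<close> takes a square root of the variance.\<close>
  have nonneg: "0 \<le> V0 + 2 * W0"
  proof -
    have "cmod (complex_of_real (exp (- (1\<^sup>2 * (V0 + 2 * W0))))) \<le> 1"
      by (rule tendsto_upperbound[OF tendsto_norm[OF char_lim[of 1]]])
        (use real_distribution.cmod_char_le_1[OF real_distr] in auto)
    then show ?thesis by simp
  qed
  have \<sigma>2: "\<sigma>2 = 2 * (V0 + 2 * W0)" by (simp add: \<sigma>2_def V0_def W0_def)
  have part4: "weak_conv_m (\<lambda>m. distr M borel (\<lambda>\<omega>. sqrt (real (2 * m)) *
      (R2 X (2 * m) \<omega> - X.expectation (R2 X (2 * m))))) (normal_law 0 \<sigma>2)"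
  proof (rule levy_continuity[OF real_distr])
    interpret G: real_distribution std_normal_distribution by (rule real_dist_normal_dist)
    show "real_distribution (normal_law 0 \<sigma>2)"
      unfolding normal_law_def by (rule G.real_distribution_distr) measurable
    show "(\<lambda>m. char (distr M borel (\<lambda>\<omega>. sqrt (real (2 * m)) *
      (R2 X (2 * m) \<omega> - X.expectation (R2 X (2 * m))))) t) \<longlonglongrightarrow> char (normal_law 0 \<sigma>2) t" for t
    proof -
      have "0 \<le> \<sigma>2" using nonneg \<sigma>2 by simp
      then have "char (normal_law 0 \<sigma>2) t = complex_of_real (exp (- (t\<^sup>2 * \<sigma>2 / 2)))"
        by (simp add: char_normal_law)
      also have "t\<^sup>2 * \<sigma>2 / 2 = t\<^sup>2 * (V0 + 2 * W0)" by (simp add: \<sigma>2)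
      finally show ?thesis using char_lim[of t] by simp
    qed
  qed
  from part1 part2 part3 part4 c show ?thesis by blast
qed

end
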